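(* Let $H$ be a subgroup of a finite group $G$. Let $\Gamma_H(G)=\coprod_{i=1}^{[G:H]}\coprod_{j=1}^{c_i}\Gamma_{i,j}$ be the decomposition of $\Gamma_H(G)$ into connected components, where the objects in $\Gamma_{i,j}$ have cardinality $i\cdot|H|$ for all $j=1,2,\dots,c_i$. Let $A_{i,j}$ be an object of $\Gamma_{i,j}$, and set $K_{i,j}:=K_{A_{i,j}}$ and $m_{i,j}:=m_{A_{i,j}}$ for all $i$ and $j$. Then there are algebra isomorphisms $$\mathbb{C}\Gamma_H(G)\cong\prod_{i=1}^{[G:H]}\prod_{j=1}^{c_i}M_{m_{i,j}}(\mathbb{C}[K_{i,j}])\cong\prod_{i=1}^{[G:H]}\prod_{j=1}^{c_i}\prod_{k=1}^{e_{i,j}}M_{m_{i,j}\cdot d_k}(\mathbb{C}),$$ where $\mathbb{C}[K_{i,j}]\cong\prod_{k=1}^{e_{i,j}}M_{d_k}(\mathbb{C})$ is the Artin–Wedderburn decomposition of $\mathbb{C}[K_{i,j}]$ (the integers $d_k$ depending on $i,j$). In particular, $\mathbb{C}\Gamma_H(G)$ is a semisimple ring.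
   Context: $\mathcal{P}_H(G/H):=\{A\subseteq G\mid H\subseteq A\text{ and }A\text{ is a union of left cosets of }H\}$. $\Gamma_H(G):=\{(A,g)\in\mathcal{P}_H(G/H)\times G\mid g^{-1}\in A\}$ is the groupoid with operation $(A,g)\cdot(B,h):=(B,gh)$ if $A=hB$, and undefined otherwise. Its objects are the elements of $\mathcal{P}_H(G/H)$, with source $s(A,g)=A$ and range $r(A,g)=gA$. Its connected components are the subgroupoids corresponding to the connected components of the graph whose vertices are the objects and which has an edge from $s(\gamma)$ to $r(\gamma)$ for each $\gamma\in\Gamma_H(G)$; all objects in a connected component have the same cardinality as subsets of $G$. The groupoid algebra $\mathbb{C}\Gamma_H(G)$ has $\Gamma_H(G)$ as $\mathbb{C}$-basis, with products that are undefined in $\Gamma_H(G)$ set to $0$. For $A\in\mathcal{P}_H(G/H)$: $K_A:=\{g\in G\mid gA=A\}$, and $m_A$ is the number of objects in the connected component of $\Gamma_H(G)$ containing $A$ (it equals $|A|/|K_A|$). *)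

theory Defs
  imports "HOL-Algebra.Algebra" "Jordan_Normal_Form.Matrix"
begin

section \<open>Complex algebras\<close>

text \<open>
  A complex algebra is given by a record of type \<open>(complex, 'b) module\<close>, which carries the ring
  operations and the scalar multiplication. The locale \<^locale>\<open>algebra\<close> is not used because it
  requires the ring to be commutative.
\<close>

definition alg_iso ::
    "(complex, 'b, 'm) module_scheme \<Rightarrow> (complex, 'c, 'n) module_scheme \<Rightarrow> ('b \<Rightarrow> 'c) set" where
  "alg_iso R S = {\<phi> \<in> ring_iso R S. \<forall>a. \<forall>x \<in> carrier R. \<phi> (a \<odot>\<^bsub>R\<^esub> x) = a \<odot>\<^bsub>S\<^esub> \<phi> x}"

definition alg_isomorphic ::
    "(complex, 'b, 'm) module_scheme \<Rightarrow> (complex, 'c, 'n) module_scheme \<Rightarrow> bool"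
    (infix \<open>\<simeq>\<^sub>a\<^sub>l\<^sub>g\<close> 50) where
  "R \<simeq>\<^sub>a\<^sub>l\<^sub>g S \<longleftrightarrow> alg_iso R S \<noteq> {}"

definition prod_alg ::
    "'i set \<Rightarrow> ('i \<Rightarrow> (complex, 'b, 'm) module_scheme) \<Rightarrow> (complex, 'i \<Rightarrow> 'b) module" where
  "prod_alg I R = \<lparr>
     carrier = (\<Pi>\<^sub>E i\<in>I. carrier (R i)),
     monoid.mult = (\<lambda>x y. \<lambda>i\<in>I. x i \<otimes>\<^bsub>R i\<^esub> y i),
     monoid.one = (\<lambda>i\<in>I. \<one>\<^bsub>R i\<^esub>),
     ring.zero = (\<lambda>i\<in>I. \<zero>\<^bsub>R i\<^esub>),
     ring.add = (\<lambda>x y. \<lambda>i\<in>I. x i \<oplus>\<^bsub>R i\<^esub> y i),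
     module.smult = (\<lambda>a x. \<lambda>i\<in>I. a \<odot>\<^bsub>R i\<^esub> x i)\<rparr>"

text \<open>
  The algebra of \<open>n \<times> n\<close> matrices over an algebra \<open>R\<close> given by a record. The operations on
  \<^typ>\<open>'a mat\<close> in the library use type class operations of the entries and so do not apply here;
  for complex entries the library's \<^const>\<open>module_mat\<close> does.
\<close>

definition mat_alg :: "nat \<Rightarrow> (complex, 'b, 'm) module_scheme \<Rightarrow> (complex, 'b mat) module" where
  "mat_alg n R = \<lparr>
     carrier = {M \<in> carrier_mat n n. elements_mat M \<subseteq> carrier R},
     monoid.mult = (\<lambda>M N. mat n n (\<lambda>(i, j). \<Oplus>\<^bsub>R\<^esub>k\<in>{..<n}. M $$ (i, k) \<otimes>\<^bsub>R\<^esub> N $$ (k, j))),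
     monoid.one = mat n n (\<lambda>(i, j). if i = j then \<one>\<^bsub>R\<^esub> else \<zero>\<^bsub>R\<^esub>),
     ring.zero = mat n n (\<lambda>_. \<zero>\<^bsub>R\<^esub>),
     ring.add = (\<lambda>M N. mat n n (\<lambda>ij. M $$ ij \<oplus>\<^bsub>R\<^esub> N $$ ij)),
     module.smult = (\<lambda>a M. mat n n (\<lambda>ij. a \<odot>\<^bsub>R\<^esub> M $$ ij))\<rparr>"

abbreviation complex_mat_alg :: "nat \<Rightarrow> (complex, complex mat) module" where
  "complex_mat_alg n \<equiv> module_mat TYPE(complex) n n"

text \<open>
  The complex algebra with basis \<open>S\<close>, where the product of two basis elements is given by the
  partial operation \<open>p\<close> and is \<open>0\<close> if undefined. An element is the function of its coefficients.
  The unit is the sum of the elements of \<open>U\<close>.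
\<close>

definition basis_alg ::
    "'b set \<Rightarrow> ('b \<Rightarrow> 'b \<Rightarrow> 'b option) \<Rightarrow> 'b set \<Rightarrow> (complex, 'b \<Rightarrow> complex) module" where
  "basis_alg S p U = \<lparr>
     carrier = {f. finite {x. f x \<noteq> 0} \<and> {x. f x \<noteq> 0} \<subseteq> S},
     monoid.mult = (\<lambda>f g z. \<Sum>(x, y) \<in> {(x, y). f x \<noteq> 0 \<and> g y \<noteq> 0 \<and> p x y = Some z}. f x * g y),
     monoid.one = (\<lambda>x. if x \<in> U then 1 else 0),
     ring.zero = (\<lambda>_. 0),
     ring.add = (\<lambda>f g x. f x + g x),
     module.smult = (\<lambda>a f x. a * f x)\<rparr>"

definition group_alg :: "('g, 'm) monoid_scheme \<Rightarrow> (complex, 'g \<Rightarrow> complex) module" where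
  "group_alg G = basis_alg (carrier G) (\<lambda>x y. Some (x \<otimes>\<^bsub>G\<^esub> y)) {\<one>\<^bsub>G\<^esub>}"

definition artin_wedderburn ::
    "(complex, 'b, 'm) module_scheme \<Rightarrow> nat \<Rightarrow> (nat \<Rightarrow> nat) \<Rightarrow> bool" where
  "artin_wedderburn R e d \<longleftrightarrow>
     (\<forall>k\<in>{1..e}. d k \<ge> 1) \<and> R \<simeq>\<^sub>a\<^sub>l\<^sub>g prod_alg {1..e} (\<lambda>k. complex_mat_alg (d k))"


section \<open>Semisimple rings\<close>

definition left_ideal :: "'a set \<Rightarrow> ('a, 'm) ring_scheme \<Rightarrow> bool" where
  "left_ideal I R \<longleftrightarrow>
     additive_subgroup I R \<and> (\<forall>r \<in> carrier R. \<forall>x \<in> I. r \<otimes>\<^bsub>R\<^esub> x \<in> I)"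

text \<open>
  A ring is semisimple if it is semisimple as a left module over itself, i.e. every submodule of
  the left regular module is a direct summand.
\<close>

definition semisimple_ring :: "('a, 'm) ring_scheme \<Rightarrow> bool" where
  "semisimple_ring R \<longleftrightarrow>
     ring R \<and>
     (\<forall>I. left_ideal I R \<longrightarrow>
        (\<exists>J. left_ideal J R \<and> I \<inter> J = {\<zero>\<^bsub>R\<^esub>} \<and> I <+>\<^bsub>R\<^esub> J = carrier R))"


section \<open>The groupoid \<open>\<Gamma>\<^sub>H(G)\<close>\<close>

definition coset_unions :: "('g, 'm) monoid_scheme \<Rightarrow> 'g set \<Rightarrow> 'g set set" where
  "coset_unions G H =
     {A. A \<subseteq> carrier G \<and> H \<subseteq> A \<and> (\<exists>S \<subseteq> carrier G. A = (\<Union>x\<in>S. x <#\<^bsub>G\<^esub> H))}"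

definition gpd :: "('g, 'm) monoid_scheme \<Rightarrow> 'g set \<Rightarrow> ('g set \<times> 'g) set" where
  "gpd G H = {(A, g). A \<in> coset_unions G H \<and> g \<in> carrier G \<and> inv\<^bsub>G\<^esub> g \<in> A}"

definition gpd_mult ::
    "('g, 'm) monoid_scheme \<Rightarrow> 'g set \<times> 'g \<Rightarrow> 'g set \<times> 'g \<Rightarrow> ('g set \<times> 'g) option" where
  "gpd_mult G = (\<lambda>(A, g) (B, h). if A = h <#\<^bsub>G\<^esub> B then Some (B, g \<otimes>\<^bsub>G\<^esub> h) else None)"

definition gpd_source :: "'g set \<times> 'g \<Rightarrow> 'g set" where
  "gpd_source = (\<lambda>(A, g). A)"

definition gpd_range :: "('g, 'm) monoid_scheme \<Rightarrow> 'g set \<times> 'g \<Rightarrow> 'g set" where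
  "gpd_range G = (\<lambda>(A, g). g <#\<^bsub>G\<^esub> A)"

text \<open>The unit of the groupoid algebra is the sum of the identities \<open>(A, 1)\<close> of the objects.\<close>

definition gpd_alg ::
    "('g, 'm) monoid_scheme \<Rightarrow> 'g set \<Rightarrow> (complex, 'g set \<times> 'g \<Rightarrow> complex) module" where
  "gpd_alg G H = basis_alg (gpd G H) (gpd_mult G) (coset_unions G H \<times> {\<one>\<^bsub>G\<^esub>})"

definition gpd_edges :: "('g, 'm) monoid_scheme \<Rightarrow> 'g set \<Rightarrow> ('g set \<times> 'g set) set" where
  "gpd_edges G H = (\<lambda>\<gamma>. (gpd_source \<gamma>, gpd_range G \<gamma>)) ` gpd G H"

definition gpd_connected :: "('g, 'm) monoid_scheme \<Rightarrow> 'g set \<Rightarrow> ('g set \<times> 'g set) set" where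
  "gpd_connected G H =
     (gpd_edges G H \<union> (gpd_edges G H)\<inverse>)\<^sup>* \<inter> (coset_unions G H \<times> coset_unions G H)"

text \<open>
  A connected component is a subgroupoid, represented by its set of arrows. The objects of a
  subgroupoid are the sources of its arrows, since it contains the identities of its objects.
\<close>

definition gpd_components :: "('g, 'm) monoid_scheme \<Rightarrow> 'g set \<Rightarrow> ('g set \<times> 'g) set set" where
  "gpd_components G H =
     (\<lambda>Y. {\<gamma> \<in> gpd G H. gpd_source \<gamma> \<in> Y}) ` (coset_unions G H // gpd_connected G H)"

definition gpd_objects :: "('g set \<times> 'g) set \<Rightarrow> 'g set set" where
  "gpd_objects \<Delta> = gpd_source ` \<Delta>"

definition stab :: "('g, 'm) monoid_scheme \<Rightarrow> 'g set \<Rightarrow> 'g set" where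
  "stab G A = {g \<in> carrier G. g <#\<^bsub>G\<^esub> A = A}"

definition comp_size :: "('g, 'm) monoid_scheme \<Rightarrow> 'g set \<Rightarrow> 'g set \<Rightarrow> nat" where
  "comp_size G H A = card (gpd_connected G H `` {A})"

text \<open>The group algebra of the subgroup \<open>K\<^sub>A\<close>.\<close>

abbreviation stab_alg :: "('g, 'm) monoid_scheme \<Rightarrow> 'g set \<Rightarrow> (complex, 'g \<Rightarrow> complex) module" where
  "stab_alg G A \<equiv> group_alg (G\<lparr>carrier := stab G A\<rparr>)"

end

(* Both parts of the structure theory come from one Peirce decomposition: if 1 is a sum of
   orthogonal idempotents u v, where the v x u fall into blocks with v u' = delta p inside a block
   and v x u' = 0 across blocks, then R is the product over the blocks of the matrix algebras over
   the corners p R p. For the groupoid algebra the idempotents are the identities of the objects,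
   the blocks are the connected components and the corner at A is the group algebra of K_A. For a
   semisimple finite-dimensional algebra the idempotents are primitive and all corners are the
   complex numbers, which is Artin-Wedderburn. Semisimplicity holds for the algebra of any finite
   groupoid, groups included: the inner product for which the arrows are orthonormal makes left
   multiplication by an arrow adjoint to left multiplication by its inverse, so orthogonal
   complements of left ideals are left ideals. *)
theory Submission
  imports Defs "HOL-Computational_Algebra.Fundamental_Theorem_Algebra"
begin

section \<open>Isomorphisms of complex algebras\<close>

text \<open>The structure theory is carried out with elements instead of modules. A decomposition of
  the regular module into left ideals R p is a family of orthogonal idempotents, an isomorphism of R
  p with R q is a pair x, y with x y = p and y x = q, and Schur's lemma becomes the statement that p
  R p consists of the multiples of p for primitive p. That statement rests on an eigenvalue: finite
  dimension gives a polynomial annihilating an element of the corner, and over the complex numbers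
  the polynomial has a root. Semisimplicity enters this argument through an idempotent in each left
  ideal that acts on the ideal as a right unit. The second isomorphism of the theorem is derived
  from an arbitrary Artin-Wedderburn decomposition of the stabiliser algebras, so it holds for every
  choice of the d_k: matrices over a product are families of matrices, and an m by m matrix of d by
  d blocks is an m d by m d matrix.\<close>

lemma alg_isoI:
  assumes "\<And>x. x \<in> carrier R \<Longrightarrow> h x \<in> carrier S"
    and "\<And>x y. x \<in> carrier R \<Longrightarrow> y \<in> carrier R \<Longrightarrow> h (x \<otimes>\<^bsub>R\<^esub> y) = h x \<otimes>\<^bsub>S\<^esub> h y"
    and "\<And>x y. x \<in> carrier R \<Longrightarrow> y \<in> carrier R \<Longrightarrow> h (x \<oplus>\<^bsub>R\<^esub> y) = h x \<oplus>\<^bsub>S\<^esub> h y"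
    and "h \<one>\<^bsub>R\<^esub> = \<one>\<^bsub>S\<^esub>"
    and "\<And>a x. x \<in> carrier R \<Longrightarrow> h (a \<odot>\<^bsub>R\<^esub> x) = a \<odot>\<^bsub>S\<^esub> h x"
    and "\<And>y. y \<in> carrier S \<Longrightarrow> k y \<in> carrier R"
    and "\<And>x. x \<in> carrier R \<Longrightarrow> k (h x) = x"
    and "\<And>y. y \<in> carrier S \<Longrightarrow> h (k y) = y"
  shows "h \<in> alg_iso R S"
proof -
  have "bij_betw h (carrier R) (carrier S)"
    by (rule bij_betw_byWitness[where f' = k]) (use assms in auto)
  then show ?thesis
    using assms by (auto simp: alg_iso_def intro!: ring_iso_memI)
qed

lemma alg_isoD:
  assumes "h \<in> alg_iso R S"
  shows "\<And>x. x \<in> carrier R \<Longrightarrow> h x \<in> carrier S"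
    and "\<And>x y. x \<in> carrier R \<Longrightarrow> y \<in> carrier R \<Longrightarrow> h (x \<otimes>\<^bsub>R\<^esub> y) = h x \<otimes>\<^bsub>S\<^esub> h y"
    and "\<And>x y. x \<in> carrier R \<Longrightarrow> y \<in> carrier R \<Longrightarrow> h (x \<oplus>\<^bsub>R\<^esub> y) = h x \<oplus>\<^bsub>S\<^esub> h y"
    and "h \<one>\<^bsub>R\<^esub> = \<one>\<^bsub>S\<^esub>"
    and "\<And>a x. x \<in> carrier R \<Longrightarrow> h (a \<odot>\<^bsub>R\<^esub> x) = a \<odot>\<^bsub>S\<^esub> h x"
    and "bij_betw h (carrier R) (carrier S)"
  using assms by (auto simp: alg_iso_def dest: ring_iso_memE)

lemma alg_isomorphic_trans [trans]:
  assumes "R \<simeq>\<^sub>a\<^sub>l\<^sub>g S" and "S \<simeq>\<^sub>a\<^sub>l\<^sub>g T"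
  shows "R \<simeq>\<^sub>a\<^sub>l\<^sub>g T"
proof -
  obtain h k where h: "h \<in> alg_iso R S" and k: "k \<in> alg_iso S T"
    using assms by (auto simp: alg_isomorphic_def)
  have "k \<circ> h \<in> ring_iso R T"
    using h k by (auto simp: alg_iso_def intro: ring_iso_set_trans)
  then have "k \<circ> h \<in> alg_iso R T"
    using alg_isoD(1,5)[OF h] alg_isoD(5)[OF k] by (simp add: alg_iso_def)
  then show ?thesis
    by (auto simp: alg_isomorphic_def)
qed

section \<open>Products of algebras and matrix algebras\<close>

lemma prod_alg_simps:
  "carrier (prod_alg I R) = (\<Pi>\<^sub>E i\<in>I. carrier (R i))"
  "x \<otimes>\<^bsub>prod_alg I R\<^esub> y = (\<lambda>i\<in>I. x i \<otimes>\<^bsub>R i\<^esub> y i)"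
  "\<one>\<^bsub>prod_alg I R\<^esub> = (\<lambda>i\<in>I. \<one>\<^bsub>R i\<^esub>)"
  "\<zero>\<^bsub>prod_alg I R\<^esub> = (\<lambda>i\<in>I. \<zero>\<^bsub>R i\<^esub>)"
  "x \<oplus>\<^bsub>prod_alg I R\<^esub> y = (\<lambda>i\<in>I. x i \<oplus>\<^bsub>R i\<^esub> y i)"
  "a \<odot>\<^bsub>prod_alg I R\<^esub> x = (\<lambda>i\<in>I. a \<odot>\<^bsub>R i\<^esub> x i)"
  by (simp_all add: prod_alg_def)

lemma mat_alg_simps:
  "carrier (mat_alg n R) = {M \<in> carrier_mat n n. elements_mat M \<subseteq> carrier R}"
  "M \<otimes>\<^bsub>mat_alg n R\<^esub> N =
     mat n n (\<lambda>(i, j). \<Oplus>\<^bsub>R\<^esub>k\<in>{..<n}. M $$ (i, k) \<otimes>\<^bsub>R\<^esub> N $$ (k, j))"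
  "\<one>\<^bsub>mat_alg n R\<^esub> = mat n n (\<lambda>(i, j). if i = j then \<one>\<^bsub>R\<^esub> else \<zero>\<^bsub>R\<^esub>)"
  "\<zero>\<^bsub>mat_alg n R\<^esub> = mat n n (\<lambda>_. \<zero>\<^bsub>R\<^esub>)"
  "M \<oplus>\<^bsub>mat_alg n R\<^esub> N = mat n n (\<lambda>ij. M $$ ij \<oplus>\<^bsub>R\<^esub> N $$ ij)"
  "a \<odot>\<^bsub>mat_alg n R\<^esub> M = mat n n (\<lambda>ij. a \<odot>\<^bsub>R\<^esub> M $$ ij)"
  by (simp_all add: mat_alg_def)

lemma elements_mat_subset_iff:
  "M \<in> carrier_mat n m \<Longrightarrow> elements_mat M \<subseteq> C \<longleftrightarrow> (\<forall>i<n. \<forall>j<m. M $$ (i, j) \<in> C)"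
  by (fastforce simp: elements_mat_def)

lemma mat_alg_carrier_iff:
  "M \<in> carrier (mat_alg n R) \<longleftrightarrow>
     M \<in> carrier_mat n n \<and> (\<forall>i<n. \<forall>j<n. M $$ (i, j) \<in> carrier R)"
  using elements_mat_subset_iff[of M n n "carrier R"] by (auto simp: mat_alg_simps)

text \<open>Used for three maps: a homomorphism applied to the entries of a matrix product, the
  coordinate projections of a product, and the inclusion of a corner. The value at zero is an
  assumption because in a monoid additivity does not determine it.\<close>

lemma finsum_additive:
  assumes "abelian_monoid R" and "abelian_monoid S"
    and "\<And>x. x \<in> carrier R \<Longrightarrow> h x \<in> carrier S"
    and "\<And>x y. x \<in> carrier R \<Longrightarrow> y \<in> carrier R \<Longrightarrow> h (x \<oplus>\<^bsub>R\<^esub> y) = h x \<oplus>\<^bsub>S\<^esub> h y"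
    and "h \<zero>\<^bsub>R\<^esub> = \<zero>\<^bsub>S\<^esub>"
    and "finite T" and "f \<in> T \<rightarrow> carrier R"
  shows "h (\<Oplus>\<^bsub>R\<^esub>t\<in>T. f t) = (\<Oplus>\<^bsub>S\<^esub>t\<in>T. h (f t))"
  using assms(6,7)
proof (induction T)
  case empty
  show ?case
    using assms(5) by (simp add: abelian_monoid.finsum_empty[OF assms(1)]
        abelian_monoid.finsum_empty[OF assms(2)])
next
  case (insert t T)
  then have f: "f \<in> T \<rightarrow> carrier R" "f t \<in> carrier R" and hf: "(\<lambda>t. h (f t)) \<in> T \<rightarrow> carrier S"
    using assms(3) by auto
  show ?case
    using insert.hyps insert.IH[OF f(1)] f hf assms(3,4)
    by (simp add: abelian_monoid.finsum_insert[OF assms(1)]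
        abelian_monoid.finsum_insert[OF assms(2)] abelian_monoid.finsum_closed[OF assms(1)])
qed

lemma ring_abelian_monoid:
  "ring R \<Longrightarrow> abelian_monoid R"
  by (simp add: ring_def abelian_group_def)

lemma additive_zero:
  assumes "ring R" and "ring S"
    and "\<And>x. x \<in> carrier R \<Longrightarrow> h x \<in> carrier S"
    and "\<And>x y. x \<in> carrier R \<Longrightarrow> y \<in> carrier R \<Longrightarrow> h (x \<oplus>\<^bsub>R\<^esub> y) = h x \<oplus>\<^bsub>S\<^esub> h y"
  shows "h \<zero>\<^bsub>R\<^esub> = \<zero>\<^bsub>S\<^esub>"
proof -
  interpret R: ring R by fact
  interpret S: ring S by fact
  show ?thesis
    using assms(3)[of "\<zero>\<^bsub>R\<^esub>"] assms(4)[of "\<zero>\<^bsub>R\<^esub>" "\<zero>\<^bsub>R\<^esub>"]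
    by (metis R.zero_closed R.l_zero S.add.r_cancel_one')
qed

lemma ring_prod_alg:
  assumes "\<And>i. i \<in> I \<Longrightarrow> ring (R i)"
  shows "ring (prod_alg I R)"
proof -
  have am: "abelian_monoid (R i)" and ag: "abelian_group (R i)" and m: "monoid (R i)"
    and sr: "semiring (R i)" if "i \<in> I" for i
    using assms[OF that] by (auto simp: ring_def abelian_group_def ring.is_abelian_group ring.is_monoid
        intro!: semiring.intro ring.axioms semiring_axioms.intro ring.ring_simprules)
  show ?thesis
  proof (rule ringI)
    show "abelian_group (prod_alg I R)"
    proof (rule abelian_groupI)
      fix x assume x: "x \<in> carrier (prod_alg I R)"
      let ?y = "\<lambda>i\<in>I. \<ominus>\<^bsub>R i\<^esub> x i"
      have "?y \<in> carrier (prod_alg I R)" "?y \<oplus>\<^bsub>prod_alg I R\<^esub> x = \<zero>\<^bsub>prod_alg I R\<^esub>"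
        using x ag by (auto simp: prod_alg_simps abelian_group.a_inv_closed abelian_group.l_neg
            PiE_def Pi_def intro!: restrict_ext)
      then show "\<exists>y\<in>carrier (prod_alg I R). y \<oplus>\<^bsub>prod_alg I R\<^esub> x = \<zero>\<^bsub>prod_alg I R\<^esub>"
        by blast
    next
      fix x assume x: "x \<in> carrier (prod_alg I R)"
      show "\<zero>\<^bsub>prod_alg I R\<^esub> \<oplus>\<^bsub>prod_alg I R\<^esub> x = x"
        using x am by (auto simp: prod_alg_simps PiE_def Pi_def abelian_monoid.l_zero
            PiE_def extensional_def restrict_def fun_eq_iff)
    qed (use am in \<open>auto simp: prod_alg_simps PiE_def Pi_def abelian_monoid.a_closed
        abelian_monoid.zero_closed abelian_monoid.a_ac intro!: restrict_ext\<close>)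
    show "monoid (prod_alg I R)"
    proof (rule monoidI)
      fix x assume x: "x \<in> carrier (prod_alg I R)"
      show "\<one>\<^bsub>prod_alg I R\<^esub> \<otimes>\<^bsub>prod_alg I R\<^esub> x = x" "x \<otimes>\<^bsub>prod_alg I R\<^esub> \<one>\<^bsub>prod_alg I R\<^esub> = x"
        using x m by (auto simp: prod_alg_simps PiE_def Pi_def monoid.l_one monoid.r_one
            PiE_def extensional_def restrict_def fun_eq_iff)
    qed (use m in \<open>auto simp: prod_alg_simps PiE_def Pi_def monoid.m_closed
        monoid.one_closed monoid.m_assoc intro!: restrict_ext\<close>)
  qed (use sr in \<open>auto simp: prod_alg_simps PiE_def Pi_def semiring.l_distr semiring.r_distr
      intro!: restrict_ext\<close>)
qed

lemma prod_alg_cong: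
  assumes "\<And>i. i \<in> I \<Longrightarrow> R i \<simeq>\<^sub>a\<^sub>l\<^sub>g S i"
  shows "prod_alg I R \<simeq>\<^sub>a\<^sub>l\<^sub>g prod_alg I S"
proof -
  have "\<forall>i\<in>I. \<exists>h. h \<in> alg_iso (R i) (S i)"
    using assms by (auto simp: alg_isomorphic_def)
  then obtain h where h: "\<And>i. i \<in> I \<Longrightarrow> h i \<in> alg_iso (R i) (S i)"
    by (metis (no_types, lifting))
  note hD = alg_isoD[OF h]
  have k: "inv_into (carrier (R i)) (h i) y \<in> carrier (R i)"
      "h i (inv_into (carrier (R i)) (h i) y) = y" if "i \<in> I" "y \<in> carrier (S i)" for i y
    using hD(6)[OF that(1)] that(2) by (auto simp: bij_betw_def inv_into_into f_inv_into_f)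
  have kh: "inv_into (carrier (R i)) (h i) (h i x) = x" if "i \<in> I" "x \<in> carrier (R i)" for i x
    using hD(6)[OF that(1)] that(2) by (auto simp: bij_betw_def)
  have "(\<lambda>x. \<lambda>i\<in>I. h i (x i)) \<in> alg_iso (prod_alg I R) (prod_alg I S)"
  proof (rule alg_isoI[where k = "\<lambda>y. \<lambda>i\<in>I. inv_into (carrier (R i)) (h i) (y i)"])
    fix x assume "x \<in> carrier (prod_alg I R)"
    then show "(\<lambda>i\<in>I. inv_into (carrier (R i)) (h i) ((\<lambda>i\<in>I. h i (x i)) i)) = x"
      using kh by (auto simp: prod_alg_simps PiE_def Pi_def extensional_def restrict_def fun_eq_iff)
  next
    fix x assume "x \<in> carrier (prod_alg I S)"
    then show "(\<lambda>i\<in>I. h i ((\<lambda>i\<in>I. inv_into (carrier (R i)) (h i) (x i)) i)) = x"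
      using k by (auto simp: prod_alg_simps PiE_def Pi_def extensional_def restrict_def fun_eq_iff)
  qed (use hD k in \<open>auto simp: prod_alg_simps PiE_def Pi_def intro!: restrict_ext\<close>)
  then show ?thesis
    by (auto simp: alg_isomorphic_def)
qed

text \<open>Currying: the components are enumerated by pairs (i, j), whereas the theorem nests the
  products over i and j.\<close>

lemma prod_alg_Sigma:
  "prod_alg (Sigma I J) (\<lambda>(i, j). R i j) \<simeq>\<^sub>a\<^sub>l\<^sub>g prod_alg I (\<lambda>i. prod_alg (J i) (R i))"
proof -
  have "(\<lambda>x. \<lambda>i\<in>I. \<lambda>j\<in>J i. x (i, j)) \<in>
      alg_iso (prod_alg (Sigma I J) (\<lambda>(i, j). R i j)) (prod_alg I (\<lambda>i. prod_alg (J i) (R i)))"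
  proof (rule alg_isoI[where k = "\<lambda>y. \<lambda>(i, j)\<in>Sigma I J. y i j"])
    fix x assume "x \<in> carrier (prod_alg (Sigma I J) (\<lambda>(i, j). R i j))"
    then show "(\<lambda>(i, j)\<in>Sigma I J. (\<lambda>i\<in>I. \<lambda>j\<in>J i. x (i, j)) i j) = x"
      by (auto simp: prod_alg_simps PiE_def extensional_def restrict_def fun_eq_iff)
  next
    fix y assume "y \<in> carrier (prod_alg I (\<lambda>i. prod_alg (J i) (R i)))"
    then show "(\<lambda>i\<in>I. \<lambda>j\<in>J i. (\<lambda>(i, j)\<in>Sigma I J. y i j) (i, j)) = y"
      by (auto simp: prod_alg_simps PiE_def Pi_def extensional_def restrict_def fun_eq_iff)
  qed (auto simp: prod_alg_simps PiE_def Pi_def extensional_def intro!: restrict_ext)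
  then show ?thesis
    by (auto simp: alg_isomorphic_def)
qed

lemma mat_alg_cong:
  assumes "ring R" and "ring S" and "R \<simeq>\<^sub>a\<^sub>l\<^sub>g S"
  shows "mat_alg n R \<simeq>\<^sub>a\<^sub>l\<^sub>g mat_alg n S"
proof -
  interpret R: ring R by fact
  interpret S: ring S by fact
  obtain h where h: "h \<in> alg_iso R S"
    using assms by (auto simp: alg_isomorphic_def)
  note hD = alg_isoD[OF h]
  let ?k = "inv_into (carrier R) h"
  have k: "?k y \<in> carrier R" "h (?k y) = y" if "y \<in> carrier S" for y
    using hD(6) that by (auto simp: bij_betw_def inv_into_into f_inv_into_f)
  have kh: "?k (h x) = x" if "x \<in> carrier R" for x
    using hD(6) that by (auto simp: bij_betw_def)
  have h0: "h \<zero>\<^bsub>R\<^esub> = \<zero>\<^bsub>S\<^esub>"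
    by (rule additive_zero) (use assms hD in auto)
  have h_sum: "h (\<Oplus>\<^bsub>R\<^esub>k\<in>{..<n}. f k) = (\<Oplus>\<^bsub>S\<^esub>k\<in>{..<n}. h (f k))"
    if "\<And>k. k < n \<Longrightarrow> f k \<in> carrier R" for f
    by (rule finsum_additive) (use that hD h0 R.abelian_monoid_axioms S.abelian_monoid_axioms in auto)
  have "map_mat h \<in> alg_iso (mat_alg n R) (mat_alg n S)"
  proof (rule alg_isoI[where k = "map_mat ?k"])
    fix M N assume M: "M \<in> carrier (mat_alg n R)" and N: "N \<in> carrier (mat_alg n R)"
    have "h (\<Oplus>\<^bsub>R\<^esub>k\<in>{..<n}. M $$ (i, k) \<otimes>\<^bsub>R\<^esub> N $$ (k, j)) =
        (\<Oplus>\<^bsub>S\<^esub>k\<in>{..<n}. h (M $$ (i, k)) \<otimes>\<^bsub>S\<^esub> h (N $$ (k, j)))" if "i < n" "j < n" for i j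
    proof -
      have "h (\<Oplus>\<^bsub>R\<^esub>k\<in>{..<n}. M $$ (i, k) \<otimes>\<^bsub>R\<^esub> N $$ (k, j)) =
          (\<Oplus>\<^bsub>S\<^esub>k\<in>{..<n}. h (M $$ (i, k) \<otimes>\<^bsub>R\<^esub> N $$ (k, j)))"
        by (rule h_sum) (use M N that in \<open>auto simp: mat_alg_carrier_iff\<close>)
      also have "\<dots> = (\<Oplus>\<^bsub>S\<^esub>k\<in>{..<n}. h (M $$ (i, k)) \<otimes>\<^bsub>S\<^esub> h (N $$ (k, j)))"
        by (rule S.finsum_cong') (use M N that hD in \<open>auto simp: mat_alg_carrier_iff\<close>)
      finally show ?thesis .
    qed
    then show "map_mat h (M \<otimes>\<^bsub>mat_alg n R\<^esub> N) = map_mat h M \<otimes>\<^bsub>mat_alg n S\<^esub> map_mat h N"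
      using M N by (auto simp: mat_alg_simps intro!: eq_matI S.finsum_cong')
        (auto simp: elements_mat_subset_iff hD intro!: S.finsum_cong')
  qed (use hD h0 k kh in \<open>auto simp: mat_alg_carrier_iff mat_alg_simps(2-) intro!: eq_matI\<close>)
  then show ?thesis
    by (auto simp: alg_isomorphic_def)
qed

lemma finsum_prod_alg:
  assumes "\<And>i. i \<in> I \<Longrightarrow> ring (R i)" and "finite T"
    and "\<And>t. t \<in> T \<Longrightarrow> f t \<in> carrier (prod_alg I R)" and "i \<in> I"
  shows "(\<Oplus>\<^bsub>prod_alg I R\<^esub>t\<in>T. f t) i = (\<Oplus>\<^bsub>R i\<^esub>t\<in>T. f t i)"
  by (rule finsum_additive[where h = "\<lambda>x. x i"])
    (use assms ring_prod_alg[of I R] in \<open>auto simp: prod_alg_simps ring_abelian_monoid\<close>)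

text \<open>A matrix of families and a family of matrices carry the same data. Their products agree
  because the sum over the inner index is computed coordinatewise in a product algebra.\<close>

lemma mat_alg_prod_alg:
  assumes "\<And>i. i \<in> I \<Longrightarrow> ring (R i)"
  shows "mat_alg n (prod_alg I R) \<simeq>\<^sub>a\<^sub>l\<^sub>g prod_alg I (\<lambda>i. mat_alg n (R i))"
proof -
  interpret P: ring "prod_alg I R"
    using assms by (rule ring_prod_alg)
  have "(\<lambda>M. \<lambda>i\<in>I. mat n n (\<lambda>ab. (M $$ ab) i)) \<in>
      alg_iso (mat_alg n (prod_alg I R)) (prod_alg I (\<lambda>i. mat_alg n (R i)))"
  proof (rule alg_isoI[where k = "\<lambda>N. mat n n (\<lambda>ab. \<lambda>i\<in>I. (N i $$ ab))"])
    fix M N assume M: "M \<in> carrier (mat_alg n (prod_alg I R))"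
      and N: "N \<in> carrier (mat_alg n (prod_alg I R))"
    have eq: "(\<Oplus>\<^bsub>prod_alg I R\<^esub>k\<in>{..<n}. M $$ (a, k) \<otimes>\<^bsub>prod_alg I R\<^esub> N $$ (k, b)) i =
        (\<Oplus>\<^bsub>R i\<^esub>k\<in>{..<n}. (M $$ (a, k)) i \<otimes>\<^bsub>R i\<^esub> (N $$ (k, b)) i)"
      if "a < n" "b < n" "i \<in> I" for a b i
    proof -
      have "(\<Oplus>\<^bsub>prod_alg I R\<^esub>k\<in>{..<n}. M $$ (a, k) \<otimes>\<^bsub>prod_alg I R\<^esub> N $$ (k, b)) i =
          (\<Oplus>\<^bsub>R i\<^esub>k\<in>{..<n}. (M $$ (a, k) \<otimes>\<^bsub>prod_alg I R\<^esub> N $$ (k, b)) i)"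
        by (rule finsum_prod_alg) (use M N assms that in \<open>auto simp: mat_alg_carrier_iff\<close>)
      then show ?thesis
        using that by (simp add: prod_alg_simps)
    qed
    show "(\<lambda>i\<in>I. mat n n (\<lambda>ab. ((M \<otimes>\<^bsub>mat_alg n (prod_alg I R)\<^esub> N) $$ ab) i)) =
        (\<lambda>i\<in>I. mat n n (\<lambda>ab. (M $$ ab) i)) \<otimes>\<^bsub>prod_alg I (\<lambda>i. mat_alg n (R i))\<^esub>
        (\<lambda>i\<in>I. mat n n (\<lambda>ab. (N $$ ab) i))"
    proof -
      have "(\<Oplus>\<^bsub>R i\<^esub>k\<in>{..<n}. (M $$ (a, k)) i \<otimes>\<^bsub>R i\<^esub> (N $$ (k, b)) i) =
          (\<Oplus>\<^bsub>R i\<^esub>k\<in>{..<n}. mat n n (\<lambda>ab. (M $$ ab) i) $$ (a, k) \<otimes>\<^bsub>R i\<^esub>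
            mat n n (\<lambda>ab. (N $$ ab) i) $$ (k, b))" if "a < n" "b < n" "i \<in> I" for a b i
      proof -
        interpret ring "R i" using assms that by simp
        show ?thesis
          by (rule finsum_cong') (use that M N in \<open>auto simp: mat_alg_carrier_iff prod_alg_simps PiE_def Pi_def\<close>)
      qed
      then show ?thesis
        using eq by (auto simp: prod_alg_simps(2) mat_alg_simps(2) intro!: restrict_ext eq_matI)
    qed
  next
    fix M assume M: "M \<in> carrier (mat_alg n (prod_alg I R))"
    then have "M $$ (a, b) \<in> (\<Pi>\<^sub>E i\<in>I. carrier (R i))" if "a < n" "b < n" for a b
      using that by (auto simp: mat_alg_carrier_iff prod_alg_simps)
    then have "restrict (M $$ (a, b)) I = M $$ (a, b)" if "a < n" "b < n" for a b
      using that by (auto simp: PiE_def extensional_restrict)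
    then show "mat n n (\<lambda>ab. \<lambda>i\<in>I. ((\<lambda>i\<in>I. mat n n (\<lambda>ab. (M $$ ab) i)) i $$ ab)) = M"
      using M by (auto simp: mat_alg_carrier_iff intro!: eq_matI cong: restrict_cong)
  next
    fix N assume N: "N \<in> carrier (prod_alg I (\<lambda>i. mat_alg n (R i)))"
    then show "(\<lambda>i\<in>I. mat n n (\<lambda>ab. (mat n n (\<lambda>ab. \<lambda>i\<in>I. (N i $$ ab)) $$ ab) i)) = N"
      by (intro extensionalityI[of _ I])
        (auto simp: prod_alg_simps PiE_def Pi_def mat_alg_carrier_iff intro!: eq_matI)
  next
    fix M N assume "M \<in> carrier (mat_alg n (prod_alg I R))" "N \<in> carrier (mat_alg n (prod_alg I R))"
    then show "(\<lambda>i\<in>I. mat n n (\<lambda>ab. ((M \<oplus>\<^bsub>mat_alg n (prod_alg I R)\<^esub> N) $$ ab) i)) =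
        (\<lambda>i\<in>I. mat n n (\<lambda>ab. (M $$ ab) i)) \<oplus>\<^bsub>prod_alg I (\<lambda>i. mat_alg n (R i))\<^esub>
        (\<lambda>i\<in>I. mat n n (\<lambda>ab. (N $$ ab) i))"
      by (auto simp: prod_alg_simps(5) mat_alg_simps(5) intro!: restrict_ext eq_matI)
  next
    fix a M assume "M \<in> carrier (mat_alg n (prod_alg I R))"
    then show "(\<lambda>i\<in>I. mat n n (\<lambda>ab. ((a \<odot>\<^bsub>mat_alg n (prod_alg I R)\<^esub> M) $$ ab) i)) =
        a \<odot>\<^bsub>prod_alg I (\<lambda>i. mat_alg n (R i))\<^esub> (\<lambda>i\<in>I. mat n n (\<lambda>ab. (M $$ ab) i))"
      by (auto simp: prod_alg_simps(6) mat_alg_simps(6) intro!: restrict_ext eq_matI)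
  next
    show "(\<lambda>i\<in>I. mat n n (\<lambda>ab. (\<one>\<^bsub>mat_alg n (prod_alg I R)\<^esub> $$ ab) i)) =
        \<one>\<^bsub>prod_alg I (\<lambda>i. mat_alg n (R i))\<^esub>"
      by (auto simp: prod_alg_simps(3,4) mat_alg_simps(3) intro!: restrict_ext eq_matI)
  next
    fix M assume "M \<in> carrier (mat_alg n (prod_alg I R))"
    then show "(\<lambda>i\<in>I. mat n n (\<lambda>ab. (M $$ ab) i)) \<in> carrier (prod_alg I (\<lambda>i. mat_alg n (R i)))"
      by (auto simp: prod_alg_simps(1) mat_alg_carrier_iff PiE_def Pi_def)
  next
    fix N assume "N \<in> carrier (prod_alg I (\<lambda>i. mat_alg n (R i)))"
    then show "mat n n (\<lambda>ab. \<lambda>i\<in>I. (N i $$ ab)) \<in> carrier (mat_alg n (prod_alg I R))"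
      by (auto simp: prod_alg_simps(1) mat_alg_carrier_iff PiE_def Pi_def)
  qed
  then show ?thesis
    by (auto simp: alg_isomorphic_def)
qed

section \<open>Complex matrices and block matrices\<close>

lemma ring_complex_mat_alg:
  "ring (complex_mat_alg d)"
proof (rule ringI)
  show "abelian_group (complex_mat_alg d)"
    by (rule abelian_group_mat)
  show "monoid (complex_mat_alg d)"
    by (rule monoidI) (auto simp: module_mat_simps)
qed (auto simp: module_mat_simps add_mult_distrib_mat mult_add_distrib_mat)

lemma finsum_complex_mat_alg:
  assumes "finite T" and "\<And>t. t \<in> T \<Longrightarrow> f t \<in> carrier_mat d d" and "i < d" and "j < d"
  shows "(\<Oplus>\<^bsub>complex_mat_alg d\<^esub>t\<in>T. f t) $$ (i, j) = (\<Sum>t\<in>T. f t $$ (i, j))"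
    and "(\<Oplus>\<^bsub>complex_mat_alg d\<^esub>t\<in>T. f t) \<in> carrier_mat d d"
proof -
  interpret ring "complex_mat_alg d" by (rule ring_complex_mat_alg)
  have "(\<Oplus>\<^bsub>complex_mat_alg d\<^esub>t\<in>T. f t) \<in> carrier_mat d d \<and>
      (\<Oplus>\<^bsub>complex_mat_alg d\<^esub>t\<in>T. f t) $$ (i, j) = (\<Sum>t\<in>T. f t $$ (i, j))"
    using assms by (induction T) (auto simp: module_mat_simps)
  then show "(\<Oplus>\<^bsub>complex_mat_alg d\<^esub>t\<in>T. f t) $$ (i, j) = (\<Sum>t\<in>T. f t $$ (i, j))"
    and "(\<Oplus>\<^bsub>complex_mat_alg d\<^esub>t\<in>T. f t) \<in> carrier_mat d d"
    by auto
qed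

text \<open>Every k below m d is r d + s with digits r = k div d and s = k mod d. In the product of
  block matrices this merges the sum over the blocks and the sum inside a block into one sum over
  k.\<close>

lemma sum_div_mod:
  fixes f :: "nat \<Rightarrow> nat \<Rightarrow> 'a::comm_monoid_add"
  assumes "d > 0"
  shows "(\<Sum>k<m * d. f (k div d) (k mod d)) = (\<Sum>r<m. \<Sum>s<d. f r s)"
proof -
  have "(\<Sum>k<m * d. f (k div d) (k mod d)) = (\<Sum>r<m. \<Sum>k = r * d..<r * d + d. f (k div d) (k mod d))"
    by (simp add: sum.nat_group)
  also have "\<dots> = (\<Sum>r<m. \<Sum>s<d. f r s)"
  proof (rule sum.cong[OF refl])
    fix r
    have "(\<Sum>k = r * d..<r * d + d. f (k div d) (k mod d)) =
        (\<Sum>s = 0..<d. f ((s + r * d) div d) ((s + r * d) mod d))"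
      using sum.shift_bounds_nat_ivl[of "\<lambda>k. f (k div d) (k mod d)" 0 "r * d" d]
      by (simp add: add.commute)
    then show "(\<Sum>k = r * d..<r * d + d. f (k div d) (k mod d)) = (\<Sum>s<d. f r s)"
      using assms by (simp add: atLeast0LessThan)
  qed
  finally show ?thesis .
qed

text \<open>Entry (i, j) of the flat matrix lies in block (i div d, j div d) at position (i mod d, j
  mod d). The assumption on d makes the remainders valid positions inside a block.\<close>

lemma mat_alg_complex_mat_alg:
  assumes d: "d > 0"
  shows "mat_alg m (complex_mat_alg d) \<simeq>\<^sub>a\<^sub>l\<^sub>g complex_mat_alg (m * d)"
proof -
  have dm: "i div d < m" "i mod d < d" if "i < m * d" for i
    using that d by (auto simp: less_mult_imp_div_less)
  have lt: "a * d + i < m * d" if "a < m" "i < d" for a i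
  proof -
    have "a * d + i < (a + 1) * d"
      using that by simp
    also have "\<dots> \<le> m * d"
      using that by (intro mult_right_mono) auto
    finally show ?thesis .
  qed
  interpret R: ring "complex_mat_alg d" by (rule ring_complex_mat_alg)
  let ?h = "\<lambda>M. mat (m * d) (m * d) (\<lambda>(i, j). (M $$ (i div d, j div d)) $$ (i mod d, j mod d))"
  let ?k = "\<lambda>N. mat m m (\<lambda>(a, b). mat d d (\<lambda>(i, j). N $$ (a * d + i, b * d + j)))"
  have "?h \<in> alg_iso (mat_alg m (complex_mat_alg d)) (complex_mat_alg (m * d))"
  proof (rule alg_isoI[where k = ?k])
    fix M N assume M: "M \<in> carrier (mat_alg m (complex_mat_alg d))"
      and N: "N \<in> carrier (mat_alg m (complex_mat_alg d))"
    have MN: "M $$ (a, b) \<in> carrier_mat d d" "N $$ (a, b) \<in> carrier_mat d d" if "a < m" "b < m" for a b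
      using M N that by (auto simp: mat_alg_carrier_iff module_mat_simps)
    show "?h (M \<otimes>\<^bsub>mat_alg m (complex_mat_alg d)\<^esub> N) = ?h M \<otimes>\<^bsub>complex_mat_alg (m * d)\<^esub> ?h N"
    proof (rule eq_matI)
      fix i j assume "i < dim_row (?h M \<otimes>\<^bsub>complex_mat_alg (m * d)\<^esub> ?h N)"
        and "j < dim_col (?h M \<otimes>\<^bsub>complex_mat_alg (m * d)\<^esub> ?h N)"
      then have i: "i < m * d" and j: "j < m * d"
        by (auto simp: module_mat_simps)
      let ?a = "i div d" and ?b = "j div d" and ?r = "i mod d" and ?s = "j mod d"
      have "?h (M \<otimes>\<^bsub>mat_alg m (complex_mat_alg d)\<^esub> N) $$ (i, j) =
          (\<Oplus>\<^bsub>complex_mat_alg d\<^esub>k\<in>{..<m}. M $$ (?a, k) * N $$ (k, ?b)) $$ (?r, ?s)"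
        using i j dm by (simp add: mat_alg_simps module_mat_simps)
      also have "\<dots> = (\<Sum>k<m. (M $$ (?a, k) * N $$ (k, ?b)) $$ (?r, ?s))"
        by (rule finsum_complex_mat_alg) (use MN dm i j in \<open>auto intro!: mult_carrier_mat[where n = d]\<close>)
      also have "\<dots> = (\<Sum>k<m. \<Sum>l<d. M $$ (?a, k) $$ (?r, l) * N $$ (k, ?b) $$ (l, ?s))"
      proof (rule sum.cong[OF refl])
        fix k assume "k \<in> {..<m}"
        then have c: "M $$ (?a, k) \<in> carrier_mat d d" "N $$ (k, ?b) \<in> carrier_mat d d"
          using MN dm i j by auto
        then have "dim_row (M $$ (?a, k)) = d" "dim_col (M $$ (?a, k)) = d"
          "dim_row (N $$ (k, ?b)) = d" "dim_col (N $$ (k, ?b)) = d"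
          by auto
        then show "(M $$ (?a, k) * N $$ (k, ?b)) $$ (?r, ?s) =
            (\<Sum>l<d. M $$ (?a, k) $$ (?r, l) * N $$ (k, ?b) $$ (l, ?s))"
          using dm i j by (auto simp: scalar_prod_def atLeast0LessThan intro!: sum.cong)
      qed
      also have "\<dots> = (\<Sum>k<m * d. M $$ (?a, k div d) $$ (?r, k mod d) * N $$ (k div d, ?b) $$ (k mod d, ?s))"
        by (rule sum_div_mod[OF d, symmetric])
      also have "\<dots> = (?h M \<otimes>\<^bsub>complex_mat_alg (m * d)\<^esub> ?h N) $$ (i, j)"
        using i j by (auto simp: module_mat_simps scalar_prod_def atLeast0LessThan intro!: sum.cong)
      finally show "?h (M \<otimes>\<^bsub>mat_alg m (complex_mat_alg d)\<^esub> N) $$ (i, j) =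
          (?h M \<otimes>\<^bsub>complex_mat_alg (m * d)\<^esub> ?h N) $$ (i, j)" .
    qed (auto simp: module_mat_simps)
  next
    fix M assume M: "M \<in> carrier (mat_alg m (complex_mat_alg d))"
    then have c: "M $$ (a, b) \<in> carrier_mat d d" if "a < m" "b < m" for a b
      using that by (auto simp: mat_alg_carrier_iff module_mat_simps)
    show "?k (?h M) = M"
    proof (rule eq_matI)
      fix a b assume "a < dim_row M" "b < dim_col M"
      then have ab: "a < m" "b < m"
        using M by (auto simp: mat_alg_carrier_iff)
      have "mat d d (\<lambda>(i, j). ?h M $$ (a * d + i, b * d + j)) = M $$ (a, b)"
        using c[OF ab] lt ab d by (auto intro!: eq_matI)
      then show "?k (?h M) $$ (a, b) = M $$ (a, b)"
        using ab by simp
    qed (use M in \<open>auto simp: mat_alg_carrier_iff\<close>)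
    fix N assume N: "N \<in> carrier (mat_alg m (complex_mat_alg d))"
    have cN: "N $$ (a, b) \<in> carrier_mat d d" if "a < m" "b < m" for a b
      using N that by (auto simp: mat_alg_carrier_iff module_mat_simps)
    show "?h (M \<oplus>\<^bsub>mat_alg m (complex_mat_alg d)\<^esub> N) = ?h M \<oplus>\<^bsub>complex_mat_alg (m * d)\<^esub> ?h N"
      using dm by (auto simp: mat_alg_simps module_mat_simps carrier_matD[OF cN] intro!: eq_matI)
  next
    fix M and a assume M: "M \<in> carrier (mat_alg m (complex_mat_alg d))"
    then have c: "M $$ (a, b) \<in> carrier_mat d d" if "a < m" "b < m" for a b
      using that by (auto simp: mat_alg_carrier_iff module_mat_simps)
    show "?h (a \<odot>\<^bsub>mat_alg m (complex_mat_alg d)\<^esub> M) = a \<odot>\<^bsub>complex_mat_alg (m * d)\<^esub> ?h M"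
      using dm by (auto simp: mat_alg_simps module_mat_simps carrier_matD[OF c] intro!: eq_matI)
  next
    \<comment> \<open>The block identity has a 1 at (i, j) when quotients and remainders both agree;
      this forces i = j.\<close>
    have div_mod_inj: "i = j" if "i div d = j div d" "i mod d = j mod d" for i j
    proof -
      have "i = i div d * d + i mod d" by simp
      also have "\<dots> = j" by (simp add: that)
      finally show ?thesis .
    qed
    show "?h \<one>\<^bsub>mat_alg m (complex_mat_alg d)\<^esub> = \<one>\<^bsub>complex_mat_alg (m * d)\<^esub>"
      using dm by (auto simp: mat_alg_simps module_mat_simps intro!: eq_matI dest: div_mod_inj)
  next
    fix N assume "N \<in> carrier (complex_mat_alg (m * d))"
    then show "?h (?k N) = N"
      using dm by (auto simp: module_mat_simps intro!: eq_matI)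
  qed (auto simp: module_mat_simps mat_alg_carrier_iff)
  then show ?thesis
    by (auto simp: alg_isomorphic_def)
qed

section \<open>Peirce decomposition\<close>

locale complex_algebra = ring R for R :: "(complex, 'b, 'm) module_scheme" (structure) +
  assumes smult_closed [simp, intro]: "x \<in> carrier R \<Longrightarrow> a \<odot> x \<in> carrier R"
    and smult_l_distr: "x \<in> carrier R \<Longrightarrow> (a + b) \<odot> x = a \<odot> x \<oplus> b \<odot> x"
    and smult_r_distr: "x \<in> carrier R \<Longrightarrow> y \<in> carrier R \<Longrightarrow> a \<odot> (x \<oplus> y) = a \<odot> x \<oplus> a \<odot> y"
    and smult_smult: "x \<in> carrier R \<Longrightarrow> a \<odot> (b \<odot> x) = (a * b) \<odot> x"
    and smult_one [simp]: "x \<in> carrier R \<Longrightarrow> 1 \<odot> x = x"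
    and smult_mult_left: "x \<in> carrier R \<Longrightarrow> y \<in> carrier R \<Longrightarrow> (a \<odot> x) \<otimes> y = a \<odot> (x \<otimes> y)"
    and smult_mult_right: "x \<in> carrier R \<Longrightarrow> y \<in> carrier R \<Longrightarrow> x \<otimes> (a \<odot> y) = a \<odot> (x \<otimes> y)"

text \<open>The Peirce corner p R p. For idempotent p it is the set of all x with p x = x = x p, a
  form that avoids choosing preimages. Operations, zero and scalars stay those of R; only the
  carrier and the unit change.\<close>

definition corner :: "('b, 'm) ring_scheme \<Rightarrow> 'b \<Rightarrow> ('b, 'm) ring_scheme" where
  "corner R p = R\<lparr>carrier := {x \<in> carrier R. p \<otimes>\<^bsub>R\<^esub> x = x \<and> x \<otimes>\<^bsub>R\<^esub> p = x}, one := p\<rparr>"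

lemma corner_simps [simp]:
  fixes R :: "('a, 'b, 'm) module_scheme"
  shows "carrier (corner R p) = {x \<in> carrier R. p \<otimes>\<^bsub>R\<^esub> x = x \<and> x \<otimes>\<^bsub>R\<^esub> p = x}"
    and "\<one>\<^bsub>corner R p\<^esub> = p"
    and "\<zero>\<^bsub>corner R p\<^esub> = \<zero>\<^bsub>R\<^esub>"
    and "x \<otimes>\<^bsub>corner R p\<^esub> y = x \<otimes>\<^bsub>R\<^esub> y"
    and "x \<oplus>\<^bsub>corner R p\<^esub> y = x \<oplus>\<^bsub>R\<^esub> y"
    and "a \<odot>\<^bsub>corner R p\<^esub> x = a \<odot>\<^bsub>R\<^esub> x"
  by (simp_all add: corner_def)

lemma (in abelian_monoid) finsum_all_but_one_zero:
  assumes "finite A" and "i \<in> A" and "f i \<in> carrier G"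
    and "\<And>j. j \<in> A \<Longrightarrow> j \<noteq> i \<Longrightarrow> f j = \<zero>"
  shows "(\<Oplus>j\<in>A. f j) = f i"
proof -
  have "(\<Oplus>j\<in>A. f j) = (\<Oplus>j\<in>A. if i = j then f i else \<zero>)"
    by (rule finsum_cong') (use assms in auto)
  also have "\<dots> = f i"
    using assms finsum_singleton[of i A "\<lambda>_. f i"] by simp
  finally show ?thesis .
qed

context ring
begin

lemma ring_corner:
  fixes p
  assumes "p \<in> carrier R" and "p \<otimes> p = p"
  shows "ring (corner R p)"
proof (rule ringI)
  show "abelian_group (corner R p)"
  proof (rule abelian_groupI)
    fix x assume x: "x \<in> carrier (corner R p)"
    then show "\<exists>y\<in>carrier (corner R p). y \<oplus>\<^bsub>corner R p\<^esub> x = \<zero>\<^bsub>corner R p\<^esub>"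
      using assms by (intro bexI[of _ "\<ominus> x"]) (auto simp: corner_def l_neg r_minus l_minus)
  qed (use assms in \<open>auto simp: corner_def r_distr l_distr a_ac\<close>)
  show "monoid (corner R p)"
  proof (rule monoidI)
    fix x y assume "x \<in> carrier (corner R p)" and "y \<in> carrier (corner R p)"
    then have "x \<in> carrier R" "y \<in> carrier R" "p \<otimes> x = x" "y \<otimes> p = y"
      by (auto simp: corner_def)
    moreover from this have "p \<otimes> (x \<otimes> y) = x \<otimes> y" "x \<otimes> y \<otimes> p = x \<otimes> y"
      using assms m_assoc[of p x y] m_assoc[of x y p] by simp_all
    ultimately show "x \<otimes>\<^bsub>corner R p\<^esub> y \<in> carrier (corner R p)"
      by (simp add: corner_def)
  qed (use assms in \<open>auto simp: corner_def m_assoc\<close>)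
qed (auto simp: corner_def l_distr r_distr)

text \<open>The matrix algebra over a corner forms its sums in the corner, whereas the Peirce
  computations take place in R.\<close>

lemma finsum_corner:
  assumes "p \<in> carrier R" and "p \<otimes> p = p"
    and "finite T" and "\<And>t. t \<in> T \<Longrightarrow> f t \<in> carrier (corner R p)"
  shows "(\<Oplus>\<^bsub>corner R p\<^esub>t\<in>T. f t) = (\<Oplus>t\<in>T. f t)"
  by (rule finsum_additive[where h = id and S = R, simplified])
    (use assms ring_corner[of p] abelian_monoid_axioms in \<open>auto simp: ring_abelian_monoid corner_def\<close>)

end

text \<open>x corresponds to the matrices with entries
  \<open>v i a \<otimes> x \<otimes> u i b\<close>, and a family of matrices to the sum of all
  \<open>u i a \<otimes> M i $$ (a, b) \<otimes> v i b\<close>. The elements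
  \<open>u i a \<otimes> v i a\<close> are orthogonal idempotents with sum 1, each equivalent to
  \<open>p i\<close> through \<open>u i a\<close> and \<open>v i a\<close>; \<open>off\<close> says
  that no element of R links different blocks.\<close>

theorem (in complex_algebra) peirce_decomposition:
  fixes I :: "'i set" and m :: "'i \<Rightarrow> nat" and p :: "'i \<Rightarrow> 'b" and u v :: "'i \<Rightarrow> nat \<Rightarrow> 'b"
  assumes I: "finite I"
    and p: "\<And>i. i \<in> I \<Longrightarrow> p i \<in> carrier R" "\<And>i. i \<in> I \<Longrightarrow> p i \<otimes> p i = p i"
    and u: "\<And>i a. i \<in> I \<Longrightarrow> a < m i \<Longrightarrow> u i a \<in> carrier R"
      "\<And>i a. i \<in> I \<Longrightarrow> a < m i \<Longrightarrow> u i a \<otimes> p i = u i a"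
    and v: "\<And>i a. i \<in> I \<Longrightarrow> a < m i \<Longrightarrow> v i a \<in> carrier R"
      "\<And>i a. i \<in> I \<Longrightarrow> a < m i \<Longrightarrow> p i \<otimes> v i a = v i a"
    and vu: "\<And>i a b. i \<in> I \<Longrightarrow> a < m i \<Longrightarrow> b < m i \<Longrightarrow>
      v i a \<otimes> u i b = (if a = b then p i else \<zero>)"
    and off: "\<And>i j a b x. i \<in> I \<Longrightarrow> j \<in> I \<Longrightarrow> i \<noteq> j \<Longrightarrow> a < m i \<Longrightarrow> b < m j \<Longrightarrow>
      x \<in> carrier R \<Longrightarrow> v i a \<otimes> x \<otimes> u j b = \<zero>"
    and uv: "(\<Oplus>i\<in>I. \<Oplus>a\<in>{..<m i}. u i a \<otimes> v i a) = \<one>"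
  shows "R \<simeq>\<^sub>a\<^sub>l\<^sub>g prod_alg I (\<lambda>i. mat_alg (m i) (corner R (p i)))"
proof -
  define h where "h x = (\<lambda>i\<in>I. mat (m i) (m i) (\<lambda>(a, b). v i a \<otimes> x \<otimes> u i b))" for x
  define k where "k M = (\<Oplus>i\<in>I. \<Oplus>a\<in>{..<m i}. \<Oplus>b\<in>{..<m i}. u i a \<otimes> M i $$ (a, b) \<otimes> v i b)" for M
  \<comment> \<open>Resolution of the identity on the right of x. It serves to restore an element
    from its matrix entries and to split the middle of a product.\<close>
  have insert_one: "x = (\<Oplus>i\<in>I. \<Oplus>a\<in>{..<m i}. x \<otimes> (u i a \<otimes> v i a))" if "x \<in> carrier R" for x
  proof -
    have "x = x \<otimes> (\<Oplus>i\<in>I. \<Oplus>a\<in>{..<m i}. u i a \<otimes> v i a)"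
      using uv that by simp
    also have "\<dots> = (\<Oplus>i\<in>I. x \<otimes> (\<Oplus>a\<in>{..<m i}. u i a \<otimes> v i a))"
      by (rule finsum_rdistr) (use I u v that in auto)
    also have "\<dots> = (\<Oplus>i\<in>I. \<Oplus>a\<in>{..<m i}. x \<otimes> (u i a \<otimes> v i a))"
      by (intro finsum_cong' finsum_rdistr) (use I u v that in auto)
    finally show ?thesis .
  qed
  have corner_entry: "v i a \<otimes> x \<otimes> u i b \<in> carrier (corner R (p i))"
    if "i \<in> I" "a < m i" "b < m i" "x \<in> carrier R" for i a b x
  proof -
    have "p i \<otimes> (v i a \<otimes> x \<otimes> u i b) = (p i \<otimes> v i a) \<otimes> x \<otimes> u i b"
      "v i a \<otimes> x \<otimes> u i b \<otimes> p i = v i a \<otimes> x \<otimes> (u i b \<otimes> p i)"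
      using that p u(1) v(1) by (simp_all add: m_assoc)
    then show ?thesis
      using that p u v by simp
  qed
  have carrierD: "M i $$ (a, b) \<in> carrier R" "p i \<otimes> M i $$ (a, b) = M i $$ (a, b)"
      "M i $$ (a, b) \<otimes> p i = M i $$ (a, b)" "M i \<in> carrier_mat (m i) (m i)"
    if "M \<in> carrier (prod_alg I (\<lambda>i. mat_alg (m i) (corner R (p i))))" "i \<in> I" "a < m i" "b < m i"
    for M i a b
    using that by (auto simp: prod_alg_simps mat_alg_carrier_iff PiE_def Pi_def)
  have dims: "M i \<in> carrier_mat (m i) (m i)"
    if "M \<in> carrier (prod_alg I (\<lambda>i. mat_alg (m i) (corner R (p i))))" "i \<in> I" for M i
    using that by (auto simp: prod_alg_simps mat_alg_carrier_iff PiE_def Pi_def)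
  have "h \<in> alg_iso R (prod_alg I (\<lambda>i. mat_alg (m i) (corner R (p i))))"
  proof (rule alg_isoI[where k = k])
    fix x assume x: "x \<in> carrier R"
    show "h x \<in> carrier (prod_alg I (\<lambda>i. mat_alg (m i) (corner R (p i))))"
      using corner_entry x by (auto simp: h_def prod_alg_simps mat_alg_carrier_iff)
    have "k (h x) = (\<Oplus>i\<in>I. \<Oplus>a\<in>{..<m i}. (\<Oplus>b\<in>{..<m i}. u i a \<otimes> (v i a \<otimes> x \<otimes> u i b) \<otimes> v i b))"
      unfolding k_def using I u v x by (intro finsum_cong') (auto simp: h_def)
    \<comment> \<open>The resolution is applied to \<open>?y\<close>, which is
      \<open>u i a \<otimes> v i a \<otimes> x\<close>. Its parts from blocks other than i vanish by
      \<open>off\<close>, and what is left comes from row a of the matrix of x.\<close>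
    also have "\<dots> = (\<Oplus>i\<in>I. \<Oplus>a\<in>{..<m i}. u i a \<otimes> v i a \<otimes> x)"
    proof (intro finsum_cong' refl)
      fix i a assume i: "i \<in> I" and a: "a \<in> {..<m i}"
      let ?y = "u i a \<otimes> v i a \<otimes> x"
      have y: "?y \<in> carrier R" using i a u v x by simp
      have yu: "?y \<otimes> (u j b \<otimes> v j b) = u i a \<otimes> (v i a \<otimes> x \<otimes> u j b) \<otimes> v j b"
        if "j \<in> I" "b < m j" for j b
        using that i a u(1) v(1) x by (simp add: m_assoc)
      have "?y = (\<Oplus>j\<in>I. \<Oplus>b\<in>{..<m j}. ?y \<otimes> (u j b \<otimes> v j b))"
        by (rule insert_one[OF y])
      also have "\<dots> = (\<Oplus>b\<in>{..<m i}. ?y \<otimes> (u i b \<otimes> v i b))"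
      proof (rule finsum_all_but_one_zero[OF I i])
        fix j assume j: "j \<in> I" "j \<noteq> i"
        have "?y \<otimes> (u j b \<otimes> v j b) = \<zero>" if "b < m j" for b
          using that i a j x u(1) v(1) off[OF i j(1)] by (simp add: yu)
        then have "(\<Oplus>b\<in>{..<m j}. ?y \<otimes> (u j b \<otimes> v j b)) = (\<Oplus>b\<in>{..<m j}. \<zero>)"
          by (intro finsum_cong') auto
        then show "(\<Oplus>b\<in>{..<m j}. ?y \<otimes> (u j b \<otimes> v j b)) = \<zero>"
          by simp
      qed (use i y u v in auto)
      also have "\<dots> = (\<Oplus>b\<in>{..<m i}. u i a \<otimes> (v i a \<otimes> x \<otimes> u i b) \<otimes> v i b)"
        by (intro finsum_cong') (use i a u(1) v(1) x yu in auto)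
      finally show "(\<Oplus>b\<in>{..<m i}. u i a \<otimes> (v i a \<otimes> x \<otimes> u i b) \<otimes> v i b) = ?y"
        by simp
    qed (use u v x in auto)
    also have "\<dots> = (\<Oplus>i\<in>I. (\<Oplus>a\<in>{..<m i}. u i a \<otimes> v i a) \<otimes> x)"
      by (intro finsum_cong' finsum_ldistr[symmetric]) (use I u v x in auto)
    also have "\<dots> = (\<Oplus>i\<in>I. \<Oplus>a\<in>{..<m i}. u i a \<otimes> v i a) \<otimes> x"
      by (rule finsum_ldistr[symmetric]) (use I u v x in auto)
    finally show "k (h x) = x"
      using uv x by simp
    show "h (a \<odot> x) = a \<odot>\<^bsub>prod_alg I (\<lambda>i. mat_alg (m i) (corner R (p i)))\<^esub> h x" for a
      using x u v by (auto simp: h_def prod_alg_simps mat_alg_simps smult_mult_left smult_mult_right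
          intro!: restrict_ext eq_matI)
    fix y assume y: "y \<in> carrier R"
    show "h (x \<oplus> y) = h x \<oplus>\<^bsub>prod_alg I (\<lambda>i. mat_alg (m i) (corner R (p i)))\<^esub> h y"
      using x y u v by (auto simp: h_def prod_alg_simps mat_alg_simps l_distr r_distr
          intro!: restrict_ext eq_matI)
    \<comment> \<open>Matrix multiplication comes from inserting the resolution of 1 between x and
      y; blocks j other than i drop out because \<open>v i a \<otimes> x \<otimes> u j c\<close> is
      zero.\<close>
    have "v i a \<otimes> (x \<otimes> y) \<otimes> u i b =
        (\<Oplus>\<^bsub>corner R (p i)\<^esub>c\<in>{..<m i}. (v i a \<otimes> x \<otimes> u i c) \<otimes> (v i c \<otimes> y \<otimes> u i b))"
      if i: "i \<in> I" and ab: "a < m i" "b < m i" for i a b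
    proof -
      let ?w = "v i a \<otimes> x" and ?z = "y \<otimes> u i b"
      have w: "?w \<in> carrier R" and z: "?z \<in> carrier R" using that u v x y by auto
      have eq: "(\<Oplus>j\<in>I. \<Oplus>c\<in>{..<m j}. ?w \<otimes> (u j c \<otimes> v j c)) = (\<Oplus>c\<in>{..<m i}. ?w \<otimes> (u i c \<otimes> v i c))"
      proof (rule finsum_all_but_one_zero[OF I i])
        fix j assume j: "j \<in> I" "j \<noteq> i"
        have "?w \<otimes> (u j c \<otimes> v j c) = (?w \<otimes> u j c) \<otimes> v j c" if "c < m j" for c
          using that j w u(1) v(1) by (simp add: m_assoc)
        then have "(\<Oplus>c\<in>{..<m j}. ?w \<otimes> (u j c \<otimes> v j c)) = (\<Oplus>c\<in>{..<m j}. \<zero>)"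
          using off[OF i j(1)] j ab x v(1) by (intro finsum_cong') auto
        then show "(\<Oplus>c\<in>{..<m j}. ?w \<otimes> (u j c \<otimes> v j c)) = \<zero>"
          by simp
      qed (use w i u v in auto)
      have "v i a \<otimes> (x \<otimes> y) \<otimes> u i b = ?w \<otimes> ?z"
        using i ab u(1) v(1) x y by (simp add: m_assoc)
      also have "\<dots> = (\<Oplus>c\<in>{..<m i}. ?w \<otimes> (u i c \<otimes> v i c)) \<otimes> ?z"
        using insert_one[OF w] eq by simp
      also have "\<dots> = (\<Oplus>c\<in>{..<m i}. ?w \<otimes> (u i c \<otimes> v i c) \<otimes> ?z)"
        by (rule finsum_ldistr) (use i u v w z in auto)
      also have "\<dots> = (\<Oplus>c\<in>{..<m i}. (v i a \<otimes> x \<otimes> u i c) \<otimes> (v i c \<otimes> y \<otimes> u i b))"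
        by (intro finsum_cong') (use i ab u(1) v(1) x y in \<open>auto simp: m_assoc\<close>)
      also have "\<dots> = (\<Oplus>\<^bsub>corner R (p i)\<^esub>c\<in>{..<m i}. (v i a \<otimes> x \<otimes> u i c) \<otimes> (v i c \<otimes> y \<otimes> u i b))"
      proof (rule finsum_corner[symmetric])
        fix c assume "c \<in> {..<m i}"
        then have "v i a \<otimes> x \<otimes> u i c \<in> carrier (corner R (p i))"
          "v i c \<otimes> y \<otimes> u i b \<in> carrier (corner R (p i))"
          using corner_entry i ab x y by auto
        then show "(v i a \<otimes> x \<otimes> u i c) \<otimes> (v i c \<otimes> y \<otimes> u i b) \<in> carrier (corner R (p i))"
          using monoid.m_closed[OF ring.is_monoid[OF ring_corner], of "p i"] p i by (simp del: corner_simps(1))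
      qed (use p i in auto)
      finally show ?thesis .
    qed
    moreover have "(\<Oplus>\<^bsub>corner R (p i)\<^esub>c\<in>{..<m i}. (v i a \<otimes> x \<otimes> u i c) \<otimes> (v i c \<otimes> y \<otimes> u i b)) =
        (\<Oplus>\<^bsub>corner R (p i)\<^esub>c\<in>{..<m i}. h x i $$ (a, c) \<otimes> h y i $$ (c, b))"
      if i: "i \<in> I" and ab: "a < m i" "b < m i" for i a b
    proof -
      interpret C: ring "corner R (p i)" using i p by (intro ring_corner)
      have eq: "h x i $$ (a, c) = v i a \<otimes> x \<otimes> u i c" "h y i $$ (c, b) = v i c \<otimes> y \<otimes> u i b" if "c < m i" for c
        using that i ab by (auto simp: h_def)
      have "h x i $$ (a, c) \<otimes>\<^bsub>corner R (p i)\<^esub> h y i $$ (c, b) \<in> carrier (corner R (p i))" if "c < m i" for c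
        unfolding eq[OF that] by (rule C.m_closed; rule corner_entry) (use i ab that x y in auto)
      then show ?thesis
        by (intro C.finsum_cong') (auto simp: eq)
    qed
    ultimately show "h (x \<otimes> y) = h x \<otimes>\<^bsub>prod_alg I (\<lambda>i. mat_alg (m i) (corner R (p i)))\<^esub> h y"
      by (subst h_def) (auto simp: prod_alg_simps mat_alg_simps intro!: restrict_ext eq_matI)
  next
    show "h \<one> = \<one>\<^bsub>prod_alg I (\<lambda>i. mat_alg (m i) (corner R (p i)))\<^esub>"
      using u v vu by (auto simp: h_def prod_alg_simps mat_alg_simps intro!: restrict_ext eq_matI)
  next
    fix M assume M: "M \<in> carrier (prod_alg I (\<lambda>i. mat_alg (m i) (corner R (p i))))"
    note Mc = carrierD[OF M]
    show kM: "k M \<in> carrier R"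
      unfolding k_def using I u v Mc by (intro finsum_closed Pi_I) auto
    \<comment> \<open>The triple sum \<open>k M\<close> collapses in stages: j is forced to be i by
      \<open>off\<close> with x = 1, then c to be a and d to be b by \<open>vu\<close>.\<close>
    have "v i a \<otimes> k M \<otimes> u i b = M i $$ (a, b)" if i: "i \<in> I" and ab: "a < m i" "b < m i" for i a b
    proof -
      let ?t = "\<lambda>j c d. u j c \<otimes> M j $$ (c, d) \<otimes> v j d"
      have t: "?t j c d \<in> carrier R" if "j \<in> I" "c < m j" "d < m j" for j c d
        using that u v Mc by auto
      have via: "v i a \<in> carrier R" and uib: "u i b \<in> carrier R" using i ab u v by auto
      have zero: "v i a \<otimes> u j c = \<zero>" if "j \<in> I" "c < m j" "j \<noteq> i \<or> c \<noteq> a" for j c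
        using off[OF i that(1) _ ab(1) that(2) one_closed] vu[OF i ab(1), of c] that via by (cases "j = i") auto
      have zero': "v j d \<otimes> u i b = \<zero>" if "j = i" "d < m j" "d \<noteq> b" for j d
        using vu[OF i _ ab(2), of d] that by auto
      have vt: "v i a \<otimes> ?t j c d = (v i a \<otimes> u j c) \<otimes> M j $$ (c, d) \<otimes> v j d"
        if "j \<in> I" "c < m j" "d < m j" for j c d
        using that u(1) v(1) Mc via by (simp add: m_assoc)
      have "v i a \<otimes> k M = (\<Oplus>j\<in>I. \<Oplus>c\<in>{..<m j}. \<Oplus>d\<in>{..<m j}. v i a \<otimes> ?t j c d)"
        unfolding k_def using I t via
        by (subst finsum_rdistr; (intro finsum_cong' refl)?; (subst finsum_rdistr)?;
            (intro finsum_cong' refl)?; (subst finsum_rdistr)?) auto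
      also have "\<dots> = (\<Oplus>c\<in>{..<m i}. \<Oplus>d\<in>{..<m i}. v i a \<otimes> ?t i c d)"
      proof (rule finsum_all_but_one_zero[OF I i])
        fix j assume j: "j \<in> I" "j \<noteq> i"
        have "(\<Oplus>c\<in>{..<m j}. \<Oplus>d\<in>{..<m j}. v i a \<otimes> ?t j c d) = (\<Oplus>c\<in>{..<m j}. \<Oplus>d\<in>{..<m j}. \<zero>)"
          by (intro finsum_cong' refl) (use j zero v Mc in \<open>auto simp: vt\<close>)
        then show "(\<Oplus>c\<in>{..<m j}. \<Oplus>d\<in>{..<m j}. v i a \<otimes> ?t j c d) = \<zero>"
          by simp
      qed (use t via i in auto)
      also have "\<dots> = (\<Oplus>d\<in>{..<m i}. v i a \<otimes> ?t i a d)"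
      proof (rule finsum_all_but_one_zero)
        fix c assume c: "c \<in> {..<m i}" "c \<noteq> a"
        have "(\<Oplus>d\<in>{..<m i}. v i a \<otimes> ?t i c d) = (\<Oplus>d\<in>{..<m i}. \<zero>)"
          by (intro finsum_cong' refl) (use i c zero v Mc in \<open>auto simp: vt\<close>)
        then show "(\<Oplus>d\<in>{..<m i}. v i a \<otimes> ?t i c d) = \<zero>"
          by simp
      qed (use t via i ab in auto)
      also have "\<dots> = (\<Oplus>d\<in>{..<m i}. M i $$ (a, d) \<otimes> v i d)"
        by (intro finsum_cong') (use i ab vu Mc v in \<open>auto simp: vt\<close>)
      finally have "v i a \<otimes> k M \<otimes> u i b = (\<Oplus>d\<in>{..<m i}. M i $$ (a, d) \<otimes> v i d) \<otimes> u i b"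
        by simp
      also have "\<dots> = (\<Oplus>d\<in>{..<m i}. M i $$ (a, d) \<otimes> v i d \<otimes> u i b)"
        by (rule finsum_ldistr) (use i ab Mc v u in auto)
      also have "\<dots> = M i $$ (a, b) \<otimes> v i b \<otimes> u i b"
      proof (rule finsum_all_but_one_zero)
        fix d assume "d \<in> {..<m i}" "d \<noteq> b"
        then show "M i $$ (a, d) \<otimes> v i d \<otimes> u i b = \<zero>"
          using i ab Mc v(1) u(1) zero'[of i d] by (simp add: m_assoc)
      qed (use i ab Mc v u in auto)
      also have "\<dots> = M i $$ (a, b)"
        using i ab Mc v(1) u(1) vu by (simp add: m_assoc)
      finally show ?thesis .
    qed
    then have "h (k M) i = M i" if "i \<in> I" for i
      using that dims[OF M that] by (auto simp: h_def intro!: eq_matI)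
    moreover have "M \<in> extensional I"
      using M by (auto simp: prod_alg_simps PiE_def)
    ultimately show "h (k M) = M"
      by (intro extensionalityI[of _ I]) (auto simp: h_def)
  qed
  then show ?thesis
    by (auto simp: alg_isomorphic_def)
qed

section \<open>The Artin--Wedderburn decomposition over the complex numbers\<close>

context complex_algebra
begin

section \<open>Scalars, polynomial evaluation and eigenvectors\<close>

lemma smult_zero_right [simp]: "a \<odot> \<zero> = \<zero>"
  using smult_mult_left[of \<zero> \<zero> a] by simp

lemma smult_zero_left [simp]:
  assumes "x \<in> carrier R"
  shows "0 \<odot> x = \<zero>"
  using smult_l_distr[OF assms, of 0 0] assms by (metis add_0 smult_closed add.r_cancel_one')

lemma smult_eq_zero_iff:
  assumes "x \<in> carrier R"
  shows "a \<odot> x = \<zero> \<longleftrightarrow> a = 0 \<or> x = \<zero>"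
proof -
  have "x = \<zero>" if "a \<noteq> 0" "a \<odot> x = \<zero>"
    using that assms smult_smult[of x "inverse a" a] by simp
  then show ?thesis
    using assms by auto
qed

lemma smult_cancel:
  assumes "x \<in> carrier R" and "x \<noteq> \<zero>" and "a \<odot> x = b \<odot> x"
  shows "a = b"
proof -
  have "(a - b) \<odot> x = a \<odot> x \<oplus> (- b) \<odot> x"
    using smult_l_distr[OF assms(1), of a "- b"] by simp
  also have "\<dots> = (b + (- b)) \<odot> x"
    using assms smult_l_distr[OF assms(1), of b "- b"] by simp
  finally show ?thesis
    using assms by (simp add: smult_eq_zero_iff)
qed

text \<open>Polynomials are evaluated at \<open>b\<close> with \<open>p\<close> in place of the unit of the algebra.\<close>

definition poly_eval :: "'b \<Rightarrow> 'b \<Rightarrow> complex poly \<Rightarrow> 'b" where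
  "poly_eval p b q = fold_coeffs (\<lambda>a x. a \<odot> p \<oplus> x \<otimes> b) q \<zero>"

context
  fixes p b
  assumes pb: "p \<in> carrier R" "p \<otimes> p = p" "b \<in> carrier R" "p \<otimes> b = b" "b \<otimes> p = b"
begin

lemma poly_eval_0 [simp]: "poly_eval p b 0 = \<zero>"
  by (simp add: poly_eval_def)

lemma poly_eval_pCons [simp]: "poly_eval p b (pCons a q) = a \<odot> p \<oplus> poly_eval p b q \<otimes> b"
  using pb by (cases "q = 0"; cases "a = 0") (simp_all add: poly_eval_def)

lemma poly_eval_closed [simp]: "poly_eval p b q \<in> carrier R"
  using pb by (induction q) auto

lemma poly_eval_corner: "p \<otimes> poly_eval p b q = poly_eval p b q" "poly_eval p b q \<otimes> p = poly_eval p b q"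
proof -
  have "p \<otimes> poly_eval p b q = poly_eval p b q \<and> poly_eval p b q \<otimes> p = poly_eval p b q"
  proof (induction q)
    case (pCons a q)
    have "p \<otimes> (poly_eval p b q \<otimes> b) = poly_eval p b q \<otimes> b"
      using pCons pb m_assoc[of p "poly_eval p b q" b] by simp
    then show ?case
      using pb by (simp add: r_distr l_distr smult_mult_left smult_mult_right m_assoc)
  qed (use pb in simp)
  then show "p \<otimes> poly_eval p b q = poly_eval p b q" "poly_eval p b q \<otimes> p = poly_eval p b q"
    by auto
qed

lemma poly_eval_add: "poly_eval p b (q + r) = poly_eval p b q \<oplus> poly_eval p b r"
proof (induction q r rule: poly_induct2)
  case (pCons a q c r)
  then show ?case
    using pb by (simp add: smult_l_distr l_distr a_ac)
qed simp

lemma poly_eval_smult: "poly_eval p b (Polynomial.smult a q) = a \<odot> poly_eval p b q"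
proof (induction q)
  case (pCons c q)
  then show ?case
    using pb by (simp add: smult_smult smult_r_distr smult_mult_left)
qed simp


lemma poly_eval_sum:
  assumes "finite T"
  shows "poly_eval p b (\<Sum>t\<in>T. q t) = (\<Oplus>t\<in>T. poly_eval p b (q t))"
  using assms by (induction T) (auto simp: poly_eval_add)

text \<open>Roots are split off one at a time. If q = (X - c) r annihilates b, then r(b) b = c r(b):
  either r(b) is the eigenvector wanted, or r annihilates b as well and has smaller degree. The
  descent cannot end in a nonzero constant a, since a p is nonzero.\<close>

lemma poly_eval_root:
  assumes "q \<noteq> 0" and "poly_eval p b q = \<zero>" and "p \<noteq> \<zero>"
  obtains c x where "x \<in> carrier R" and "x \<noteq> \<zero>" and "x \<otimes> p = x" and "x \<otimes> b = c \<odot> x"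
  using assms(1,2)
proof (induction "Polynomial.degree q" arbitrary: q thesis rule: less_induct)
  case less
  show ?case
  proof (cases "Polynomial.degree q = 0")
    case True
    then obtain a where "q = [:a:]"
      by (rule degree_eq_zeroE)
    then show ?thesis
      using less.prems assms(3) pb by (simp add: smult_eq_zero_iff)
  next
    case False
    then obtain c where "poly q c = 0"
      using fundamental_theorem_of_algebra[of q] by (auto simp: constant_degree)
    then obtain r where r: "q = [:- c, 1:] * r"
      by (auto simp: poly_eq_0_iff_dvd elim: dvdE)
    let ?x = "poly_eval p b r"
    \<comment> \<open>\<open>pCons 0 r\<close> is X r, which evaluates to r(b) b.\<close>
    have q: "q = pCons 0 r + Polynomial.smult (- c) r"
      by (simp add: r)
    have "?x \<otimes> b \<oplus> (- c) \<odot> ?x = \<zero>"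
      using less.prems(3)[unfolded q poly_eval_add poly_eval_smult] pb by simp
    moreover have "c \<odot> ?x \<oplus> (- c) \<odot> ?x = \<zero>"
      using smult_l_distr[of ?x c "- c"] by simp
    ultimately have eig: "?x \<otimes> b = c \<odot> ?x"
      using pb by (metis add.r_cancel m_closed poly_eval_closed smult_closed)
    show ?thesis
    proof (cases "?x = \<zero>")
      case True
      have "r \<noteq> 0"
        using r less.prems(2) by auto
      then have "Polynomial.degree r < Polynomial.degree q"
        by (simp add: r degree_mult_eq del: mult_pCons_left)
      then show ?thesis
        using less.hyps[of r] less.prems(1) True \<open>r \<noteq> 0\<close> by blast
    next
      case False
      then show ?thesis
        using less.prems(1)[of ?x c] eig poly_eval_corner by simp
    qed
  qed
qed

end

text \<open>Dimension at most N, stated as linear dependence of any N + 1 elements; the index set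
  \<open>{..N}\<close> has N + 1 members. Families are used in place of sets so that coinciding
  powers of an element are covered.\<close>

definition dim_le :: "nat \<Rightarrow> bool" where
  "dim_le N \<longleftrightarrow> (\<forall>f. f \<in> {..N} \<rightarrow> carrier R \<longrightarrow>
     (\<exists>c. (\<exists>i\<le>N. c i \<noteq> 0) \<and> (\<Oplus>i\<in>{..N}. c i \<odot> f i) = \<zero>))"

text \<open>The N + 1 powers p, b, ..., b^N are linearly dependent, and the coefficients of a
  relation are those of a nonzero polynomial annihilating b.\<close>

lemma ex_eigenvector:
  assumes "dim_le N" and p: "p \<in> carrier R" "p \<otimes> p = p" "p \<noteq> \<zero>"
    and b: "b \<in> carrier R" "p \<otimes> b = b" "b \<otimes> p = b"
  obtains c x where "x \<in> carrier R" and "x \<noteq> \<zero>" and "x \<otimes> p = x" and "x \<otimes> b = c \<odot> x"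
proof -
  note pb = p(1,2) b
  let ?f = "\<lambda>i. poly_eval p b (Polynomial.monom 1 i)"
  have "?f \<in> {..N} \<rightarrow> carrier R"
    using poly_eval_closed[OF pb] by simp
  then obtain c where c: "\<exists>i\<le>N. c i \<noteq> 0" "(\<Oplus>i\<in>{..N}. c i \<odot> ?f i) = \<zero>"
    using assms(1) unfolding dim_le_def by blast
  define q where "q = (\<Sum>i\<in>{..N}. Polynomial.smult (c i) (Polynomial.monom 1 i))"
  have "Polynomial.coeff q i = c i" if "i \<le> N" for i
    using that by (simp add: q_def coeff_sum if_distrib cong: if_cong)
  then have "q \<noteq> 0"
    using c(1) by auto
  moreover have "poly_eval p b q = \<zero>"
    using c(2) by (simp only: q_def poly_eval_sum[OF pb finite_atMost] poly_eval_smult[OF pb])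
  ultimately show ?thesis
    using poly_eval_root[OF pb _ _ p(3)] that by metis
qed

end

section \<open>Left ideals and idempotents\<close>

context ring
begin

text \<open>Closure under negation follows from closure under left multiplication by -1.\<close>

lemma left_idealI:
  assumes "I \<subseteq> carrier R" and "\<zero> \<in> I" and "\<And>x y. x \<in> I \<Longrightarrow> y \<in> I \<Longrightarrow> x \<oplus> y \<in> I"
    and "\<And>r x. r \<in> carrier R \<Longrightarrow> x \<in> I \<Longrightarrow> r \<otimes> x \<in> I"
  shows "left_ideal I R"
proof -
  have "\<ominus> x \<in> I" if "x \<in> I" for x
    using assms(1) assms(4)[of "\<ominus> \<one>" x] that by (auto simp: l_minus)
  then have "subgroup I (add_monoid R)"
    using assms(1,2,3) by (intro add.subgroupI) auto
  then show ?thesis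
    using assms by (auto simp: left_ideal_def intro: additive_subgroupI)
qed

text \<open>Let R be the direct sum of I and J, and 1 = e + f accordingly. For x in I the element x
  f = x - x e lies in both I and J, hence is zero, so e is a right unit on I.\<close>

lemma left_ideal_idempotent:
  assumes "semisimple_ring R" and I: "left_ideal I R"
  obtains e where "e \<in> I" and "e \<otimes> e = e" and "\<And>x. x \<in> I \<Longrightarrow> x \<otimes> e = x"
proof -
  obtain J where J: "left_ideal J R" "I \<inter> J = {\<zero>}" "I <+> J = carrier R"
    using assms unfolding semisimple_ring_def by blast
  interpret I: additive_subgroup I R
    using I by (simp add: left_ideal_def)
  interpret J: additive_subgroup J R
    using J(1) by (simp add: left_ideal_def)
  obtain e f where ef: "e \<in> I" "f \<in> J" "\<one> = e \<oplus> f"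
    using J(3) one_closed unfolding set_add_def' by blast
  have x: "x \<otimes> e = x" if "x \<in> I" for x
  proof -
    note c = I.a_subset[THEN subsetD, OF that] I.a_subset[THEN subsetD, OF ef(1)]
      J.a_subset[THEN subsetD, OF ef(2)]
    have "x \<otimes> \<one> = x \<otimes> e \<oplus> x \<otimes> f"
      unfolding ef(3) using c by (intro r_distr)
    then have xe: "x = x \<otimes> e \<oplus> x \<otimes> f"
      using c by simp
    then have "x \<otimes> f = \<ominus> (x \<otimes> e) \<oplus> x"
      using c by (metis m_closed r_neg1)
    moreover have "x \<otimes> e \<in> I" "x \<otimes> f \<in> J"
      using I J(1) ef c by (auto simp: left_ideal_def)
    ultimately have "x \<otimes> f \<in> I \<inter> J"
      using that by simp
    then show ?thesis
      using J(2) xe c by simp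
  qed
  show thesis
    using that[of e] ef(1) x by simp
qed

definition primitive :: "'a \<Rightarrow> bool" where
  "primitive p \<longleftrightarrow> p \<in> carrier R \<and> p \<noteq> \<zero> \<and> p \<otimes> p = p \<and>
     (\<forall>q\<in>carrier R. q \<otimes> q = q \<and> p \<otimes> q = q \<and> q \<otimes> p = q \<longrightarrow> q = \<zero> \<or> q = p)"

text \<open>Right multiplications by x and y are mutually inverse isomorphisms between the left
  ideals R p and R q, so this is isomorphism of the left modules that p and q generate.\<close>

definition iso_idem :: "'a \<Rightarrow> 'a \<Rightarrow> bool" where
  "iso_idem p q \<longleftrightarrow> (\<exists>x\<in>carrier R. \<exists>y\<in>carrier R.
     p \<otimes> x = x \<and> x \<otimes> q = x \<and> q \<otimes> y = y \<and> y \<otimes> p = y \<and> x \<otimes> y = p \<and> y \<otimes> x = q)"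

lemma iso_idem_refl: "p \<in> carrier R \<Longrightarrow> p \<otimes> p = p \<Longrightarrow> iso_idem p p"
  by (auto simp: iso_idem_def)

lemma iso_idem_sym: "iso_idem p q \<Longrightarrow> iso_idem q p"
  by (auto simp: iso_idem_def)

lemma iso_idem_trans:
  assumes "p \<in> carrier R" "q \<in> carrier R" "r \<in> carrier R" and "iso_idem p q" and "iso_idem q r"
  shows "iso_idem p r"
proof -
  obtain x y where xy: "x \<in> carrier R" "y \<in> carrier R" "p \<otimes> x = x" "x \<otimes> q = x" "q \<otimes> y = y"
    "y \<otimes> p = y" "x \<otimes> y = p" "y \<otimes> x = q"
    using assms(4) by (auto simp: iso_idem_def)
  obtain z w where zw: "z \<in> carrier R" "w \<in> carrier R" "q \<otimes> z = z" "z \<otimes> r = z" "r \<otimes> w = w"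
    "w \<otimes> q = w" "z \<otimes> w = q" "w \<otimes> z = r"
    using assms(5) by (auto simp: iso_idem_def)
  have "(x \<otimes> z) \<otimes> (w \<otimes> y) = x \<otimes> ((z \<otimes> w) \<otimes> y)" "(w \<otimes> y) \<otimes> (x \<otimes> z) = w \<otimes> ((y \<otimes> x) \<otimes> z)"
    "p \<otimes> (x \<otimes> z) = (p \<otimes> x) \<otimes> z" "(x \<otimes> z) \<otimes> r = x \<otimes> (z \<otimes> r)"
    "r \<otimes> (w \<otimes> y) = (r \<otimes> w) \<otimes> y" "(w \<otimes> y) \<otimes> p = w \<otimes> (y \<otimes> p)"
    using xy(1,2) zw(1,2) assms by (simp_all add: m_assoc)
  then show ?thesis
    unfolding iso_idem_def using xy zw
    by (intro bexI[of _ "x \<otimes> z"] bexI[of _ "w \<otimes> y"]) auto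
qed

end

context complex_algebra
begin

text \<open>
  An eigenvector of right multiplication by \<open>b\<close> makes \<open>{x. x p = x \<and> x b = c x}\<close> a nonzero left
  ideal; if it is generated by the idempotent \<open>e\<close>, then \<open>p e\<close> is a nonzero idempotent below \<open>p\<close>, so
  \<open>p\<close> itself lies in the ideal.
\<close>

lemma primitive_corner_scalar:
  assumes "semisimple_ring R" and "dim_le N" and "primitive p"
    and b: "b \<in> carrier R" "p \<otimes> b = b" "b \<otimes> p = b"
  obtains c where "b = c \<odot> p"
proof -
  have p: "p \<in> carrier R" "p \<otimes> p = p" "p \<noteq> \<zero>"
    using assms(3) by (auto simp: primitive_def)
  obtain c x where x: "x \<in> carrier R" "x \<noteq> \<zero>" "x \<otimes> p = x" "x \<otimes> b = c \<odot> x"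
    using ex_eigenvector[OF assms(2) p b] .
  define I where "I = {y \<in> carrier R. y \<otimes> p = y \<and> y \<otimes> b = c \<odot> y}"
  have "left_ideal I R"
    by (rule left_idealI) (use p b in \<open>auto simp: I_def l_distr smult_r_distr m_assoc smult_mult_right\<close>)
  then obtain e where e: "e \<in> I" "e \<otimes> e = e" "\<And>y. y \<in> I \<Longrightarrow> y \<otimes> e = y"
    using left_ideal_idempotent[OF assms(1)] by metis
  then have ep: "e \<in> carrier R" "e \<otimes> p = e" and eb: "e \<otimes> b = c \<odot> e"
    by (auto simp: I_def)
  have "x \<otimes> e = x"
    using x by (intro e(3)) (auto simp: I_def)
  then have "e \<noteq> \<zero>"
    using x by auto
  have 1: "p \<otimes> e \<otimes> (p \<otimes> e) = p \<otimes> ((e \<otimes> p) \<otimes> e)" "p \<otimes> (p \<otimes> e) = (p \<otimes> p) \<otimes> e"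
    "p \<otimes> e \<otimes> p = p \<otimes> (e \<otimes> p)" "e \<otimes> (p \<otimes> e) = (e \<otimes> p) \<otimes> e"
    using p(1) ep(1) by (simp_all add: m_assoc)
  have "p \<otimes> e \<noteq> \<zero>"
    using 1(4) \<open>e \<noteq> \<zero>\<close> ep e(2) by auto
  moreover have "p \<otimes> e = \<zero> \<or> p \<otimes> e = p"
    using assms(3) 1 p ep e(2) unfolding primitive_def by simp
  ultimately have "p = p \<otimes> e"
    by simp
  then have "b = p \<otimes> (e \<otimes> b)"
    using b p ep(1) by (metis m_assoc)
  also have "\<dots> = c \<odot> p"
    using \<open>p = p \<otimes> e\<close> eb p ep by (simp add: smult_mult_right)
  finally show thesis
    by (rule that)
qed

text \<open>A nonzero x = p a q turns out to be invertible between p and q. The left ideal R x has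
  an idempotent e = y x as right unit, so x y x = x. Cutting y down to z = q y p keeps x z x = x,
  while z x and x z are scalar multiples of q and p; the relation x z x = x makes both scalars
  1.\<close>

lemma primitive_iso_idem:
  assumes ss: "semisimple_ring R" and fd: "dim_le N" and pq: "primitive p" "primitive q"
    and a: "a \<in> carrier R" and nz: "p \<otimes> a \<otimes> q \<noteq> \<zero>"
  shows "iso_idem p q"
proof -
  have p: "p \<in> carrier R" "p \<otimes> p = p" and q: "q \<in> carrier R" "q \<otimes> q = q"
    using pq by (auto simp: primitive_def)
  define x where "x = p \<otimes> a \<otimes> q"
  have x: "x \<in> carrier R" "p \<otimes> x = x" "x \<otimes> q = x" "x \<noteq> \<zero>"
    using p q a nz m_assoc[of p p "a \<otimes> q"] by (simp_all add: x_def m_assoc)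
  define I where "I = {y \<otimes> x | y. y \<in> carrier R}"
  have "left_ideal I R"
  proof (rule left_idealI)
    show "\<zero> \<in> I"
      using x(1) by (auto simp: I_def intro!: exI[of _ \<zero>])
  next
    fix y z assume "y \<in> I" "z \<in> I"
    then obtain y' z' where "y' \<in> carrier R" "z' \<in> carrier R" "y = y' \<otimes> x" "z = z' \<otimes> x"
      by (auto simp: I_def)
    then show "y \<oplus> z \<in> I"
      using x(1) by (auto simp: I_def l_distr intro!: exI[of _ "y' \<oplus> z'"])
  next
    fix t y assume "t \<in> carrier R" "y \<in> I"
    then obtain y' where "t \<in> carrier R" "y' \<in> carrier R" "y = y' \<otimes> x"
      by (auto simp: I_def)
    then show "t \<otimes> y \<in> I"
      using x(1) by (auto simp: I_def m_assoc intro!: exI[of _ "t \<otimes> y'"])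
  qed (use x in \<open>auto simp: I_def\<close>)
  then obtain e where e: "e \<in> I" "\<And>z. z \<in> I \<Longrightarrow> z \<otimes> e = z"
    using left_ideal_idempotent[OF ss] by metis
  then obtain y where y: "y \<in> carrier R" "e = y \<otimes> x"
    by (auto simp: I_def)
  have "x \<in> I"
    using x by (auto simp: I_def intro!: exI[of _ \<one>])
  then have xyx: "x \<otimes> (y \<otimes> x) = x"
    using e(2) y(2) by auto
  define z where "z = q \<otimes> y \<otimes> p"
  have z: "z \<in> carrier R" "q \<otimes> z = z" "z \<otimes> p = z"
    using p q y m_assoc[of q q "y \<otimes> p"] by (simp_all add: z_def m_assoc)
  have xzx: "x \<otimes> (z \<otimes> x) = x"
  proof -
    have "x \<otimes> (z \<otimes> x) = (x \<otimes> q) \<otimes> (y \<otimes> (p \<otimes> x))"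
      using x(1) y p q by (simp add: z_def m_assoc)
    then show ?thesis
      using x xyx by simp
  qed
  have zx: "q \<otimes> (z \<otimes> x) = z \<otimes> x" "(z \<otimes> x) \<otimes> q = z \<otimes> x" "z \<otimes> x \<in> carrier R"
    using x z q m_assoc[of q z x] m_assoc[of z x q] by simp_all
  have xz: "p \<otimes> (x \<otimes> z) = x \<otimes> z" "(x \<otimes> z) \<otimes> p = x \<otimes> z" "x \<otimes> z \<in> carrier R"
    using x z p m_assoc[of p x z] m_assoc[of x z p] by simp_all
  obtain c where c: "z \<otimes> x = c \<odot> q"
    using primitive_corner_scalar[OF ss fd pq(2) zx(3,1,2)] .
  have "c \<odot> x = 1 \<odot> x"
    using xzx c x q by (simp add: smult_mult_right)
  then have "c = 1"
    using smult_cancel[OF x(1,4)] by simp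
  obtain d where d: "x \<otimes> z = d \<odot> p"
    using primitive_corner_scalar[OF ss fd pq(1) xz(3,1,2)] .
  have "d \<odot> x = (x \<otimes> z) \<otimes> x"
    using d x p by (simp add: smult_mult_left)
  then have "d \<odot> x = 1 \<odot> x"
    using xzx x z by (simp add: m_assoc)
  then have "d = 1"
    using smult_cancel[OF x(1,4)] by simp
  show ?thesis
    unfolding iso_idem_def using x z c d \<open>c = 1\<close> \<open>d = 1\<close> p q by (intro bexI[of _ x] bexI[of _ z]) auto
qed

text \<open>The complex numbers appear as 1 by 1 matrices, so that a matrix algebra over the corner
  flattens to a complex matrix algebra of the same size.\<close>

lemma corner_isomorphic_complex:
  assumes ss: "semisimple_ring R" and fd: "dim_le N" and "primitive p"
  shows "corner R p \<simeq>\<^sub>a\<^sub>l\<^sub>g complex_mat_alg 1"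
proof -
  have p: "p \<in> carrier R" "p \<otimes> p = p" "p \<noteq> \<zero>"
    using assms(3) by (auto simp: primitive_def)
  have "\<forall>x\<in>carrier (corner R p). \<exists>c. x = c \<odot> p"
    using primitive_corner_scalar[OF assms] by (metis (mono_tags, lifting) corner_simps(1) mem_Collect_eq)
  then obtain c where c: "\<And>x. x \<in> carrier (corner R p) \<Longrightarrow> x = c x \<odot> p"
    by metis
  \<comment> \<open>The coordinate function c was chosen by existence only. Since p is nonzero the
    coordinate is unique, and the homomorphism laws follow once sums and products are written as
    multiples of p.\<close>
  have c_eq: "c x = a" if "x = a \<odot> p" for x a
  proof -
    have "a \<odot> p \<in> carrier (corner R p)"
      using p by (simp add: smult_mult_left smult_mult_right)
    then show ?thesis
      using c[of x] that smult_cancel[OF p(1,3)] by metis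
  qed
  have "(\<lambda>x. mat 1 1 (\<lambda>_. c x)) \<in> alg_iso (corner R p) (complex_mat_alg 1)"
  proof (rule alg_isoI[where k = "\<lambda>M. M $$ (0, 0) \<odot> p"])
    fix x assume x: "x \<in> carrier (corner R p)"
    show "mat 1 1 (\<lambda>_. c (a \<odot>\<^bsub>corner R p\<^esub> x)) = a \<odot>\<^bsub>complex_mat_alg 1\<^esub> mat 1 1 (\<lambda>_. c x)" for a
    proof -
      have "a \<odot> x = (a * c x) \<odot> p"
        using p by (subst c[OF x]) (simp add: smult_smult)
      then show ?thesis
        by (auto simp: module_mat_simps c_eq intro!: eq_matI)
    qed
    fix y assume y: "y \<in> carrier (corner R p)"
    have "x \<otimes> y = (c x * c y) \<odot> p"
      using p by (subst c[OF x], subst c[OF y]) (simp add: smult_smult smult_mult_left smult_mult_right mult.commute)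
    then show "mat 1 1 (\<lambda>_. c (x \<otimes>\<^bsub>corner R p\<^esub> y)) =
        mat 1 1 (\<lambda>_. c x) \<otimes>\<^bsub>complex_mat_alg 1\<^esub> mat 1 1 (\<lambda>_. c y)"
      by (auto simp: module_mat_simps scalar_prod_def c_eq intro!: eq_matI)
    have "x \<oplus> y = (c x + c y) \<odot> p"
      using p by (subst c[OF x], subst c[OF y]) (simp add: smult_l_distr)
    then show "mat 1 1 (\<lambda>_. c (x \<oplus>\<^bsub>corner R p\<^esub> y)) =
        mat 1 1 (\<lambda>_. c x) \<oplus>\<^bsub>complex_mat_alg 1\<^esub> mat 1 1 (\<lambda>_. c y)"
      by (auto simp: module_mat_simps c_eq intro!: eq_matI)
  next
    have "c p = 1"
      using p by (intro c_eq) simp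
    then show "mat 1 1 (\<lambda>_. c \<one>\<^bsub>corner R p\<^esub>) = \<one>\<^bsub>complex_mat_alg 1\<^esub>"
      by (auto simp: module_mat_simps intro!: eq_matI)
  next
    fix M assume "M \<in> carrier (complex_mat_alg 1)"
    then show "mat 1 1 (\<lambda>_. c (M $$ (0, 0) \<odot> p)) = M"
      by (auto simp: module_mat_simps c_eq[OF refl] intro!: eq_matI)
  qed (use p c in \<open>auto simp: module_mat_simps smult_mult_left smult_mult_right\<close>)
  then show ?thesis
    by (auto simp: alg_isomorphic_def)
qed

section \<open>Complete orthogonal families of idempotents\<close>

definition orthogonal_idempotents :: "'b set \<Rightarrow> bool" where
  "orthogonal_idempotents P \<longleftrightarrow> finite P \<and> P \<subseteq> carrier R \<and> \<zero> \<notin> P \<and> (\<forall>p\<in>P. p \<otimes> p = p) \<and>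
     (\<forall>p\<in>P. \<forall>q\<in>P. p \<noteq> q \<longrightarrow> p \<otimes> q = \<zero>) \<and> (\<Oplus>p\<in>P. p) = \<one>"

text \<open>Nonzero orthogonal idempotents are linearly independent: multiplying a relation by
  \<open>f i\<close> leaves only the term \<open>c i \<odot> f i\<close>. The bound lets a family of
  maximal size be chosen.\<close>

lemma card_orthogonal_idempotents_le:
  assumes fd: "dim_le N" and P: "orthogonal_idempotents P"
  shows "card P \<le> N"
proof (rule ccontr)
  assume "\<not> card P \<le> N"
  then have "card {..N} \<le> card P"
    by simp
  moreover have "finite P"
    using P by (simp add: orthogonal_idempotents_def)
  ultimately obtain f where f: "f ` {..N} \<subseteq> P" "inj_on f {..N}"
    using card_le_inj[of "{..N}" P] by auto
  have fP: "f i \<in> P" "f i \<in> carrier R" if "i \<le> N" for i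
    using f(1) that P by (auto simp: orthogonal_idempotents_def)
  have "f \<in> {..N} \<rightarrow> carrier R"
    using fP(2) by simp
  then obtain c where "\<exists>i\<le>N. c i \<noteq> 0" and c0: "(\<Oplus>j\<in>{..N}. c j \<odot> f j) = \<zero>"
    using fd unfolding dim_le_def by blast
  then obtain i where c: "i \<le> N" "c i \<noteq> 0"
    by blast
  have ortho: "f i \<otimes> (c j \<odot> f j) = \<zero>" if "j \<le> N" "j \<noteq> i" for j
  proof -
    have "f i \<noteq> f j"
      using f(2) that c(1) by (auto dest: inj_onD)
    then show ?thesis
      using P fP that c(1) by (auto simp: smult_mult_right orthogonal_idempotents_def)
  qed
  have "\<zero> = f i \<otimes> (\<Oplus>j\<in>{..N}. c j \<odot> f j)"
    using c c0 fP by simp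
  also have "\<dots> = (\<Oplus>j\<in>{..N}. f i \<otimes> (c j \<odot> f j))"
    by (rule finsum_rdistr) (use c fP in auto)
  also have "\<dots> = f i \<otimes> (c i \<odot> f i)"
    by (rule finsum_all_but_one_zero) (use c fP ortho in auto)
  also have "\<dots> = c i \<odot> f i"
    using P fP c(1) by (simp add: smult_mult_right orthogonal_idempotents_def)
  finally show False
    using c fP P by (metis smult_eq_zero_iff orthogonal_idempotents_def)
qed

text \<open>An orthogonal family of maximal size consists of primitive idempotents.\<close>

lemma ex_primitive_decomposition:
  assumes fd: "dim_le N"
  obtains P where "orthogonal_idempotents P" and "\<And>p. p \<in> P \<Longrightarrow> primitive p"
proof -
  \<comment> \<open>In the zero ring the element 1 is zero and may not belong to the family, but
    there the empty sum is already 1.\<close>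
  have "orthogonal_idempotents (if \<one> = \<zero> then {} else {\<one>})"
    by (simp add: orthogonal_idempotents_def)
  then obtain P where P: "orthogonal_idempotents P"
    and max: "\<And>Q. orthogonal_idempotents Q \<Longrightarrow> card Q \<le> card P"
    using ex_has_greatest_nat[of orthogonal_idempotents _ card "Suc N"]
      card_orthogonal_idempotents_le[OF fd] le_imp_less_Suc by metis
  have fin: "finite P" and PD: "\<And>p. p \<in> P \<Longrightarrow> p \<in> carrier R" "\<And>p. p \<in> P \<Longrightarrow> p \<noteq> \<zero>"
    "\<And>p. p \<in> P \<Longrightarrow> p \<otimes> p = p" "\<And>p q. p \<in> P \<Longrightarrow> q \<in> P \<Longrightarrow> p \<noteq> q \<Longrightarrow> p \<otimes> q = \<zero>"
    and sum: "(\<Oplus>p\<in>P. p) = \<one>"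
    using P by (auto simp: orthogonal_idempotents_def)
  have "primitive p" if p: "p \<in> P" for p
  proof (rule ccontr)
    assume "\<not> primitive p"
    then obtain q where q: "q \<in> carrier R" "q \<otimes> q = q" "p \<otimes> q = q" "q \<otimes> p = q" "q \<noteq> \<zero>" "q \<noteq> p"
      using PD p by (auto simp: primitive_def)
    note pc = PD(1)[OF p]
    \<comment> \<open>As p is not primitive, p = q + r with nonzero orthogonal idempotents q and r;
      replacing p by the two enlarges the family.\<close>
    define r where "r = p \<ominus> q"
    have r: "r \<in> carrier R" "r \<noteq> \<zero>"
      using q pc by (auto simp: r_def)
    have qr: "q \<oplus> r = p" "q \<otimes> r = \<zero>" "r \<otimes> q = \<zero>" "p \<otimes> r = r" "r \<otimes> p = r"
      using q pc PD(3)[OF p] by (simp_all add: r_def a_minus_def r_distr l_distr r_minus l_minus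
          r_neg l_neg a_lcomm[of q p])
    have rr: "r \<otimes> r = r"
    proof -
      have "r \<otimes> r = r \<otimes> p \<ominus> r \<otimes> q"
        using r q pc by (simp add: r_def a_minus_def r_distr r_minus)
      then show ?thesis
        using r qr by (simp add: a_minus_def)
    qed
    note r = r qr rr
    have ortho: "q \<otimes> s = \<zero>" "s \<otimes> q = \<zero>" "r \<otimes> s = \<zero>" "s \<otimes> r = \<zero>" if s: "s \<in> P - {p}" for s
    proof -
      have "p \<otimes> s = \<zero>" "s \<otimes> p = \<zero>" "s \<in> carrier R"
        using PD(1,4) p s by auto
      then have "t \<otimes> s = \<zero> \<and> s \<otimes> t = \<zero>" if "t \<in> carrier R" "p \<otimes> t = t" "t \<otimes> p = t" for t
        using that pc m_assoc[of t p s] m_assoc[of s p t] by simp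
      then show "q \<otimes> s = \<zero>" "s \<otimes> q = \<zero>" "r \<otimes> s = \<zero>" "s \<otimes> r = \<zero>"
        using q r by auto
    qed
    \<comment> \<open>The count goes up only if q and r are new and distinct. Each coincidence would
      turn an orthogonality relation into q q = 0 or r r = 0.\<close>
    have new: "q \<notin> P - {p}" "r \<notin> P - {p}" "q \<noteq> r"
      using ortho q r PD(3) by (metis DiffD1 q(2,5), metis DiffD1 r(2,5), metis)
    let ?Q = "insert q (insert r (P - {p}))"
    have PC: "P - {p} \<subseteq> carrier R"
      using PD(1) by auto
    then have "(\<Oplus>s\<in>?Q. s) = q \<oplus> (r \<oplus> (\<Oplus>s\<in>P - {p}. s))"
      using fin new q r by (simp add: Pi_def subset_iff)
    also have "\<dots> = p \<oplus> (\<Oplus>s\<in>P - {p}. s)"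
      using PC q r(1) qr(1)[symmetric] by (simp add: a_assoc Pi_def subset_iff)
    also have "\<dots> = (\<Oplus>s\<in>insert p (P - {p}). s)"
      using fin PC pc by (subst finsum_insert) (auto simp: Pi_def)
    also have "\<dots> = \<one>"
      using sum p by (simp add: insert_absorb)
    finally have "(\<Oplus>s\<in>?Q. s) = \<one>" .
    moreover have "s \<otimes> t = \<zero>" if "s \<in> ?Q" "t \<in> ?Q" "s \<noteq> t" for s t
      using that ortho r PD(4) by blast
    ultimately have "orthogonal_idempotents ?Q"
      using fin q r PD PC by (auto simp: orthogonal_idempotents_def)
    then have "card ?Q \<le> card P"
      by (rule max)
    moreover have "card ?Q = Suc (Suc (card (P - {p})))"
      using fin new by (simp del: card_Diff_insert)
    ultimately show False
      using card_Suc_Diff1[OF fin p] by linarith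
  qed
  then show thesis
    using P that by blast
qed

text \<open>The blocks are the classes of P under \<open>iso_idem\<close>, and \<open>d i\<close> is
  the size of class i. Equivalences with a representative \<open>p i\<close> supply the u and v of
  the Peirce decomposition; for p and q in different classes \<open>primitive_iso_idem\<close>
  forces p R q = 0.\<close>

theorem artin_wedderburn_exists:
  assumes ss: "semisimple_ring R" and fd: "dim_le N"
  shows "\<exists>e d. artin_wedderburn R e d"
proof -
  obtain P where P: "orthogonal_idempotents P" and prim: "\<And>p. p \<in> P \<Longrightarrow> primitive p"
    using ex_primitive_decomposition[OF fd] by blast
  have fin: "finite P" and PD: "\<And>p. p \<in> P \<Longrightarrow> p \<in> carrier R" "\<And>p. p \<in> P \<Longrightarrow> p \<otimes> p = p"
    "\<And>p q. p \<in> P \<Longrightarrow> q \<in> P \<Longrightarrow> p \<noteq> q \<Longrightarrow> p \<otimes> q = \<zero>" and sum: "(\<Oplus>p\<in>P. p) = \<one>"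
    using P by (auto simp: orthogonal_idempotents_def)
  define r where "r = {(p, q) \<in> P \<times> P. iso_idem p q}"
  have r: "equiv P r"
    using PD iso_idem_refl iso_idem_sym
    by (auto simp: r_def equiv_def refl_on_def sym_def trans_def intro: iso_idem_trans[OF PD(1) PD(1) PD(1)])
  have "finite (P // r)"
    using fin by (intro finite_quotient) (auto simp: r_def)
  then obtain \<kappa> where \<kappa>: "bij_betw \<kappa> {1..card (P // r)} (P // r)"
    using ex_bij_betw_nat_finite_1 by blast
  define e where "e = card (P // r)"
  define d where "d i = card (\<kappa> i)" for i
  have \<kappa>_class: "\<kappa> i \<in> P // r" if "i \<in> {1..e}" for i
    using \<kappa> that by (auto simp: bij_betw_def e_def)
  then have \<kappa>_sub: "\<kappa> i \<subseteq> P" if "i \<in> {1..e}" for i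
    using that r by (metis in_quotient_imp_subset)
  then have \<kappa>_carrier: "q \<in> carrier R" if "i \<in> {1..e}" "q \<in> \<kappa> i" for i q
    using that PD(1) by blast
  have \<kappa>_fin: "finite (\<kappa> i)" if "i \<in> {1..e}" for i
    using that fin \<kappa>_sub finite_subset by metis
  have "\<forall>i\<in>{1..e}. \<exists>\<beta>. bij_betw \<beta> {..<d i} (\<kappa> i)"
    using \<kappa>_fin ex_bij_betw_nat_finite by (metis atLeast0LessThan d_def)
  then obtain \<beta> where \<beta>: "\<And>i. i \<in> {1..e} \<Longrightarrow> bij_betw (\<beta> i) {..<d i} (\<kappa> i)"
    by metis
  have d_pos: "d i \<ge> 1" if "i \<in> {1..e}" for i
    using \<kappa>_fin[OF that] in_quotient_imp_non_empty[OF r \<kappa>_class[OF that]]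
    by (simp add: d_def card_gt_0_iff Suc_le_eq)
  \<comment> \<open>Index 0 is in range because classes are nonempty, so the representative is a
    member of its class.\<close>
  define p where "p i = \<beta> i 0" for i
  have \<beta>_class: "\<beta> i a \<in> \<kappa> i" if "i \<in> {1..e}" "a < d i" for i a
    using \<beta>[OF that(1)] that(2) by (auto simp: bij_betw_def)
  then have \<beta>P: "\<beta> i a \<in> P" if "i \<in> {1..e}" "a < d i" for i a
    using that \<kappa>_sub by blast
  have pP: "p i \<in> P" if "i \<in> {1..e}" for i
    using that d_pos[OF that] by (auto simp: p_def intro: \<beta>P)
  have "iso_idem (\<beta> i a) (p i)" if "i \<in> {1..e}" "a < d i" for i a
  proof -
    have "(\<beta> i a, p i) \<in> r"
      using quotient_eq_iff[OF r \<kappa>_class \<kappa>_class \<beta>_class \<beta>_class, of i i a 0] that d_pos[OF that(1)]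
      by (auto simp: p_def)
    then show ?thesis
      by (simp add: r_def)
  qed
  then have "\<forall>i\<in>{1..e}. \<forall>a\<in>{..<d i}. \<exists>x y. x \<in> carrier R \<and> y \<in> carrier R \<and> \<beta> i a \<otimes> x = x \<and> x \<otimes> p i = x \<and>
      p i \<otimes> y = y \<and> y \<otimes> \<beta> i a = y \<and> x \<otimes> y = \<beta> i a \<and> y \<otimes> x = p i"
    unfolding iso_idem_def by blast
  then obtain u v where uv: "\<And>i a. i \<in> {1..e} \<Longrightarrow> a < d i \<Longrightarrow> u i a \<in> carrier R \<and> v i a \<in> carrier R \<and>
      \<beta> i a \<otimes> u i a = u i a \<and> u i a \<otimes> p i = u i a \<and> p i \<otimes> v i a = v i a \<and> v i a \<otimes> \<beta> i a = v i a \<and>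
      u i a \<otimes> v i a = \<beta> i a \<and> v i a \<otimes> u i a = p i"
    by (metis lessThan_iff)
  have "R \<simeq>\<^sub>a\<^sub>l\<^sub>g prod_alg {1..e} (\<lambda>i. mat_alg (d i) (corner R (p i)))"
  proof (rule peirce_decomposition[where u = u and v = v])
    fix i a b assume i: "i \<in> {1..e}" and a: "a < d i" and b: "b < d i"
    show "v i a \<otimes> u i b = (if a = b then p i else \<zero>)"
    proof (cases "a = b")
      case False
      then have "\<beta> i a \<noteq> \<beta> i b"
        using \<beta>[OF i] a b by (auto simp: bij_betw_def dest: inj_onD)
      then have "\<beta> i a \<otimes> \<beta> i b = \<zero>"
        using PD(3) \<beta>P i a b by blast
      moreover have "(v i a \<otimes> \<beta> i a) \<otimes> (\<beta> i b \<otimes> u i b) = v i a \<otimes> (\<beta> i a \<otimes> \<beta> i b) \<otimes> u i b"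
      proof -
        have "v i a \<in> carrier R" "u i b \<in> carrier R" "\<beta> i a \<in> carrier R" "\<beta> i b \<in> carrier R"
          using uv i a b PD(1) \<beta>P by auto
        then show ?thesis
          by (simp add: m_assoc)
      qed
      ultimately show ?thesis
        using False uv[OF i a] uv[OF i b] by simp
    qed (use uv i a in simp)
  next
    fix i j a b x assume i: "i \<in> {1..e}" and j: "j \<in> {1..e}" and "i \<noteq> j" and a: "a < d i" and b: "b < d j"
      and x: "x \<in> carrier R"
    have c: "\<beta> i a \<in> carrier R" "\<beta> j b \<in> carrier R"
      using PD(1) \<beta>P i j a b by auto
    have "\<beta> i a \<otimes> x \<otimes> \<beta> j b = \<zero>"
    proof (rule ccontr)
      assume "\<beta> i a \<otimes> x \<otimes> \<beta> j b \<noteq> \<zero>"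
      then have "iso_idem (\<beta> i a) (\<beta> j b)"
        using primitive_iso_idem[OF ss fd] prim \<beta>P i j a b x by blast
      then have "(\<beta> i a, \<beta> j b) \<in> r"
        using \<beta>P i j a b by (simp add: r_def)
      then have "\<kappa> i = \<kappa> j"
        using quotient_eq_iff[OF r \<kappa>_class[OF i] \<kappa>_class[OF j] \<beta>_class[OF i a] \<beta>_class[OF j b]] by simp
      then show False
        using \<kappa> i j \<open>i \<noteq> j\<close> by (auto simp: bij_betw_def e_def dest: inj_onD)
    qed
    moreover have "(v i a \<otimes> \<beta> i a) \<otimes> x \<otimes> (\<beta> j b \<otimes> u j b) = v i a \<otimes> (\<beta> i a \<otimes> x \<otimes> \<beta> j b) \<otimes> u j b"
    proof -
      have "v i a \<in> carrier R" "u j b \<in> carrier R"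
        using uv i j a b by auto
      then show ?thesis
        using c x by (simp add: m_assoc)
    qed
    ultimately show "v i a \<otimes> x \<otimes> u j b = \<zero>"
      using uv[OF i a] uv[OF j b] by simp
  next
    have "(\<Oplus>i\<in>{1..e}. \<Oplus>a\<in>{..<d i}. u i a \<otimes> v i a) = (\<Oplus>i\<in>{1..e}. \<Oplus>q\<in>\<kappa> i. q)"
    proof (intro finsum_cong' refl)
      fix i assume i: "i \<in> {1..e}"
      have "(\<Oplus>a\<in>{..<d i}. u i a \<otimes> v i a) = (\<Oplus>a\<in>{..<d i}. \<beta> i a)"
        by (intro finsum_cong') (use uv i PD(1) \<beta>P in auto)
      also have "\<dots> = (\<Oplus>q\<in>\<beta> i ` {..<d i}. q)"
        by (rule finsum_reindex[symmetric]) (use \<beta>[OF i] PD(1) \<kappa>_sub[OF i] in \<open>auto simp: bij_betw_def\<close>)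
      finally show "(\<Oplus>a\<in>{..<d i}. u i a \<otimes> v i a) = (\<Oplus>q\<in>\<kappa> i. q)"
        using \<beta>[OF i] by (simp add: bij_betw_def)
    qed (use \<kappa>_carrier in \<open>auto intro!: finsum_closed\<close>)
    also have "\<dots> = (\<Oplus>q\<in>\<Union>(\<kappa> ` {1..e}). q)"
    proof (rule add.finprod_UN_disjoint[symmetric])
      show "pairwise (\<lambda>i j. disjnt (\<kappa> i) (\<kappa> j)) {1..e}"
      proof (rule pairwiseI)
        fix i j assume ij: "i \<in> {1..e}" "j \<in> {1..e}" "i \<noteq> j"
        then have "\<kappa> i \<noteq> \<kappa> j"
          using \<kappa> by (metis bij_betw_def e_def inj_onD)
        then show "disjnt (\<kappa> i) (\<kappa> j)"
          using quotient_disj[OF r \<kappa>_class[OF ij(1)] \<kappa>_class[OF ij(2)]] by (simp add: disjnt_def)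
      qed
    qed (use \<kappa>_fin \<kappa>_carrier in auto)
    also have "\<Union>(\<kappa> ` {1..e}) = P"
      using \<kappa> Union_quotient[OF r] by (simp add: bij_betw_def e_def)
    finally show "(\<Oplus>i\<in>{1..e}. \<Oplus>a\<in>{..<d i}. u i a \<otimes> v i a) = \<one>"
      using sum by simp
  qed (use uv pP PD in auto)
  also have "prod_alg {1..e} (\<lambda>i. mat_alg (d i) (corner R (p i))) \<simeq>\<^sub>a\<^sub>l\<^sub>g
      prod_alg {1..e} (\<lambda>i. mat_alg (d i) (complex_mat_alg 1))"
    using pP PD prim corner_isomorphic_complex[OF ss fd]
    by (intro prod_alg_cong mat_alg_cong ring_corner ring_complex_mat_alg) auto
  also have "\<dots> \<simeq>\<^sub>a\<^sub>l\<^sub>g prod_alg {1..e} (\<lambda>i. complex_mat_alg (d i))"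
    using mat_alg_complex_mat_alg[of 1] by (intro prod_alg_cong) simp
  finally show ?thesis
    using d_pos unfolding artin_wedderburn_def by blast
qed

end

section \<open>Algebras of finite groupoids\<close>

text \<open>A homogeneous linear system with unknowns indexed by T and fewer equations than
  unknowns. Induction on the equations: the one at s eliminates an unknown \<open>t0\<close>, unless
  all its coefficients vanish.\<close>

lemma ex_nontrivial_solution:
  fixes v :: "'t \<Rightarrow> 'b \<Rightarrow> 'a::field"
  assumes "finite S" and "finite T" and "card S < card T"
  shows "\<exists>c. (\<exists>t\<in>T. c t \<noteq> 0) \<and> (\<forall>x\<in>S. (\<Sum>t\<in>T. c t * v t x) = 0)"
  using assms
proof (induction S arbitrary: T v rule: finite_induct)
  case empty
  then show ?case
    by (intro exI[of _ "\<lambda>_. 1"]) (auto simp: card_gt_0_iff)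
next
  case (insert s S)
  show ?case
  proof (cases "\<forall>t\<in>T. v t s = 0")
    case True
    obtain c where "\<exists>t\<in>T. c t \<noteq> 0" "\<forall>x\<in>S. (\<Sum>t\<in>T. c t * v t x) = 0"
      using insert.IH[of T v] insert.prems insert.hyps by auto
    then show ?thesis
      using True by (intro exI[of _ c]) auto
  next
    case False
    then obtain t0 where t0: "t0 \<in> T" "v t0 s \<noteq> 0"
      by blast
    let ?T = "T - {t0}"
    \<comment> \<open>Gaussian elimination with pivot \<open>v t0 s\<close>: the entries of w at s
      are zero.\<close>
    define w where "w t x = v t x - v t s / v t0 s * v t0 x" for t x
    have "card S < card ?T"
      using insert.prems insert.hyps t0 by simp
    then obtain c where c: "\<exists>t\<in>?T. c t \<noteq> 0" "\<And>x. x \<in> S \<Longrightarrow> (\<Sum>t\<in>?T. c t * w t x) = 0"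
      using insert.IH[of ?T w] insert.prems by auto
    \<comment> \<open>The value -d of the eliminated unknown is forced by the equation at s.\<close>
    define d where "d = (\<Sum>t\<in>?T. c t * (v t s / v t0 s))"
    define c' where "c' = c(t0 := - d)"
    have split: "(\<Sum>t\<in>T. c' t * v t x) = (\<Sum>t\<in>?T. c t * v t x) - d * v t0 x" for x
      using insert.prems t0 by (simp add: sum.remove[OF _ t0(1)] c'_def)
    have "(\<Sum>t\<in>T. c' t * v t x) = 0" if "x \<in> S" for x
    proof -
      have "(\<Sum>t\<in>?T. c t * v t x) - d * v t0 x = (\<Sum>t\<in>?T. c t * w t x)"
        by (simp add: w_def d_def sum_distrib_right sum_subtractf right_diff_distrib mult.assoc)
      then show ?thesis
        using c(2)[OF that] split by simp
    qed
    moreover have "(\<Sum>t\<in>T. c' t * v t s) = 0"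
    proof -
      have "d * v t0 s = (\<Sum>t\<in>?T. c t * v t s)"
        using t0 by (simp add: d_def sum_distrib_right)
      then show ?thesis
        using split by simp
    qed
    moreover have "\<exists>t\<in>T. c' t \<noteq> 0"
      using c(1) by (auto simp: c'_def)
    ultimately show ?thesis
      by (intro exI[of _ c']) auto
  qed
qed

lemma sum_swap4:
  fixes F :: "'s \<Rightarrow> 'w \<Rightarrow> 'x \<Rightarrow> 'y \<Rightarrow> 'a::comm_monoid_add"
  shows "(\<Sum>s\<in>A. \<Sum>w\<in>B. \<Sum>x\<in>C. \<Sum>y\<in>D. F s w x y) = (\<Sum>x\<in>C. \<Sum>y\<in>D. \<Sum>w\<in>B. \<Sum>s\<in>A. F s w x y)"
proof -
  have "(\<Sum>s\<in>A. \<Sum>w\<in>B. \<Sum>x\<in>C. \<Sum>y\<in>D. F s w x y) = (\<Sum>s\<in>A. \<Sum>x\<in>C. \<Sum>w\<in>B. \<Sum>y\<in>D. F s w x y)"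
    by (intro sum.cong refl sum.swap)
  also have "\<dots> = (\<Sum>x\<in>C. \<Sum>s\<in>A. \<Sum>w\<in>B. \<Sum>y\<in>D. F s w x y)"
    by (rule sum.swap)
  also have "\<dots> = (\<Sum>x\<in>C. \<Sum>s\<in>A. \<Sum>y\<in>D. \<Sum>w\<in>B. F s w x y)"
    by (intro sum.cong refl sum.swap)
  also have "\<dots> = (\<Sum>x\<in>C. \<Sum>y\<in>D. \<Sum>s\<in>A. \<Sum>w\<in>B. F s w x y)"
    by (intro sum.cong refl sum.swap)
  also have "\<dots> = (\<Sum>x\<in>C. \<Sum>y\<in>D. \<Sum>w\<in>B. \<Sum>s\<in>A. F s w x y)"
    by (intro sum.cong refl sum.swap)
  finally show ?thesis .
qed

section \<open>The algebra spanned by the arrows of a finite groupoid\<close>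

lemma basis_alg_simps:
  "carrier (basis_alg S p U) = {f. finite {x. f x \<noteq> 0} \<and> {x. f x \<noteq> 0} \<subseteq> S}"
  "f \<otimes>\<^bsub>basis_alg S p U\<^esub> g =
     (\<lambda>z. \<Sum>(x, y) \<in> {(x, y). f x \<noteq> 0 \<and> g y \<noteq> 0 \<and> p x y = Some z}. f x * g y)"
  "\<one>\<^bsub>basis_alg S p U\<^esub> = (\<lambda>x. if x \<in> U then 1 else 0)"
  "\<zero>\<^bsub>basis_alg S p U\<^esub> = (\<lambda>_. 0)"
  "f \<oplus>\<^bsub>basis_alg S p U\<^esub> g = (\<lambda>x. f x + g x)"
  "a \<odot>\<^bsub>basis_alg S p U\<^esub> f = (\<lambda>x. a * f x)"
  by (simp_all add: basis_alg_def)

lemma basis_alg_carrier_iff: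
  "finite S \<Longrightarrow> f \<in> carrier (basis_alg S p U) \<longleftrightarrow> (\<forall>x. x \<notin> S \<longrightarrow> f x = 0)"
  by (auto simp: basis_alg_simps intro: finite_subset[of _ S])

text \<open>Summing over S instead of over the supports makes the index sets independent of f and g,
  so that sums can be interchanged; the additional terms are zero.\<close>

lemma basis_alg_mult:
  assumes "finite S" and "f \<in> carrier (basis_alg S p U)" and "g \<in> carrier (basis_alg S p U)"
  shows "(f \<otimes>\<^bsub>basis_alg S p U\<^esub> g) z = (\<Sum>x\<in>S. \<Sum>y\<in>S. if p x y = Some z then f x * g y else 0)"
proof -
  have "(f \<otimes>\<^bsub>basis_alg S p U\<^esub> g) z =
      (\<Sum>(x, y)\<in>S \<times> S. if p x y = Some z then f x * g y else 0)"
    unfolding basis_alg_simps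
  proof (rule sum.mono_neutral_cong_left)
    show "{(x, y). f x \<noteq> 0 \<and> g y \<noteq> 0 \<and> p x y = Some z} \<subseteq> S \<times> S"
      using assms by (auto simp: basis_alg_carrier_iff)
    show "\<forall>i\<in>S \<times> S - {(x, y). f x \<noteq> 0 \<and> g y \<noteq> 0 \<and> p x y = Some z}.
        (case i of (x, y) \<Rightarrow> if p x y = Some z then f x * g y else 0) = 0"
      by (simp add: case_prod_beta) auto
  qed (use assms(1) in auto)
  then show ?thesis
    by (simp add: sum.cartesian_product)
qed

lemma sum_option_delta:
  assumes "finite S" and "\<And>s. q = Some s \<Longrightarrow> s \<in> S"
  shows "(\<Sum>s\<in>S. if q = Some s then F s else 0) = (case q of None \<Rightarrow> 0 | Some s \<Rightarrow> F s)"
  using assms by (cases q) (auto simp: sum.delta')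

text \<open>Sources and ranges are encoded by the units: \<open>left_unit\<close> and
  \<open>right_unit\<close> say that exactly one unit can be multiplied to x on each side.
  \<open>assoc\<close> in the option monad includes that both iterated products are undefined
  together. The cancellation laws are the form in which inverses are used, namely to solve x y = z
  for y or for x. A group is the case of a single unit.\<close>

locale finite_groupoid =
  fixes S :: "'b set" and p :: "'b \<Rightarrow> 'b \<Rightarrow> 'b option" and U :: "'b set" and \<iota> :: "'b \<Rightarrow> 'b"
  assumes finite_S: "finite S" and U_subset: "U \<subseteq> S"
    and closed: "x \<in> S \<Longrightarrow> y \<in> S \<Longrightarrow> p x y = Some z \<Longrightarrow> z \<in> S"
    and assoc: "x \<in> S \<Longrightarrow> y \<in> S \<Longrightarrow> w \<in> S \<Longrightarrow>
      Option.bind (p x y) (\<lambda>s. p s w) = Option.bind (p y w) (p x)"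
    and left_unit: "x \<in> S \<Longrightarrow> \<exists>r\<in>U. \<forall>u\<in>U. p u x = (if u = r then Some x else None)"
    and right_unit: "x \<in> S \<Longrightarrow> \<exists>r\<in>U. \<forall>u\<in>U. p x u = (if u = r then Some x else None)"
    and \<iota>_closed: "x \<in> S \<Longrightarrow> \<iota> x \<in> S"
    and \<iota>_\<iota>: "x \<in> S \<Longrightarrow> \<iota> (\<iota> x) = x"
    and left_cancel: "x \<in> S \<Longrightarrow> y \<in> S \<Longrightarrow> z \<in> S \<Longrightarrow> p x y = Some z \<longleftrightarrow> p (\<iota> x) z = Some y"
    and right_cancel: "x \<in> S \<Longrightarrow> y \<in> S \<Longrightarrow> z \<in> S \<Longrightarrow> p x y = Some z \<longleftrightarrow> p z (\<iota> y) = Some x"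
begin

abbreviation B :: "(complex, 'b \<Rightarrow> complex) module" where
  "B \<equiv> basis_alg S p U"

lemmas carrier_iff = basis_alg_carrier_iff[OF finite_S]
lemmas mult_eq = basis_alg_mult[OF finite_S]

lemma mult_closed:
  assumes "f \<in> carrier B" and "g \<in> carrier B"
  shows "f \<otimes>\<^bsub>B\<^esub> g \<in> carrier B"
proof -
  have "p x y \<noteq> Some z" if "x \<in> S" "y \<in> S" "z \<notin> S" for x y z
    using that closed by blast
  then show ?thesis
    unfolding carrier_iff mult_eq[OF assms] by (simp cong: sum.cong)
qed

text \<open>Either side is the sum of f x * g y * h w over the triples whose iterated product is z;
  \<open>assoc\<close> identifies the two conditions, undefined products included.\<close>

lemma mult_assoc:
  assumes "f \<in> carrier B" and "g \<in> carrier B" and "h \<in> carrier B"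
  shows "f \<otimes>\<^bsub>B\<^esub> g \<otimes>\<^bsub>B\<^esub> h = f \<otimes>\<^bsub>B\<^esub> (g \<otimes>\<^bsub>B\<^esub> h)"
proof
  fix z
  have "(f \<otimes>\<^bsub>B\<^esub> g \<otimes>\<^bsub>B\<^esub> h) z = (\<Sum>s\<in>S. \<Sum>w\<in>S. \<Sum>x\<in>S. \<Sum>y\<in>S.
      if p x y = Some s then (if p s w = Some z then f x * g y * h w else 0) else 0)"
    unfolding mult_eq[OF mult_closed[OF assms(1,2)] assms(3)] mult_eq[OF assms(1,2)]
    by (intro sum.cong refl) (auto simp: sum_distrib_right intro!: sum.cong sum.neutral)
  also have "\<dots> = (\<Sum>x\<in>S. \<Sum>y\<in>S. \<Sum>w\<in>S. \<Sum>s\<in>S.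
      if p x y = Some s then (if p s w = Some z then f x * g y * h w else 0) else 0)"
    by (rule sum_swap4)
  also have "\<dots> = (\<Sum>x\<in>S. \<Sum>y\<in>S. \<Sum>w\<in>S.
      if Option.bind (p x y) (\<lambda>s. p s w) = Some z then f x * g y * h w else 0)"
    by (intro sum.cong refl, subst sum_option_delta[OF finite_S])
      (auto intro: closed split: option.split)
  also have "\<dots> = (\<Sum>x\<in>S. \<Sum>y\<in>S. \<Sum>w\<in>S.
      if Option.bind (p y w) (p x) = Some z then f x * g y * h w else 0)"
    by (intro sum.cong refl) (simp add: assoc)
  also have "\<dots> = (\<Sum>x\<in>S. \<Sum>y\<in>S. \<Sum>w\<in>S. \<Sum>s\<in>S.
      if p y w = Some s then (if p x s = Some z then f x * g y * h w else 0) else 0)"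
    by (intro sum.cong refl, subst sum_option_delta[OF finite_S])
      (auto intro: closed split: option.split)
  also have "\<dots> = (\<Sum>x\<in>S. \<Sum>s\<in>S. \<Sum>y\<in>S. \<Sum>w\<in>S.
      if p y w = Some s then (if p x s = Some z then f x * g y * h w else 0) else 0)"
  proof (rule sum.cong[OF refl])
    fix x
    let ?F = "\<lambda>y w s. if p y w = Some s then (if p x s = Some z then f x * g y * h w else 0) else 0"
    have "(\<Sum>y\<in>S. \<Sum>w\<in>S. \<Sum>s\<in>S. ?F y w s) = (\<Sum>y\<in>S. \<Sum>s\<in>S. \<Sum>w\<in>S. ?F y w s)"
      by (intro sum.cong refl sum.swap)
    also have "\<dots> = (\<Sum>s\<in>S. \<Sum>y\<in>S. \<Sum>w\<in>S. ?F y w s)"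
      by (rule sum.swap)
    finally show "(\<Sum>y\<in>S. \<Sum>w\<in>S. \<Sum>s\<in>S. ?F y w s) = (\<Sum>s\<in>S. \<Sum>y\<in>S. \<Sum>w\<in>S. ?F y w s)" .
  qed
  also have "\<dots> = (f \<otimes>\<^bsub>B\<^esub> (g \<otimes>\<^bsub>B\<^esub> h)) z"
    unfolding mult_eq[OF assms(1) mult_closed[OF assms(2,3)]] mult_eq[OF assms(2,3)]
    by (intro sum.cong refl) (auto simp: sum_distrib_left mult.assoc intro!: sum.cong sum.neutral)
  finally show "(f \<otimes>\<^bsub>B\<^esub> g \<otimes>\<^bsub>B\<^esub> h) z = (f \<otimes>\<^bsub>B\<^esub> (g \<otimes>\<^bsub>B\<^esub> h)) z" .
qed

definition single :: "'b \<Rightarrow> 'b \<Rightarrow> complex" where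
  "single a = (\<lambda>x. if x = a then 1 else 0)"

lemma single_closed: "a \<in> S \<Longrightarrow> single a \<in> carrier B"
  by (auto simp: carrier_iff single_def)

text \<open>\<open>left_cancel\<close> leaves at most one term, at the y that solves a y =
  z.\<close>

lemma single_mult:
  assumes "a \<in> S" and f: "f \<in> carrier B" and z: "z \<in> S"
  shows "(single a \<otimes>\<^bsub>B\<^esub> f) z = (case p (\<iota> a) z of None \<Rightarrow> 0 | Some y \<Rightarrow> f y)"
proof -
  have "(single a \<otimes>\<^bsub>B\<^esub> f) z = (\<Sum>x\<in>S. if x = a then \<Sum>y\<in>S. if p a y = Some z then f y else 0 else 0)"
    unfolding mult_eq[OF single_closed[OF assms(1)] f]
    by (intro sum.cong refl) (auto simp: single_def intro!: sum.cong sum.neutral)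
  also have "\<dots> = (\<Sum>y\<in>S. if p (\<iota> a) z = Some y then f y else 0)"
    using assms left_cancel finite_S by (simp add: sum.delta cong: sum.cong if_cong)
  also have "\<dots> = (case p (\<iota> a) z of None \<Rightarrow> 0 | Some y \<Rightarrow> f y)"
    using assms by (intro sum_option_delta finite_S) (auto intro: closed \<iota>_closed)
  finally show ?thesis .
qed

lemma mult_single:
  assumes "b \<in> S" and f: "f \<in> carrier B" and z: "z \<in> S"
  shows "(f \<otimes>\<^bsub>B\<^esub> single b) z = (case p z (\<iota> b) of None \<Rightarrow> 0 | Some x \<Rightarrow> f x)"
proof -
  have "(f \<otimes>\<^bsub>B\<^esub> single b) z = (\<Sum>x\<in>S. \<Sum>y\<in>S. if y = b then (if p x b = Some z then f x else 0) else 0)"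
    unfolding mult_eq[OF f single_closed[OF assms(1)]]
    by (intro sum.cong refl) (auto simp: single_def)
  also have "\<dots> = (\<Sum>x\<in>S. if p z (\<iota> b) = Some x then f x else 0)"
    using assms right_cancel finite_S by (simp add: sum.delta cong: sum.cong if_cong)
  also have "\<dots> = (case p z (\<iota> b) of None \<Rightarrow> 0 | Some x \<Rightarrow> f x)"
    using assms by (intro sum_option_delta finite_S) (auto intro: closed \<iota>_closed)
  finally show ?thesis .
qed

lemma one_closed: "\<one>\<^bsub>B\<^esub> \<in> carrier B"
  using U_subset unfolding carrier_iff by (auto simp: basis_alg_simps)

text \<open>For each y exactly one unit has a defined product with y on the left, so the sum over U
  contributes \<open>f y\<close> once.\<close>

lemma one_mult:
  assumes "f \<in> carrier B"
  shows "\<one>\<^bsub>B\<^esub> \<otimes>\<^bsub>B\<^esub> f = f"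
proof
  fix z
  have "(\<one>\<^bsub>B\<^esub> \<otimes>\<^bsub>B\<^esub> f) z = (\<Sum>x\<in>U. \<Sum>y\<in>S. if p x y = Some z then f y else 0)"
    unfolding mult_eq[OF one_closed assms]
    by (rule sum.mono_neutral_cong_right)
      (use finite_S U_subset in \<open>auto simp: basis_alg_simps(3) intro!: sum.cong cong: if_cong\<close>)
  also have "\<dots> = (\<Sum>y\<in>S. \<Sum>x\<in>U. if p x y = Some z then f y else 0)"
    by (rule sum.swap)
  also have "\<dots> = (\<Sum>y\<in>S. if y = z then f y else 0)"
  proof (rule sum.cong[OF refl])
    fix y assume "y \<in> S"
    then obtain r where r: "r \<in> U" "\<And>u. u \<in> U \<Longrightarrow> p u y = (if u = r then Some y else None)"
      using left_unit by blast
    have "(\<Sum>x\<in>U. if p x y = Some z then f y else 0) = (\<Sum>x\<in>U. if x = r then (if y = z then f y else 0) else 0)"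
      by (intro sum.cong refl) (auto simp: r(2))
    then show "(\<Sum>x\<in>U. if p x y = Some z then f y else 0) = (if y = z then f y else 0)"
      using r(1) finite_subset[OF U_subset finite_S] by (simp add: sum.delta)
  qed
  also have "\<dots> = f z"
    using finite_S assms by (simp add: sum.delta carrier_iff)
  finally show "(\<one>\<^bsub>B\<^esub> \<otimes>\<^bsub>B\<^esub> f) z = f z" .
qed

lemma mult_one:
  assumes "f \<in> carrier B"
  shows "f \<otimes>\<^bsub>B\<^esub> \<one>\<^bsub>B\<^esub> = f"
proof
  fix z
  have "(f \<otimes>\<^bsub>B\<^esub> \<one>\<^bsub>B\<^esub>) z = (\<Sum>x\<in>S. \<Sum>y\<in>U. if p x y = Some z then f x else 0)"
    unfolding mult_eq[OF assms one_closed]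
    by (intro sum.cong refl sum.mono_neutral_cong_right)
      (use finite_S U_subset in \<open>auto simp: basis_alg_simps\<close>)
  also have "\<dots> = (\<Sum>x\<in>S. if x = z then f x else 0)"
  proof (rule sum.cong[OF refl])
    fix x assume "x \<in> S"
    then obtain r where r: "r \<in> U" "\<And>u. u \<in> U \<Longrightarrow> p x u = (if u = r then Some x else None)"
      using right_unit by blast
    have "(\<Sum>y\<in>U. if p x y = Some z then f x else 0) = (\<Sum>y\<in>U. if y = r then (if x = z then f x else 0) else 0)"
      by (intro sum.cong refl) (auto simp: r(2))
    then show "(\<Sum>y\<in>U. if p x y = Some z then f x else 0) = (if x = z then f x else 0)"
      using r(1) finite_subset[OF U_subset finite_S] by (simp add: sum.delta)
  qed
  also have "\<dots> = f z"
    using finite_S assms by (simp add: sum.delta carrier_iff)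
  finally show "(f \<otimes>\<^bsub>B\<^esub> \<one>\<^bsub>B\<^esub>) z = f z" .
qed

lemma add_closed: "f \<in> carrier B \<Longrightarrow> g \<in> carrier B \<Longrightarrow> f \<oplus>\<^bsub>B\<^esub> g \<in> carrier B"
  unfolding carrier_iff by (simp add: basis_alg_simps)

lemma scale_closed: "f \<in> carrier B \<Longrightarrow> a \<odot>\<^bsub>B\<^esub> f \<in> carrier B"
  unfolding carrier_iff by (simp add: basis_alg_simps)

lemma ring_B: "ring B"
proof (rule ringI)
  show "abelian_group B"
  proof (rule abelian_groupI)
    fix f assume f: "f \<in> carrier B"
    show "\<exists>g\<in>carrier B. g \<oplus>\<^bsub>B\<^esub> f = \<zero>\<^bsub>B\<^esub>"
      using f scale_closed[OF f, of "- 1"] by (intro bexI[of _ "(- 1) \<odot>\<^bsub>B\<^esub> f"]) (auto simp: basis_alg_simps(4-6))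
  qed (use add_closed in \<open>auto simp: carrier_iff basis_alg_simps(4-5) add.assoc add.commute\<close>)
  show "monoid B"
    by (rule monoidI) (use mult_closed mult_assoc one_closed one_mult mult_one in auto)
next
  fix f g h assume c: "f \<in> carrier B" "g \<in> carrier B" "h \<in> carrier B"
  show "(f \<oplus>\<^bsub>B\<^esub> g) \<otimes>\<^bsub>B\<^esub> h = f \<otimes>\<^bsub>B\<^esub> h \<oplus>\<^bsub>B\<^esub> g \<otimes>\<^bsub>B\<^esub> h"
  proof
    fix z
    have "((f \<oplus>\<^bsub>B\<^esub> g) \<otimes>\<^bsub>B\<^esub> h) z = (f \<otimes>\<^bsub>B\<^esub> h) z + (g \<otimes>\<^bsub>B\<^esub> h) z"
      using c add_closed[OF c(1,2)]
      by (simp add: mult_eq basis_alg_simps(5) distrib_right sum.distrib[symmetric] cong: sum.cong)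
        (auto simp: algebra_simps intro!: sum.cong)
    then show "((f \<oplus>\<^bsub>B\<^esub> g) \<otimes>\<^bsub>B\<^esub> h) z = (f \<otimes>\<^bsub>B\<^esub> h \<oplus>\<^bsub>B\<^esub> g \<otimes>\<^bsub>B\<^esub> h) z"
      by (simp add: basis_alg_simps(5))
  qed
  show "h \<otimes>\<^bsub>B\<^esub> (f \<oplus>\<^bsub>B\<^esub> g) = h \<otimes>\<^bsub>B\<^esub> f \<oplus>\<^bsub>B\<^esub> h \<otimes>\<^bsub>B\<^esub> g"
  proof
    fix z
    have "(h \<otimes>\<^bsub>B\<^esub> (f \<oplus>\<^bsub>B\<^esub> g)) z = (h \<otimes>\<^bsub>B\<^esub> f) z + (h \<otimes>\<^bsub>B\<^esub> g) z"
      using c add_closed[OF c(1,2)]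
      by (simp add: mult_eq basis_alg_simps(5) distrib_left sum.distrib[symmetric] cong: sum.cong)
        (auto simp: algebra_simps intro!: sum.cong)
    then show "(h \<otimes>\<^bsub>B\<^esub> (f \<oplus>\<^bsub>B\<^esub> g)) z = (h \<otimes>\<^bsub>B\<^esub> f \<oplus>\<^bsub>B\<^esub> h \<otimes>\<^bsub>B\<^esub> g) z"
      by (simp add: basis_alg_simps(5))
  qed
qed

sublocale B: complex_algebra B
proof (intro complex_algebra.intro complex_algebra_axioms.intro ring_B scale_closed)
  fix f g a assume c: "f \<in> carrier B" "g \<in> carrier B"
  show "(a \<odot>\<^bsub>B\<^esub> f) \<otimes>\<^bsub>B\<^esub> g = a \<odot>\<^bsub>B\<^esub> (f \<otimes>\<^bsub>B\<^esub> g)"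
  proof
    fix z
    show "((a \<odot>\<^bsub>B\<^esub> f) \<otimes>\<^bsub>B\<^esub> g) z = (a \<odot>\<^bsub>B\<^esub> (f \<otimes>\<^bsub>B\<^esub> g)) z"
      unfolding basis_alg_simps(6)[of _ _ _ _ "f \<otimes>\<^bsub>B\<^esub> g"] mult_eq[OF scale_closed[OF c(1)] c(2)] mult_eq[OF c]
      by (auto simp: basis_alg_simps(6) sum_distrib_left mult.assoc intro!: sum.cong)
  qed
  show "f \<otimes>\<^bsub>B\<^esub> (a \<odot>\<^bsub>B\<^esub> g) = a \<odot>\<^bsub>B\<^esub> (f \<otimes>\<^bsub>B\<^esub> g)"
  proof
    fix z
    show "(f \<otimes>\<^bsub>B\<^esub> (a \<odot>\<^bsub>B\<^esub> g)) z = (a \<odot>\<^bsub>B\<^esub> (f \<otimes>\<^bsub>B\<^esub> g)) z"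
      unfolding basis_alg_simps(6)[of _ _ _ _ "f \<otimes>\<^bsub>B\<^esub> g"] mult_eq[OF c(1) scale_closed[OF c(2)]] mult_eq[OF c]
      by (auto simp: basis_alg_simps(6) sum_distrib_left mult.left_commute intro!: sum.cong)
  qed
qed (auto simp: basis_alg_simps(5,6) algebra_simps)

lemma finsum_apply:
  assumes "finite T" and "\<And>t. t \<in> T \<Longrightarrow> f t \<in> carrier B"
  shows "(\<Oplus>\<^bsub>B\<^esub>t\<in>T. f t) x = (\<Sum>t\<in>T. f t x)"
  using assms
proof (induction T)
  case empty
  show ?case
    by (simp add: basis_alg_simps(4))
next
  case (insert t T)
  then show ?case
    by (subst B.finsum_insert) (auto simp: basis_alg_simps(5))
qed

text \<open>A linear relation between \<open>card S + 1\<close> elements is a system with one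
  equation for each arrow, hence with one more unknown than equations.\<close>

lemma dim_le_card: "B.dim_le (card S)"
  unfolding B.dim_le_def
proof (intro allI impI)
  fix f assume f: "f \<in> {..card S} \<rightarrow> carrier B"
  obtain c where c: "\<exists>i\<in>{..card S}. c i \<noteq> 0" "\<And>x. x \<in> S \<Longrightarrow> (\<Sum>i\<in>{..card S}. c i * f i x) = 0"
    using ex_nontrivial_solution[OF finite_S, of "{..card S}" f] by auto
  have "(\<Oplus>\<^bsub>B\<^esub>i\<in>{..card S}. c i \<odot>\<^bsub>B\<^esub> f i) x = 0" for x
  proof -
    have "c i \<odot>\<^bsub>B\<^esub> f i \<in> carrier B" if "i \<le> card S" for i
      using that f by (intro scale_closed) auto
    then have "(\<Oplus>\<^bsub>B\<^esub>i\<in>{..card S}. c i \<odot>\<^bsub>B\<^esub> f i) x = (\<Sum>i\<in>{..card S}. (c i \<odot>\<^bsub>B\<^esub> f i) x)"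
      by (intro finsum_apply) auto
    also have "\<dots> = (\<Sum>i\<in>{..card S}. c i * f i x)"
      by (simp add: basis_alg_simps(6))
    finally have "(\<Oplus>\<^bsub>B\<^esub>i\<in>{..card S}. c i \<odot>\<^bsub>B\<^esub> f i) x = (\<Sum>i\<in>{..card S}. c i * f i x)" .
    then show ?thesis
      using c(2)[of x] f by (cases "x \<in> S") (auto simp: carrier_iff Pi_iff)
  qed
  then have "(\<Oplus>\<^bsub>B\<^esub>i\<in>{..card S}. c i \<odot>\<^bsub>B\<^esub> f i) = \<zero>\<^bsub>B\<^esub>"
    by (auto simp: basis_alg_simps(4))
  then show "\<exists>c. (\<exists>i\<le>card S. c i \<noteq> 0) \<and> (\<Oplus>\<^bsub>B\<^esub>i\<in>{..card S}. c i \<odot>\<^bsub>B\<^esub> f i) = \<zero>\<^bsub>B\<^esub>"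
    using c(1) by auto
qed

section \<open>Inner product, adjoints and semisimplicity\<close>

definition inner :: "('b \<Rightarrow> complex) \<Rightarrow> ('b \<Rightarrow> complex) \<Rightarrow> complex" where
  "inner f g = (\<Sum>x\<in>S. f x * cnj (g x))"

definition star :: "('b \<Rightarrow> complex) \<Rightarrow> 'b \<Rightarrow> complex" where
  "star f = (\<lambda>x. if x \<in> S then cnj (f (\<iota> x)) else 0)"

lemma star_closed: "star f \<in> carrier B"
  by (simp add: star_def carrier_iff)

lemma inner_add_right: "inner h (\<lambda>x. f x + g x) = inner h f + inner h g"
  and inner_diff_left: "inner (\<lambda>x. f x - g x) h = inner f h - inner g h"
  and inner_scale_left: "inner (\<lambda>x. a * f x) h = a * inner f h"
  and inner_commute: "inner g f = cnj (inner f g)"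
  and inner_sum_left: "inner (\<lambda>x. \<Sum>t\<in>T. F t x) h = (\<Sum>t\<in>T. inner (F t) h)"
  by (simp_all add: inner_def sum.distrib sum_subtractf sum_distrib_left algebra_simps)
    (simp add: sum_distrib_left sum.swap[of _ T])

lemma inner_self_eq_zero:
  assumes "f \<in> carrier B"
  shows "inner f f = 0 \<longleftrightarrow> f = (\<lambda>_. 0)"
proof
  assume "inner f f = 0"
  moreover have "inner f f = of_real (\<Sum>x\<in>S. (cmod (f x))\<^sup>2)"
    by (simp add: inner_def complex_norm_square del: of_real_power)
  ultimately have "(\<Sum>x\<in>S. (cmod (f x))\<^sup>2) = 0"
    by (metis of_real_eq_0_iff)
  then have "\<forall>x\<in>S. f x = 0"
    using finite_S by (simp add: sum_nonneg_eq_0_iff)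
  then show "f = (\<lambda>_. 0)"
    using assms by (auto simp: carrier_iff)
qed (simp add: inner_def)

text \<open>On the right-hand side x is replaced by its inverse \<open>\<iota> x\<close>. Then
  \<open>left_cancel\<close> translates the condition (\<iota> x) z = y into x y = z, and both sides
  become the sum of a x * f y * cnj (g z) over all x, y, z with x y = z.\<close>

lemma inner_mult_left:
  assumes a: "a \<in> carrier B" and f: "f \<in> carrier B" and g: "g \<in> carrier B"
  shows "inner (a \<otimes>\<^bsub>B\<^esub> f) g = inner f (star a \<otimes>\<^bsub>B\<^esub> g)"
proof -
  have "inner f (star a \<otimes>\<^bsub>B\<^esub> g) =
      (\<Sum>y\<in>S. \<Sum>x\<in>S. \<Sum>z\<in>S. if p x z = Some y then a (\<iota> x) * f y * cnj (g z) else 0)"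
    unfolding inner_def mult_eq[OF star_closed g]
    by (intro sum.cong refl) (auto simp: star_def sum_distrib_left intro!: sum.cong)
  also have "\<dots> = (\<Sum>y\<in>S. \<Sum>x\<in>S. \<Sum>z\<in>S. if p x y = Some z then a x * f y * cnj (g z) else 0)"
  proof (rule sum.cong[OF refl])
    fix y assume y: "y \<in> S"
    show "(\<Sum>x\<in>S. \<Sum>z\<in>S. if p x z = Some y then a (\<iota> x) * f y * cnj (g z) else 0) =
        (\<Sum>x\<in>S. \<Sum>z\<in>S. if p x y = Some z then a x * f y * cnj (g z) else 0)"
      by (rule sum.reindex_bij_witness[of _ \<iota> \<iota>])
        (use y in \<open>auto simp: \<iota>_closed \<iota>_\<iota> left_cancel[of "\<iota> _"] intro!: sum.cong\<close>)
  qed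
  also have "\<dots> = (\<Sum>z\<in>S. \<Sum>x\<in>S. \<Sum>y\<in>S. if p x y = Some z then a x * f y * cnj (g z) else 0)"
  proof -
    let ?F = "\<lambda>x y z. if p x y = Some z then a x * f y * cnj (g z) else 0"
    have "(\<Sum>y\<in>S. \<Sum>x\<in>S. \<Sum>z\<in>S. ?F x y z) = (\<Sum>y\<in>S. \<Sum>z\<in>S. \<Sum>x\<in>S. ?F x y z)"
      by (intro sum.cong refl sum.swap)
    also have "\<dots> = (\<Sum>z\<in>S. \<Sum>y\<in>S. \<Sum>x\<in>S. ?F x y z)"
      by (rule sum.swap)
    also have "\<dots> = (\<Sum>z\<in>S. \<Sum>x\<in>S. \<Sum>y\<in>S. ?F x y z)"
      by (intro sum.cong refl sum.swap)
    finally show ?thesis .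
  qed
  also have "\<dots> = inner (a \<otimes>\<^bsub>B\<^esub> f) g"
    unfolding inner_def mult_eq[OF a f]
    by (intro sum.cong refl) (auto simp: sum_distrib_right intro!: sum.cong)
  finally show ?thesis ..
qed

text \<open>The vectors are not normalised; the projection divides by \<open>inner e e\<close>
  instead, which is nonzero because the zero vector is excluded.\<close>

definition orthogonal_family :: "('b \<Rightarrow> complex) set \<Rightarrow> bool" where
  "orthogonal_family E \<longleftrightarrow> finite E \<and> (\<lambda>_. 0) \<notin> E \<and> E \<subseteq> carrier B \<and>
     (\<forall>e\<in>E. \<forall>e'\<in>E. e \<noteq> e' \<longrightarrow> inner e e' = 0)"

lemma inner_orthogonal_combination:
  assumes "orthogonal_family E" and "e \<in> E"
  shows "inner (\<lambda>x. \<Sum>t\<in>E. c t * t x) e = c e * inner e e"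
proof -
  have "inner (\<lambda>x. \<Sum>t\<in>E. c t * t x) e = (\<Sum>t\<in>E. if t = e then c t * inner t e else 0)"
    unfolding inner_sum_left inner_scale_left
    by (intro sum.cong refl) (use assms in \<open>auto simp: orthogonal_family_def\<close>)
  then show ?thesis
    using assms by (simp add: orthogonal_family_def sum.delta)
qed

lemma orthogonal_family_self:
  assumes "orthogonal_family E" and "e \<in> E"
  shows "inner e e \<noteq> 0"
  using assms inner_self_eq_zero[of e] by (auto simp: orthogonal_family_def)

text \<open>In a linear relation the inner product with e isolates the coefficient of e, so nonzero
  orthogonal vectors are independent.\<close>

lemma card_orthogonal_family_le:
  assumes "orthogonal_family E"
  shows "card E \<le> card S"
proof (rule ccontr)
  assume "\<not> card E \<le> card S"
  then obtain c e where c: "e \<in> E" "c e \<noteq> 0" "\<And>x. x \<in> S \<Longrightarrow> (\<Sum>t\<in>E. c t * t x) = 0"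
    using ex_nontrivial_solution[OF finite_S, of E "\<lambda>t. t"] assms
    by (auto simp: orthogonal_family_def)
  then have "inner (\<lambda>x. \<Sum>t\<in>E. c t * t x) e = 0"
    by (simp add: inner_def)
  then show False
    using inner_orthogonal_combination[OF assms c(1), of c] orthogonal_family_self[OF assms c(1)] c(2) by simp
qed

text \<open>Take an orthogonal family E in I of maximal size and let P be the projection onto its
  span. For h in I the remainder h - P h lies in I and is orthogonal to E, so it would extend E
  unless it is zero. Hence E spans I, and g - P g, being orthogonal to E, is orthogonal to all of
  I.\<close>

lemma ex_orthogonal_projection:
  assumes I: "I \<subseteq> carrier B" "(\<lambda>_. 0) \<in> I" "\<And>f g. f \<in> I \<Longrightarrow> g \<in> I \<Longrightarrow> (\<lambda>x. f x + g x) \<in> I"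
      "\<And>a f. f \<in> I \<Longrightarrow> (\<lambda>x. a * f x) \<in> I"
    and g: "g \<in> carrier B"
  obtains f where "f \<in> I" and "\<And>h. h \<in> I \<Longrightarrow> inner h (\<lambda>x. g x - f x) = 0"
proof -
  have "orthogonal_family {} \<and> {} \<subseteq> I"
    by (simp add: orthogonal_family_def)
  moreover have "\<forall>E. orthogonal_family E \<and> E \<subseteq> I \<longrightarrow> card E < Suc (card S)"
    using card_orthogonal_family_le by (simp add: less_Suc_eq_le)
  ultimately obtain E where E: "orthogonal_family E" "E \<subseteq> I"
    and max: "\<And>E'. orthogonal_family E' \<Longrightarrow> E' \<subseteq> I \<Longrightarrow> card E' \<le> card E"
    using ex_has_greatest_nat[of "\<lambda>E. orthogonal_family E \<and> E \<subseteq> I" "{}" card "Suc (card S)"] by auto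
  have fin: "finite E"
    using E(1) by (simp add: orthogonal_family_def)
  define P where "P f = (\<lambda>x. \<Sum>e\<in>E. inner f e / inner e e * e x)" for f
  have comb: "(\<lambda>x. \<Sum>e\<in>F. c e * e x) \<in> I" if "finite F" "F \<subseteq> I" for F c
    using that by (induction F) (use I in auto)
  have P: "P f \<in> I" for f
    unfolding P_def using comb[OF fin E(2), of "\<lambda>e. inner f e / inner e e"] by simp
  have inner_P: "inner (\<lambda>x. f x - P f x) e = 0" if "e \<in> E" for f e
    using inner_orthogonal_combination[OF E(1) that, of "\<lambda>e. inner f e / inner e e"]
      orthogonal_family_self[OF E(1) that]
    by (simp add: inner_diff_left P_def)
  have fixed: "P h = h" if h: "h \<in> I" for h
  proof (rule ccontr)
    let ?r = "\<lambda>x. h x - P h x"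
    assume "P h \<noteq> h"
    have r0: "?r \<noteq> (\<lambda>_. 0)"
    proof
      assume "?r = (\<lambda>_. 0)"
      then have "P h x = h x" for x
        by (auto dest: fun_cong[of _ _ x])
      then show False
        using \<open>P h \<noteq> h\<close> by auto
    qed
    have rI: "?r \<in> I"
      using I(3)[OF h I(4)[OF P, of "- 1"]] by simp
    then have "inner ?r ?r \<noteq> 0"
      using inner_self_eq_zero[of ?r] I(1) r0 by auto
    then have "?r \<notin> E"
      using inner_P by blast
    have "inner e ?r = 0" if "e \<in> E" for e
      using inner_P[OF that, of h] inner_commute[of e ?r] by simp
    then have "orthogonal_family (insert ?r E)"
      using E(1) rI r0 I(1) inner_P by (auto simp: orthogonal_family_def)
    then have "card (insert ?r E) \<le> card E"
      using max rI E(2) by blast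
    then show False
      using \<open>?r \<notin> E\<close> fin by simp
  qed
  have "inner h (\<lambda>x. g x - P g x) = 0" if "h \<in> I" for h
  proof -
    have "inner (P h) (\<lambda>x. g x - P g x) = (\<Sum>e\<in>E. inner h e / inner e e * inner e (\<lambda>x. g x - P g x))"
      by (simp add: P_def inner_sum_left inner_scale_left del: times_divide_eq_left)
    also have "\<dots> = 0"
      using inner_P[of _ g] by (intro sum.neutral ballI) (subst inner_commute, simp)
    finally show ?thesis
      using fixed[OF that] by simp
  qed
  then show thesis
    using that P by blast
qed

text \<open>
  For \<open>f\<^sup>* x = cnj (f (\<iota> x))\<close>, left multiplication by \<open>f\<^sup>*\<close> is adjoint to left multiplication by
  \<open>f\<close>, so that the orthogonal complement of a left ideal is a left ideal.
\<close>

theorem semisimple: "semisimple_ring B"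
  unfolding semisimple_ring_def
proof (intro conjI allI impI ring_B)
  fix I assume I: "left_ideal I B"
  interpret I: additive_subgroup I B
    using I by (simp add: left_ideal_def)
  \<comment> \<open>A left ideal is only assumed closed under addition and ring multiplication;
    closure under scalars follows by writing a f as (a 1) f.\<close>
  have scale: "(\<lambda>x. a * f x) \<in> I" if "f \<in> I" for a f
  proof -
    have f: "f \<in> carrier B"
      using that I.a_subset by auto
    have "(a \<odot>\<^bsub>B\<^esub> \<one>\<^bsub>B\<^esub>) \<otimes>\<^bsub>B\<^esub> f \<in> I"
      using I that one_closed scale_closed by (auto simp: left_ideal_def)
    moreover have "(a \<odot>\<^bsub>B\<^esub> \<one>\<^bsub>B\<^esub>) \<otimes>\<^bsub>B\<^esub> f = a \<odot>\<^bsub>B\<^esub> f"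
      using f B.smult_mult_left one_mult one_closed by simp
    ultimately show ?thesis
      by (simp add: basis_alg_simps(6))
  qed
  have zero: "(\<lambda>_. 0) \<in> I"
    using I.zero_closed by (simp add: basis_alg_simps(4))
  have add: "(\<lambda>x. f x + g x) \<in> I" if "f \<in> I" "g \<in> I" for f g
    using I.a_closed[OF that] by (simp add: basis_alg_simps(5))
  define J where "J = {g \<in> carrier B. \<forall>f\<in>I. inner f g = 0}"
  have "left_ideal J B"
  proof (rule B.left_idealI)
    fix r g assume r: "r \<in> carrier B" and g: "g \<in> J"
    have "inner f (r \<otimes>\<^bsub>B\<^esub> g) = 0" if f: "f \<in> I" for f
    proof -
      \<comment> \<open>The adjoint formula is applied to \<open>star r\<close>, whose own adjoint
        is r: the inner product of f with r g equals that of (star r) f with g, and (star r) f lies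
        in I.\<close>
      have "star r \<otimes>\<^bsub>B\<^esub> f \<in> I"
        using I f star_closed by (auto simp: left_ideal_def)
      then have "inner (star r \<otimes>\<^bsub>B\<^esub> f) g = 0"
        using g by (simp add: J_def)
      moreover have "star (star r) = r"
        using r by (auto simp: star_def fun_eq_iff \<iota>_closed \<iota>_\<iota> carrier_iff)
      ultimately show ?thesis
        using inner_mult_left[of "star r" f g] star_closed f g I.a_subset by (auto simp: J_def)
    qed
    then show "r \<otimes>\<^bsub>B\<^esub> g \<in> J"
      using r g mult_closed by (simp add: J_def)
  next
    fix f g assume "f \<in> J" "g \<in> J"
    then show "f \<oplus>\<^bsub>B\<^esub> g \<in> J"
      using add_closed by (simp add: J_def basis_alg_simps(5) inner_add_right)
  qed (auto simp: J_def basis_alg_simps(4) inner_def carrier_iff)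
  moreover have "I \<inter> J = {\<zero>\<^bsub>B\<^esub>}"
  proof -
    have "f = (\<lambda>_. 0)" if "f \<in> I" "f \<in> J" for f
      using that inner_self_eq_zero[of f] by (auto simp: J_def)
    moreover have "(\<lambda>_. 0) \<in> J"
      by (simp add: J_def inner_def carrier_iff)
    ultimately show ?thesis
      using zero unfolding basis_alg_simps(4) by blast
  qed
  moreover have "I <+>\<^bsub>B\<^esub> J = carrier B"
  proof (intro equalityI subsetI)
    fix g assume "g \<in> I <+>\<^bsub>B\<^esub> J"
    then show "g \<in> carrier B"
      using I.a_subset add_closed by (auto simp: set_add_def' J_def)
  next
    fix g assume g: "g \<in> carrier B"
    obtain f where f: "f \<in> I" "\<And>h. h \<in> I \<Longrightarrow> inner h (\<lambda>x. g x - f x) = 0"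
      using ex_orthogonal_projection[OF I.a_subset zero add scale g] by blast
    have "(\<lambda>x. g x - f x) \<in> J"
      using f g I.a_subset by (auto simp: J_def carrier_iff)
    moreover have "g = f \<oplus>\<^bsub>B\<^esub> (\<lambda>x. g x - f x)"
      by (simp add: basis_alg_simps(5))
    ultimately show "g \<in> I <+>\<^bsub>B\<^esub> J"
      using f(1) unfolding set_add_def' by blast
  qed
  ultimately show "\<exists>J. left_ideal J B \<and> I \<inter> J = {\<zero>\<^bsub>B\<^esub>} \<and> I <+>\<^bsub>B\<^esub> J = carrier B"
    by blast
qed

end

text \<open>A group is a groupoid with one object; this makes semisimplicity and the dimension bound
  available for the group algebras of the stabilisers.\<close>

lemma (in group) finite_groupoid_group:
  assumes "finite (carrier G)"
  shows "finite_groupoid (carrier G) (\<lambda>x y. Some (x \<otimes> y)) {\<one>} (m_inv G)"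
proof
  show "(Some (x \<otimes> y) = Some z) = (Some (inv x \<otimes> z) = Some y)"
    if "x \<in> carrier G" "y \<in> carrier G" "z \<in> carrier G" for x y z
    using that by (metis inv_solve_left option.inject)
  show "(Some (x \<otimes> y) = Some z) = (Some (z \<otimes> inv y) = Some x)"
    if "x \<in> carrier G" "y \<in> carrier G" "z \<in> carrier G" for x y z
    using that by (metis inv_solve_right option.inject)
qed (use assms in \<open>auto simp: m_assoc\<close>)

lemma (in finite_groupoid) single_mult_single:
  assumes "a \<in> S" and "b \<in> S"
  shows "single a \<otimes>\<^bsub>B\<^esub> single b = (case p a b of None \<Rightarrow> (\<lambda>_. 0) | Some c \<Rightarrow> single c)"
proof
  fix z
  have "(single a \<otimes>\<^bsub>B\<^esub> single b) z = (\<Sum>x\<in>S. if x = a then \<Sum>y\<in>S. if y = b then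
      (if p a b = Some z then 1 else 0) else 0 else 0)"
    unfolding mult_eq[OF single_closed[OF assms(1)] single_closed[OF assms(2)]]
    by (intro sum.cong refl) (auto simp: single_def intro!: sum.cong sum.neutral)
  also have "\<dots> = (if p a b = Some z then 1 else 0)"
    using assms finite_S by (simp add: sum.delta)
  finally show "(single a \<otimes>\<^bsub>B\<^esub> single b) z = (case p a b of None \<Rightarrow> (\<lambda>_. 0) | Some c \<Rightarrow> single c) z"
    by (auto simp: single_def split: option.split)
qed

section \<open>The groupoid algebra\<close>

locale finite_group_subgroup = group G for G (structure) +
  fixes H
  assumes finite_G: "finite (carrier G)" and subgroup_H: "subgroup H G"
begin

section \<open>Unions of cosets and the groupoid laws\<close>

lemma mem_l_coset_iff:
  assumes "g \<in> carrier G" and "A \<subseteq> carrier G" and "x \<in> carrier G"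
  shows "x \<in> g <# A \<longleftrightarrow> inv g \<otimes> x \<in> A"
proof
  assume "x \<in> g <# A"
  then obtain a where "a \<in> A" "x = g \<otimes> a"
    by (auto simp: l_coset_def)
  then show "inv g \<otimes> x \<in> A"
    using assms by (auto simp: m_assoc[symmetric])
next
  assume "inv g \<otimes> x \<in> A"
  moreover have "x = g \<otimes> (inv g \<otimes> x)"
    using assms by (simp add: m_assoc[symmetric])
  ultimately show "x \<in> g <# A"
    unfolding l_coset_def by blast
qed

text \<open>A set stable under right multiplication by H is the union of the cosets a H over its own
  elements a, so stability replaces the choice of representatives.\<close>

lemma coset_unions_iff:
  "A \<in> coset_unions G H \<longleftrightarrow> A \<subseteq> carrier G \<and> H \<subseteq> A \<and> (\<forall>a\<in>A. \<forall>h\<in>H. a \<otimes> h \<in> A)"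
proof
  interpret H: subgroup H G by (rule subgroup_H)
  assume "A \<in> coset_unions G H"
  then obtain S where S: "A \<subseteq> carrier G" "H \<subseteq> A" "S \<subseteq> carrier G" "A = (\<Union>x\<in>S. x <# H)"
    by (auto simp: coset_unions_def)
  have "a \<otimes> h \<in> A" if a: "a \<in> A" and h: "h \<in> H" for a h
  proof -
    obtain x k where x: "x \<in> S" "k \<in> H" "a = x \<otimes> k"
      using a S(4) by (auto simp: l_coset_def)
    then have "a \<otimes> h = x \<otimes> (k \<otimes> h)"
      using S(3) h by (auto simp: m_assoc)
    then show ?thesis
      using x h S(4) by (auto simp: l_coset_def)
  qed
  then show "A \<subseteq> carrier G \<and> H \<subseteq> A \<and> (\<forall>a\<in>A. \<forall>h\<in>H. a \<otimes> h \<in> A)"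
    using S by blast
next
  interpret H: subgroup H G by (rule subgroup_H)
  assume A: "A \<subseteq> carrier G \<and> H \<subseteq> A \<and> (\<forall>a\<in>A. \<forall>h\<in>H. a \<otimes> h \<in> A)"
  have "A = (\<Union>x\<in>A. x <# H)"
  proof (intro equalityI subsetI)
    fix x assume "x \<in> A"
    then have "x \<in> x <# H"
      using A unfolding l_coset_def by (auto intro!: bexI[of _ \<one>])
    then show "x \<in> (\<Union>x\<in>A. x <# H)"
      using \<open>x \<in> A\<close> by blast
  qed (use A in \<open>auto simp: l_coset_def\<close>)
  then show "A \<in> coset_unions G H"
    using A unfolding coset_unions_def by blast
qed

lemma coset_unionsD:
  assumes "A \<in> coset_unions G H"
  shows "A \<subseteq> carrier G" and "\<one> \<in> A"
  using assms subgroup.one_closed[OF subgroup_H] by (auto simp: coset_unions_iff)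

lemma finite_coset_unions: "finite (coset_unions G H)"
  by (rule finite_subset[of _ "Pow (carrier G)"]) (use finite_G in \<open>auto dest: coset_unionsD(1)\<close>)

text \<open>The condition \<open>inv g \<in> A\<close> is what puts H inside g A: since A is stable
  under H, it gives g^-1 h in A for every h in H.\<close>

lemma l_coset_coset_unions:
  assumes A: "A \<in> coset_unions G H" and g: "g \<in> carrier G" "inv g \<in> A"
  shows "g <# A \<in> coset_unions G H"
proof -
  interpret H: subgroup H G by (rule subgroup_H)
  have A': "A \<subseteq> carrier G" "\<And>a h. a \<in> A \<Longrightarrow> h \<in> H \<Longrightarrow> a \<otimes> h \<in> A"
    using A by (auto simp: coset_unions_iff)
  have sub: "g <# A \<subseteq> carrier G"
    using A' g by (auto simp: l_coset_def)
  show ?thesis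
    unfolding coset_unions_iff
  proof (intro conjI ballI sub)
    show "H \<subseteq> g <# A"
      using A' g by (auto simp: mem_l_coset_iff)
    fix a h assume a: "a \<in> g <# A" and h: "h \<in> H"
    then have "a \<in> carrier G"
      using sub by blast
    then have "inv g \<otimes> a \<otimes> h \<in> A"
      using a h A' g by (auto simp: mem_l_coset_iff)
    then show "a \<otimes> h \<in> g <# A"
      using \<open>a \<in> carrier G\<close> h A' g by (auto simp: mem_l_coset_iff m_assoc)
  qed
qed

lemma gpd_iff: "(A, g) \<in> gpd G H \<longleftrightarrow> A \<in> coset_unions G H \<and> g \<in> carrier G \<and> inv g \<in> A"
  by (simp add: gpd_def)

lemma gpd_mult_iff:
  "gpd_mult G (A, g) (B, h) = Some z \<longleftrightarrow> A = h <# B \<and> z = (B, g \<otimes> h)"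
  by (auto simp: gpd_mult_def)

lemma gpd_mult_eq:
  "gpd_mult G (A, g) (B, h) = (if A = h <# B then Some (B, g \<otimes> h) else None)"
  by (simp add: gpd_mult_def)

lemma l_coset_inverse:
  assumes "A \<subseteq> carrier G" and "g \<in> carrier G"
  shows "inv g <# (g <# A) = A" and "g <# (inv g <# A) = A"
  using assms by (simp_all add: lcos_m_assoc lcos_mult_one)

definition gpd_inv :: "'a set \<times> 'a \<Rightarrow> 'a set \<times> 'a" where
  "gpd_inv = (\<lambda>(A, g). (g <# A, inv g))"

lemma gpd_inv_simp: "gpd_inv (A, g) = (g <# A, inv g)"
  by (simp add: gpd_inv_def)

lemma gpd_inv_closed:
  assumes "(A, g) \<in> gpd G H"
  shows "(g <# A, inv g) \<in> gpd G H"
proof -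
  have A: "A \<in> coset_unions G H" "g \<in> carrier G" "inv g \<in> A"
    using assms by (auto simp: gpd_iff)
  have "g \<in> g <# A"
    using A coset_unionsD[OF A(1)] by (simp add: mem_l_coset_iff)
  then show ?thesis
    using A l_coset_coset_unions by (simp add: gpd_iff)
qed

lemma gpd_closed:
  assumes "(h <# B, g) \<in> gpd G H" and "(B, h) \<in> gpd G H"
  shows "(B, g \<otimes> h) \<in> gpd G H"
proof -
  have B: "B \<in> coset_unions G H" "h \<in> carrier G" "inv h \<in> B" "B \<subseteq> carrier G" and g: "g \<in> carrier G" "inv g \<in> h <# B"
    using assms coset_unionsD by (auto simp: gpd_iff)
  then have "inv h \<otimes> inv g \<in> B"
    by (simp add: mem_l_coset_iff)
  then show ?thesis
    using B g by (simp add: gpd_iff inv_mult_group)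
qed

lemma finite_gpd: "finite (gpd G H)"
  by (rule finite_subset[of _ "coset_unions G H \<times> carrier G"])
    (use finite_G finite_coset_unions in \<open>auto simp: gpd_iff\<close>)

lemma gpd_one: "A \<in> coset_unions G H \<Longrightarrow> (A, \<one>) \<in> gpd G H"
  using coset_unionsD by (simp add: gpd_iff)

sublocale gpd: finite_groupoid "gpd G H" "gpd_mult G" "coset_unions G H \<times> {\<one>}" gpd_inv
proof
  show "finite (gpd G H)"
    by (rule finite_gpd)
  show "coset_unions G H \<times> {\<one>} \<subseteq> gpd G H"
    using gpd_one by auto
next
  fix x y z assume "x \<in> gpd G H" "y \<in> gpd G H" "gpd_mult G x y = Some z"
  then show "z \<in> gpd G H"
    using gpd_closed by (cases x; cases y) (auto simp: gpd_mult_iff)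
next
  fix x y w assume xyw: "x \<in> gpd G H" "y \<in> gpd G H" "w \<in> gpd G H"
  obtain A g B h C k where eq: "x = (A, g)" "y = (B, h)" "w = (C, k)"
    by (cases x; cases y; cases w)
  then have "g \<in> carrier G" "h \<in> carrier G" "k \<in> carrier G" "C \<subseteq> carrier G"
    using xyw coset_unionsD by (auto simp: gpd_iff)
  then show "Option.bind (gpd_mult G x y) (\<lambda>s. gpd_mult G s w) = Option.bind (gpd_mult G y w) (gpd_mult G x)"
    by (auto simp: eq gpd_mult_eq m_assoc lcos_m_assoc)
next
  fix x assume x: "x \<in> gpd G H"
  obtain A g where eq: "x = (A, g)"
    by (cases x)
  have c: "A \<in> coset_unions G H" "g \<in> carrier G" "A \<subseteq> carrier G" "g <# A \<in> coset_unions G H"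
    using x coset_unionsD l_coset_coset_unions by (auto simp: eq gpd_iff)
  show "\<exists>r\<in>coset_unions G H \<times> {\<one>}. \<forall>u\<in>coset_unions G H \<times> {\<one>}.
      gpd_mult G u x = (if u = r then Some x else None)"
    using c by (intro bexI[of _ "(g <# A, \<one>)"]) (auto simp: eq gpd_mult_eq)
  show "\<exists>r\<in>coset_unions G H \<times> {\<one>}. \<forall>u\<in>coset_unions G H \<times> {\<one>}.
      gpd_mult G x u = (if u = r then Some x else None)"
    using c by (intro bexI[of _ "(A, \<one>)"]) (auto simp: eq gpd_mult_eq lcos_mult_one coset_unionsD(1))
  show "gpd_inv x \<in> gpd G H"
    using x gpd_inv_closed by (simp add: eq gpd_inv_simp)
  show "gpd_inv (gpd_inv x) = x"
    using c by (simp add: eq gpd_inv_simp l_coset_inverse)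
next
  fix x y z assume xyz: "x \<in> gpd G H" "y \<in> gpd G H" "z \<in> gpd G H"
  obtain A g B h C k where eq: "x = (A, g)" "y = (B, h)" "z = (C, k)"
    by (cases x; cases y; cases z)
  then have c: "g \<in> carrier G" "h \<in> carrier G" "k \<in> carrier G" "A \<subseteq> carrier G" "B \<subseteq> carrier G" "C \<subseteq> carrier G"
    using xyz coset_unionsD by (auto simp: eq gpd_iff)
  \<comment> \<open>Left multiplication by g is injective on subsets of the group, so g A = (g h) B
    is equivalent to A = h B, the condition under which (A, g) and (B, h) can be multiplied.\<close>
  have "g <# A = g <# (h <# B) \<longleftrightarrow> A = h <# B"
    using c l_coset_inverse(1)[of A g] l_coset_inverse(1)[of "h <# B" g] l_coset_subset_G by metis
  then have 1: "g <# A = (g \<otimes> h) <# B \<longleftrightarrow> A = h <# B"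
    using c by (simp add: lcos_m_assoc)
  have 2: "k = g \<otimes> h \<longleftrightarrow> h = inv g \<otimes> k" "k = g \<otimes> h \<longleftrightarrow> g = k \<otimes> inv h"
    using c by (simp_all add: inv_solve_left inv_solve_right)
  show "gpd_mult G x y = Some z \<longleftrightarrow> gpd_mult G (gpd_inv x) z = Some y"
    unfolding eq gpd_inv_simp gpd_mult_iff using 1 2(1) by auto
  show "gpd_mult G x y = Some z \<longleftrightarrow> gpd_mult G z (gpd_inv y) = Some x"
    unfolding eq gpd_inv_simp gpd_mult_iff using 2(2) c by (auto simp: l_coset_inverse)
qed

lemma gpd_alg_eq: "gpd_alg G H = gpd.B"
  by (simp add: gpd_alg_def)

section \<open>Connected components\<close>

lemma gpd_edges_iff:
  "(A, B) \<in> gpd_edges G H \<longleftrightarrow> (\<exists>g. (A, g) \<in> gpd G H \<and> B = g <# A)"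
  by (auto simp: gpd_edges_def gpd_source_def gpd_range_def image_def)

text \<open>Arrows can be composed and inverted, and each object has its identity, so the edges
  already form an equivalence relation on the objects. Hence two objects of one component are joined
  by a single arrow, which the later choice of u and v relies on.\<close>

lemma gpd_connected_eq: "gpd_connected G H = gpd_edges G H"
proof -
  have sub: "gpd_edges G H \<subseteq> coset_unions G H \<times> coset_unions G H"
    using l_coset_coset_unions by (auto simp: gpd_edges_iff gpd_iff)
  have "sym (gpd_edges G H)"
  proof (rule symI)
    fix A B assume "(A, B) \<in> gpd_edges G H"
    then obtain g where "(A, g) \<in> gpd G H" "B = g <# A"
      by (auto simp: gpd_edges_iff)
    then show "(B, A) \<in> gpd_edges G H"
      using gpd_inv_closed[of A g] coset_unionsD(1)
      by (auto simp: gpd_edges_iff gpd_iff l_coset_inverse intro!: exI[of _ "inv g"])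
  qed
  then have "gpd_edges G H \<union> (gpd_edges G H)\<inverse> = gpd_edges G H"
    by (simp add: sym_conv_converse_eq)
  moreover have "trans (gpd_edges G H)"
  proof (rule transI)
    fix A B C assume "(A, B) \<in> gpd_edges G H" "(B, C) \<in> gpd_edges G H"
    then obtain g h where gh: "(A, g) \<in> gpd G H" "B = g <# A" "(B, h) \<in> gpd G H" "C = h <# B"
      by (auto simp: gpd_edges_iff)
    then have "(A, h \<otimes> g) \<in> gpd G H"
      using gpd_closed by blast
    moreover have "C = (h \<otimes> g) <# A"
      using gh coset_unionsD(1) by (auto simp: gpd_iff lcos_m_assoc)
    ultimately show "(A, C) \<in> gpd_edges G H"
      by (auto simp: gpd_edges_iff)
  qed
  moreover have "(A, A) \<in> gpd_edges G H" if "A \<in> coset_unions G H" for A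
    using gpd_one[OF that] coset_unionsD(1)[OF that] lcos_mult_one by (auto simp: gpd_edges_iff)
  ultimately show ?thesis
    using sub unfolding gpd_connected_def by (auto simp: rtrancl_trancl_reflcl)
qed

lemma gpd_connected_iff:
  "(A, B) \<in> gpd_connected G H \<longleftrightarrow> (\<exists>g. (A, g) \<in> gpd G H \<and> B = g <# A)"
  by (simp add: gpd_connected_eq gpd_edges_iff)

lemma equiv_gpd_connected: "equiv (coset_unions G H) (gpd_connected G H)"
proof (rule equivI)
  let ?E = "gpd_edges G H \<union> (gpd_edges G H)\<inverse>"
  have "sym (?E\<^sup>*)"
    by (intro sym_rtrancl symI) auto
  then show "sym (gpd_connected G H)"
    unfolding gpd_connected_def by (auto simp: sym_def)
  show "trans (gpd_connected G H)"
    unfolding gpd_connected_def by (auto simp: trans_def intro: rtrancl_trans)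
qed (auto simp: gpd_connected_def refl_on_def)

text \<open>The identity arrows bring back every A in Y. Components and classes of objects thus
  correspond, and an enumeration of the former enumerates the latter.\<close>

lemma gpd_objects_component:
  assumes "Y \<in> coset_unions G H // gpd_connected G H"
  shows "gpd_objects {\<gamma> \<in> gpd G H. gpd_source \<gamma> \<in> Y} = Y"
proof (intro equalityI subsetI)
  fix A assume "A \<in> Y"
  then have "(A, \<one>) \<in> {\<gamma> \<in> gpd G H. gpd_source \<gamma> \<in> Y}"
    using in_quotient_imp_subset[OF equiv_gpd_connected assms] gpd_one by (auto simp: gpd_source_def)
  then show "A \<in> gpd_objects {\<gamma> \<in> gpd G H. gpd_source \<gamma> \<in> Y}"
    unfolding gpd_objects_def by (force simp: gpd_source_def)
qed (auto simp: gpd_objects_def)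

lemma gpd_objects_bij:
  "bij_betw gpd_objects (gpd_components G H) (coset_unions G H // gpd_connected G H)"
  by (rule bij_betw_byWitness[where f' = "\<lambda>Y. {\<gamma> \<in> gpd G H. gpd_source \<gamma> \<in> Y}"])
    (auto simp: gpd_components_def gpd_objects_component)

section \<open>Stabilisers, corners and the decomposition of the groupoid algebra\<close>

lemma stab_iff: "g \<in> stab G A \<longleftrightarrow> g \<in> carrier G \<and> g <# A = A"
  by (simp add: stab_def)

lemma subgroup_stab:
  assumes "A \<subseteq> carrier G"
  shows "subgroup (stab G A) G"
proof
  fix g assume "g \<in> stab G A"
  then show "inv g \<in> stab G A"
    using assms l_coset_inverse(1)[of A g] by (auto simp: stab_iff)
qed (use assms in \<open>auto simp: stab_iff lcos_m_assoc[symmetric] lcos_mult_one\<close>)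

lemma finite_stab: "finite (stab G A)"
  by (rule finite_subset[of _ "carrier G"]) (use finite_G in \<open>auto simp: stab_iff\<close>)

lemma stab_alg_eq:
  "stab_alg G A = basis_alg (stab G A) (\<lambda>x y. Some (x \<otimes> y)) {\<one>}"
  by (simp add: group_alg_def)

lemma finite_groupoid_stab:
  assumes "A \<subseteq> carrier G"
  shows "finite_groupoid (stab G A) (\<lambda>x y. Some (x \<otimes> y)) {\<one>} (m_inv (G\<lparr>carrier := stab G A\<rparr>))"
  using group.finite_groupoid_group[OF subgroup.subgroup_is_group[OF subgroup_stab[OF assms] is_group]]
    finite_stab by simp

text \<open>Since 1 lies in A, the element g^-1 lies in g^-1 A = A. So every g in the stabiliser
  gives a loop at A, and the vertex group at A is all of K_A.\<close>

lemma mem_gpd_stab: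
  assumes "A \<in> coset_unions G H" and "g \<in> stab G A"
  shows "(A, g) \<in> gpd G H"
proof -
  have "inv g \<in> stab G A"
    using assms subgroup.m_inv_closed[OF subgroup_stab] coset_unionsD(1) by blast
  then have "inv g \<otimes> \<one> \<in> A"
    using coset_unionsD[OF assms(1)] unfolding stab_iff l_coset_def by blast
  then show ?thesis
    using assms \<open>inv g \<in> stab G A\<close> by (simp add: gpd_iff stab_iff)
qed

lemma
  assumes A: "A \<in> coset_unions G H" and f: "f \<in> carrier gpd.B" and D: "(D, g) \<in> gpd G H"
  shows single_one_mult: "(gpd.single (A, \<one>) \<otimes>\<^bsub>gpd.B\<^esub> f) (D, g) = (if A = g <# D then f (D, g) else 0)"
    and mult_single_one: "(f \<otimes>\<^bsub>gpd.B\<^esub> gpd.single (A, \<one>)) (D, g) = (if D = A then f (D, g) else 0)"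
proof -
  have c: "g \<in> carrier G" "\<one> <# A = A"
    using D lcos_mult_one[OF coset_unionsD(1)[OF A]] by (auto simp: gpd_iff)
  show "(gpd.single (A, \<one>) \<otimes>\<^bsub>gpd.B\<^esub> f) (D, g) = (if A = g <# D then f (D, g) else 0)"
    unfolding gpd.single_mult[OF gpd_one[OF A] f D] gpd_inv_simp using c by (simp add: gpd_mult_eq)
  show "(f \<otimes>\<^bsub>gpd.B\<^esub> gpd.single (A, \<one>)) (D, g) = (if D = A then f (D, g) else 0)"
    unfolding gpd.mult_single[OF gpd_one[OF A] f D] gpd_inv_simp using c by (simp add: gpd_mult_eq)
qed

text \<open>Multiplication by the identity of A keeps the arrows with range A when done on the left,
  and those with source A when done on the right. The corner therefore consists of the combinations
  of loops (A, g) with g A = A, and these multiply like the group elements g.\<close>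

lemma corner_isomorphic_stab_alg:
  assumes A: "A \<in> coset_unions G H"
  shows "corner (gpd_alg G H) (gpd.single (A, \<one>)) \<simeq>\<^sub>a\<^sub>l\<^sub>g stab_alg G A"
proof -
  note Ac = coset_unionsD[OF A]
  note one = gpd_one[OF A]
  let ?C = "corner (gpd_alg G H) (gpd.single (A, \<one>))"
  define h where "h f = (\<lambda>g. if g \<in> stab G A then f (A, g) else 0)" for f :: "'a set \<times> 'a \<Rightarrow> complex"
  define k where "k f = (\<lambda>(D, g). if D = A then f g else 0)" for f :: "'a \<Rightarrow> complex"
  have supp: "f (D, g) = 0" if f: "f \<in> carrier ?C" and z: "\<not> (D = A \<and> g \<in> stab G A)" for f D g
  proof (cases "(D, g) \<in> gpd G H")
    case True
    then have D: "D \<in> coset_unions G H" "g \<in> carrier G"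
      by (auto simp: gpd_iff)
    have fB: "f \<in> carrier gpd.B" "gpd.single (A, \<one>) \<otimes>\<^bsub>gpd.B\<^esub> f = f" "f \<otimes>\<^bsub>gpd.B\<^esub> gpd.single (A, \<one>) = f"
      using f by (auto simp: gpd_alg_eq)
    show ?thesis
    proof (rule ccontr)
      assume nz: "f (D, g) \<noteq> 0"
      have "A = g <# D"
        using single_one_mult[OF A fB(1) True] nz unfolding fB(2) by (simp split: if_splits)
      moreover have "D = A"
        using mult_single_one[OF A fB(1) True] nz unfolding fB(3) by (simp split: if_splits)
      ultimately show False
        using z D(2) by (simp add: stab_iff)
    qed
  next
    case False
    then show ?thesis
      using f gpd.carrier_iff by (simp add: gpd_alg_eq)
  qed
  have carrier: "f \<in> carrier ?C \<longleftrightarrow> (\<forall>D g. \<not> (D = A \<and> g \<in> stab G A) \<longrightarrow> f (D, g) = 0)" for f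
  proof
    assume z: "\<forall>D g. \<not> (D = A \<and> g \<in> stab G A) \<longrightarrow> f (D, g) = 0"
    have fB: "f \<in> carrier gpd.B"
      unfolding gpd.carrier_iff using z mem_gpd_stab[OF A] by (metis surj_pair)
    have "(gpd.single (A, \<one>) \<otimes>\<^bsub>gpd.B\<^esub> f) (D, g) = f (D, g) \<and>
        (f \<otimes>\<^bsub>gpd.B\<^esub> gpd.single (A, \<one>)) (D, g) = f (D, g)" for D g
    proof (cases "(D, g) \<in> gpd G H")
      case True
      have "f (D, g) = 0" if "\<not> (D = A \<and> g \<in> stab G A)"
        using z that by blast
      then show ?thesis
        unfolding single_one_mult[OF A fB True] mult_single_one[OF A fB True]
        by (auto simp: stab_iff)
    next
      case False
      then show ?thesis
        using gpd.mult_closed[OF gpd.single_closed[OF one] fB] gpd.mult_closed[OF fB gpd.single_closed[OF one]] fB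
        unfolding gpd.carrier_iff by metis
    qed
    then show "f \<in> carrier ?C"
      using fB by (auto simp: gpd_alg_eq fun_eq_iff)
  qed (use supp in blast)
  have h_closed: "h f \<in> carrier (stab_alg G A)" for f
    unfolding stab_alg_eq basis_alg_carrier_iff[OF finite_stab] by (simp add: h_def)
  have "h \<in> alg_iso ?C (stab_alg G A)"
  proof (rule alg_isoI[where k = k])
    fix f assume f: "f \<in> carrier ?C"
    then show "k (h f) = f"
      using supp[OF f] by (auto simp: h_def k_def fun_eq_iff)
    show "h (a \<odot>\<^bsub>?C\<^esub> f) = a \<odot>\<^bsub>stab_alg G A\<^esub> h f" for a
      by (auto simp: h_def gpd_alg_eq stab_alg_eq basis_alg_simps(6))
    fix g assume g: "g \<in> carrier ?C"
    show "h (f \<oplus>\<^bsub>?C\<^esub> g) = h f \<oplus>\<^bsub>stab_alg G A\<^esub> h g"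
      by (auto simp: h_def gpd_alg_eq stab_alg_eq basis_alg_simps(5))
    have fB: "f \<in> carrier gpd.B" and gB: "g \<in> carrier gpd.B"
      using f g by (auto simp: gpd_alg_eq)
    show "h (f \<otimes>\<^bsub>?C\<^esub> g) = h f \<otimes>\<^bsub>stab_alg G A\<^esub> h g"
    proof
      fix c
      \<comment> \<open>Both factors live on the loops at A, so the double sum over all arrows
        reduces to a double sum over the stabiliser, where products are always defined.\<close>
      have supp_sum: "(\<Sum>x\<in>gpd G H. F x) = (\<Sum>a\<in>stab G A. F (A, a))"
        if F: "\<And>D a. \<not> (D = A \<and> a \<in> stab G A) \<Longrightarrow> F (D, a) = 0" for F :: "'a set \<times> 'a \<Rightarrow> complex"
      proof -
        have "F x = 0" if "x \<notin> Pair A ` stab G A" for x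
        proof -
          obtain D a where "x = (D, a)" by (cases x)
          then show ?thesis using F[of D a] that by blast
        qed
        then have "(\<Sum>x\<in>gpd G H. F x) = (\<Sum>x\<in>Pair A ` stab G A. F x)"
          by (intro sum.mono_neutral_right) (use finite_gpd mem_gpd_stab[OF A] in auto)
        then show ?thesis
          by (simp add: sum.reindex inj_on_def)
      qed
      have "(f \<otimes>\<^bsub>gpd.B\<^esub> g) (A, c) =
          (\<Sum>x\<in>gpd G H. \<Sum>y\<in>gpd G H. if gpd_mult G x y = Some (A, c) then f x * g y else 0)"
        by (rule gpd.mult_eq[OF fB gB])
      also have "\<dots> = (\<Sum>a\<in>stab G A. \<Sum>y\<in>gpd G H. if gpd_mult G (A, a) y = Some (A, c) then f (A, a) * g y else 0)"
        by (rule supp_sum) (simp add: supp[OF f] cong: if_cong)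
      also have "\<dots> = (\<Sum>a\<in>stab G A. \<Sum>b\<in>stab G A. if gpd_mult G (A, a) (A, b) = Some (A, c) then f (A, a) * g (A, b) else 0)"
        by (rule sum.cong[OF refl], rule supp_sum) (simp add: supp[OF g] cong: if_cong)
      also have "\<dots> = (\<Sum>a\<in>stab G A. \<Sum>b\<in>stab G A. if Some (a \<otimes> b) = Some c then h f a * h g b else 0)"
        by (intro sum.cong refl) (auto simp: gpd_mult_eq stab_iff h_def)
      also have "\<dots> = (h f \<otimes>\<^bsub>stab_alg G A\<^esub> h g) c"
        unfolding stab_alg_eq
        by (rule basis_alg_mult[OF finite_stab, symmetric]) (use h_closed stab_alg_eq in auto)
      finally have "(f \<otimes>\<^bsub>gpd.B\<^esub> g) (A, c) = (h f \<otimes>\<^bsub>stab_alg G A\<^esub> h g) c" .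
      moreover have "(h f \<otimes>\<^bsub>stab_alg G A\<^esub> h g) c = 0" if "c \<notin> stab G A"
        using finite_groupoid.mult_closed[OF finite_groupoid_stab[OF Ac(1)]] h_closed that
        unfolding stab_alg_eq basis_alg_carrier_iff[OF finite_stab] by blast
      ultimately show "h (f \<otimes>\<^bsub>?C\<^esub> g) c = (h f \<otimes>\<^bsub>stab_alg G A\<^esub> h g) c"
        by (simp add: h_def gpd_alg_eq)
    qed
  next
    show "h \<one>\<^bsub>?C\<^esub> = \<one>\<^bsub>stab_alg G A\<^esub>"
      using Ac lcos_mult_one by (auto simp: h_def stab_alg_eq basis_alg_simps(3) gpd.single_def stab_iff)
  next
    fix f assume "f \<in> carrier (stab_alg G A)"
    then have f: "f g = 0" if "g \<notin> stab G A" for g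
      using that unfolding stab_alg_eq basis_alg_carrier_iff[OF finite_stab] by blast
    show "k f \<in> carrier ?C"
      unfolding carrier using f by (auto simp: k_def)
    show "h (k f) = f"
      using f by (auto simp: h_def k_def)
  qed (rule h_closed)
  then show ?thesis
    by (auto simp: alg_isomorphic_def)
qed

text \<open>In each component the arrows \<open>(A k, x k a)\<close> from the chosen object
  \<open>A k\<close> to the objects \<open>b k a\<close> serve as u, and their inverses as v. Then u
  v is the identity of \<open>b k a\<close> and v u that of \<open>A k\<close>, while v u is zero
  when the two arrows end in different objects. The index set K is arbitrary so that pairs (i, j)
  can be used.\<close>

theorem gpd_alg_decomposition:
  assumes bij: "bij_betw \<Gamma> K (gpd_components G H)"
    and obj: "\<And>k. k \<in> K \<Longrightarrow> A k \<in> gpd_objects (\<Gamma> k)"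
  shows "gpd_alg G H \<simeq>\<^sub>a\<^sub>l\<^sub>g prod_alg K (\<lambda>k. mat_alg (comp_size G H (A k)) (stab_alg G (A k)))"
proof -
  let ?R = "gpd_connected G H"
  define Y where "Y k = gpd_objects (\<Gamma> k)" for k
  define m where "m k = comp_size G H (A k)" for k
  have "Y = gpd_objects \<circ> \<Gamma>"
    by (simp add: Y_def fun_eq_iff)
  then have Y: "bij_betw Y K (coset_unions G H // ?R)"
    using bij_betw_trans[OF bij gpd_objects_bij] by simp
  have finK: "finite K"
    using bij_betw_finite[OF Y] finite_quotient[OF finite_coset_unions, of ?R] by (auto simp: gpd_connected_def)
  have Yq: "Y k \<in> coset_unions G H // ?R" if "k \<in> K" for k
    using Y that by (auto simp: bij_betw_def)
  have Ysub: "Y k \<subseteq> coset_unions G H" if "k \<in> K" for k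
    using in_quotient_imp_subset[OF equiv_gpd_connected Yq[OF that]] .
  have AY: "A k \<in> Y k" if "k \<in> K" for k
    using obj[OF that] by (simp add: Y_def)
  have A: "A k \<in> coset_unions G H" if "k \<in> K" for k
    using AY[OF that] Ysub[OF that] by blast
  \<comment> \<open>\<open>comp_size\<close> counts the class of \<open>A k\<close>; this is the
    object set of component k because \<open>A k\<close> belongs to it.\<close>
  have "?R `` {A k} = Y k" if "k \<in> K" for k
    using quotient_eqI[OF equiv_gpd_connected quotientI[OF A[OF that]] Yq[OF that] _ AY[OF that], of "A k"]
      equiv_class_self[OF equiv_gpd_connected A[OF that]] equiv_gpd_connected A[OF that]
    by (auto simp: equiv_def refl_on_def)
  then have m: "m k = card (Y k)" and conn: "\<And>D. D \<in> Y k \<Longrightarrow> (A k, D) \<in> ?R" if "k \<in> K" for k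
    using that by (auto simp: m_def comp_size_def)
  have finY: "finite (Y k)" if "k \<in> K" for k
    using finite_subset[OF Ysub[OF that] finite_coset_unions] .
  have "\<forall>k\<in>K. \<exists>b. bij_betw b {..<m k} (Y k)"
    using finY ex_bij_betw_nat_finite m by (metis atLeast0LessThan)
  then obtain b where b: "\<And>k. k \<in> K \<Longrightarrow> bij_betw (b k) {..<m k} (Y k)"
    by metis
  have bY: "b k a \<in> Y k" if "k \<in> K" "a < m k" for k a
    using b[OF that(1)] that(2) by (auto simp: bij_betw_def)
  have "\<forall>k\<in>K. \<forall>a\<in>{..<m k}. \<exists>g. (A k, g) \<in> gpd G H \<and> b k a = g <# A k"
    using conn bY by (auto simp: gpd_connected_iff)
  then obtain x where x: "\<And>k a. k \<in> K \<Longrightarrow> a < m k \<Longrightarrow> (A k, x k a) \<in> gpd G H"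
    and xA: "\<And>k a. k \<in> K \<Longrightarrow> a < m k \<Longrightarrow> x k a <# A k = b k a"
    by (metis lessThan_iff)
  have xG: "x k a \<in> carrier G" if "k \<in> K" "a < m k" for k a
    using x[OF that] by (simp add: gpd_iff)
  have AG: "A k \<subseteq> carrier G" if "k \<in> K" for k
    using coset_unionsD(1)[OF A[OF that]] .
  have x': "(b k a, inv (x k a)) \<in> gpd G H" if "k \<in> K" "a < m k" for k a
    using gpd_inv_closed[OF x[OF that]] xA[OF that] by simp
  have xA': "inv (x k a) <# b k a = A k" if "k \<in> K" "a < m k" for k a
    using l_coset_inverse(1)[OF AG[OF that(1)] xG[OF that]] xA[OF that] by simp
  have bG: "b k a \<subseteq> carrier G" if "k \<in> K" "a < m k" for k a
    using coset_unionsD(1) Ysub bY that by blast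
  define p where "p k = gpd.single (A k, \<one>)" for k
  define u where "u k a = gpd.single (A k, x k a)" for k a
  define v where "v k a = gpd.single (b k a, inv (x k a))" for k a
  have pc: "p k \<in> carrier gpd.B" if "k \<in> K" for k
    unfolding p_def using gpd_one[OF A[OF that]] by (rule gpd.single_closed)
  have uc: "u k a \<in> carrier gpd.B" if "k \<in> K" "a < m k" for k a
    unfolding u_def using x[OF that] by (rule gpd.single_closed)
  have vc: "v k a \<in> carrier gpd.B" if "k \<in> K" "a < m k" for k a
    unfolding v_def using x'[OF that] by (rule gpd.single_closed)
  have pp: "p k \<otimes>\<^bsub>gpd.B\<^esub> p k = p k" if "k \<in> K" for k
    unfolding p_def using gpd.single_mult_single[OF gpd_one gpd_one, OF A A, OF that that] AG[OF that]
    by (simp add: gpd_mult_eq lcos_mult_one)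
  have "gpd.B \<simeq>\<^sub>a\<^sub>l\<^sub>g prod_alg K (\<lambda>k. mat_alg (m k) (corner gpd.B (p k)))"
  proof (rule gpd.B.peirce_decomposition[where u = u and v = v])
    fix k a assume k: "k \<in> K" and a: "a < m k"
    show "u k a \<otimes>\<^bsub>gpd.B\<^esub> p k = u k a"
      unfolding u_def p_def using gpd.single_mult_single[OF x gpd_one, OF k a A[OF k]] AG[OF k] xG[OF k a]
      by (simp add: gpd_mult_eq lcos_mult_one)
    show "p k \<otimes>\<^bsub>gpd.B\<^esub> v k a = v k a"
      unfolding v_def p_def using gpd.single_mult_single[OF gpd_one x', OF A[OF k] k a] xA'[OF k a] xG[OF k a]
      by (simp add: gpd_mult_eq)
    fix c assume c: "c < m k"
    have "b k a = b k c \<longleftrightarrow> a = c"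
      using b[OF k] a c by (auto simp: bij_betw_def dest: inj_onD)
    then show "v k a \<otimes>\<^bsub>gpd.B\<^esub> u k c = (if a = c then p k else \<zero>\<^bsub>gpd.B\<^esub>)"
      unfolding v_def p_def u_def
      using gpd.single_mult_single[OF x' x, OF k a k c] xA[OF k c] xG[OF k a] by (auto simp: gpd_mult_eq basis_alg_simps(4))
  next
    fix k l a c f assume k: "k \<in> K" and l: "l \<in> K" and "k \<noteq> l" and a: "a < m k" and c: "c < m l"
      and f: "f \<in> carrier gpd.B"
    \<comment> \<open>A nonzero coefficient at (D, d) requires the arrow (D, d) to have range
      \<open>A k\<close> and source \<open>A l\<close>; it would connect two different
      components.\<close>
    have "(v k a \<otimes>\<^bsub>gpd.B\<^esub> (f \<otimes>\<^bsub>gpd.B\<^esub> u l c)) (D, d) = 0" for D d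
    proof (cases "(D, d) \<in> gpd G H")
      case True
      show ?thesis
      proof (rule ccontr)
        assume nz: "\<not> ?thesis"
        have "d \<in> carrier G"
          using True by (simp add: gpd_iff)
        have "(case gpd_mult G (A k, x k a) (D, d) of None \<Rightarrow> 0 | Some y \<Rightarrow> (f \<otimes>\<^bsub>gpd.B\<^esub> u l c) y) \<noteq> 0"
          using nz gpd.single_mult[OF x'[OF k a] gpd.mult_closed[OF f uc[OF l c]] True] xA'[OF k a] xG[OF k a]
          by (simp add: v_def gpd_inv_simp)
        then have Ak: "A k = d <# D" and nz': "(f \<otimes>\<^bsub>gpd.B\<^esub> u l c) (D, x k a \<otimes> d) \<noteq> 0"
          by (auto simp: gpd_mult_eq split: if_splits)
        have "(D, x k a \<otimes> d) \<in> gpd G H"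
          using gpd_closed[of d D "x k a"] x[OF k a] True Ak by simp
        then have "D = A l"
          using nz' gpd.mult_single[OF x[OF l c] f, of "(D, x k a \<otimes> d)"] xA'[OF l c] xA[OF l c]
          by (auto simp: u_def gpd_inv_simp gpd_mult_eq split: if_splits)
        then have "(A l, A k) \<in> ?R"
          using True Ak by (auto simp: gpd_connected_iff)
        then have "Y l = Y k"
          using quotient_eq_iff[OF equiv_gpd_connected Yq[OF l] Yq[OF k] AY[OF l] AY[OF k]] by simp
        then show False
          using Y k l \<open>k \<noteq> l\<close> by (auto simp: bij_betw_def dest: inj_onD)
      qed
    next
      case False
      then show ?thesis
        using gpd.mult_closed[OF vc[OF k a] gpd.mult_closed[OF f uc[OF l c]]] unfolding gpd.carrier_iff by blast
    qed
    then show "v k a \<otimes>\<^bsub>gpd.B\<^esub> f \<otimes>\<^bsub>gpd.B\<^esub> u l c = \<zero>\<^bsub>gpd.B\<^esub>"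
      using gpd.mult_assoc[OF vc[OF k a] f uc[OF l c]] by (auto simp: basis_alg_simps(4))
  next
    have uv: "u k a \<otimes>\<^bsub>gpd.B\<^esub> v k a = gpd.single (b k a, \<one>)" if "k \<in> K" "a < m k" for k a
      unfolding u_def v_def using gpd.single_mult_single[OF x x', OF that that] xA'[OF that] xG[OF that]
      by (simp add: gpd_mult_eq)
    have uvc: "u k a \<otimes>\<^bsub>gpd.B\<^esub> v k a \<in> carrier gpd.B" if "k \<in> K" "a < m k" for k a
      using uc[OF that] vc[OF that] by (rule gpd.mult_closed)
    \<comment> \<open>Evaluated at z, the sum runs over the identities of the objects, class by
      class. The classes partition the objects, so the unit of the groupoid algebra results.\<close>
    have "(\<Oplus>\<^bsub>gpd.B\<^esub>k\<in>K. \<Oplus>\<^bsub>gpd.B\<^esub>a\<in>{..<m k}. u k a \<otimes>\<^bsub>gpd.B\<^esub> v k a) z = \<one>\<^bsub>gpd.B\<^esub> z" for z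
    proof -
      have "(\<Oplus>\<^bsub>gpd.B\<^esub>k\<in>K. \<Oplus>\<^bsub>gpd.B\<^esub>a\<in>{..<m k}. u k a \<otimes>\<^bsub>gpd.B\<^esub> v k a) z =
          (\<Sum>k\<in>K. (\<Oplus>\<^bsub>gpd.B\<^esub>a\<in>{..<m k}. u k a \<otimes>\<^bsub>gpd.B\<^esub> v k a) z)"
        by (rule gpd.finsum_apply[OF finK], rule gpd.B.finsum_closed) (use uvc in auto)
      also have "\<dots> = (\<Sum>k\<in>K. \<Sum>a<m k. (u k a \<otimes>\<^bsub>gpd.B\<^esub> v k a) z)"
        by (rule sum.cong[OF refl], rule gpd.finsum_apply) (use uvc in auto)
      also have "\<dots> = (\<Sum>k\<in>K. \<Sum>D\<in>Y k. gpd.single (D, \<one>) z)"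
      proof (rule sum.cong[OF refl])
        fix k assume k: "k \<in> K"
        have "(\<Sum>a<m k. (u k a \<otimes>\<^bsub>gpd.B\<^esub> v k a) z) = (\<Sum>a<m k. gpd.single (b k a, \<one>) z)"
          by (rule sum.cong[OF refl]) (use uv k in simp)
        also have "\<dots> = (\<Sum>D\<in>Y k. gpd.single (D, \<one>) z)"
          by (rule sum.reindex_bij_betw[OF b[OF k]])
        finally show "(\<Sum>a<m k. (u k a \<otimes>\<^bsub>gpd.B\<^esub> v k a) z) = (\<Sum>D\<in>Y k. gpd.single (D, \<one>) z)" .
      qed
      also have "\<dots> = (\<Sum>D\<in>(\<Union>k\<in>K. Y k). gpd.single (D, \<one>) z)"
      proof (rule sum.UNION_disjoint[symmetric])
        show "\<forall>k\<in>K. \<forall>l\<in>K. k \<noteq> l \<longrightarrow> Y k \<inter> Y l = {}"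
          using quotient_disj[OF equiv_gpd_connected] Yq Y by (metis bij_betw_def inj_onD)
      qed (use finK finY in auto)
      also have "(\<Union>k\<in>K. Y k) = coset_unions G H"
        using Y Union_quotient[OF equiv_gpd_connected] by (simp add: bij_betw_def)
      also have "(\<Sum>D\<in>coset_unions G H. gpd.single (D, \<one>) z) = \<one>\<^bsub>gpd.B\<^esub> z"
      proof -
        obtain E e where z: "z = (E, e)"
          by (cases z)
        have "(\<Sum>D\<in>coset_unions G H. gpd.single (D, \<one>) z) =
            (\<Sum>D\<in>coset_unions G H. if D = E then (if e = \<one> then 1 else 0) else 0)"
          by (rule sum.cong[OF refl]) (auto simp: gpd.single_def z)
        then show ?thesis
          using finite_coset_unions by (auto simp: sum.delta basis_alg_simps(3) z)
      qed
      finally show ?thesis .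
    qed
    then show "(\<Oplus>\<^bsub>gpd.B\<^esub>k\<in>K. \<Oplus>\<^bsub>gpd.B\<^esub>a\<in>{..<m k}. u k a \<otimes>\<^bsub>gpd.B\<^esub> v k a) = \<one>\<^bsub>gpd.B\<^esub>"
      by auto
  qed (use finK pc pp uc vc in auto)
  also have "\<dots> \<simeq>\<^sub>a\<^sub>l\<^sub>g prod_alg K (\<lambda>k. mat_alg (m k) (stab_alg G (A k)))"
  proof (intro prod_alg_cong mat_alg_cong)
    fix k assume k: "k \<in> K"
    show "ring (corner gpd.B (p k))"
      using pc[OF k] pp[OF k] by (rule gpd.B.ring_corner)
    show "ring (stab_alg G (A k))"
      unfolding stab_alg_eq by (rule finite_groupoid.ring_B[OF finite_groupoid_stab[OF AG[OF k]]])
    show "corner gpd.B (p k) \<simeq>\<^sub>a\<^sub>l\<^sub>g stab_alg G (A k)"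
      using corner_isomorphic_stab_alg[OF A[OF k]] by (simp add: p_def gpd_alg_eq)
  qed
  finally show ?thesis
    by (simp add: gpd_alg_eq m_def)
qed

end

section \<open>The structure theorem\<close>

text \<open>Matrices over a product split into a product of matrix algebras, and each factor of m by
  m matrices with \<open>d k\<close> by \<open>d k\<close> blocks is flattened; the positivity of
  \<open>d k\<close> enters in the flattening.\<close>

lemma mat_alg_artin_wedderburn:
  assumes "ring R" and "artin_wedderburn R e d"
  shows "mat_alg m R \<simeq>\<^sub>a\<^sub>l\<^sub>g prod_alg {1..e} (\<lambda>k. complex_mat_alg (m * d k))"
proof -
  have "mat_alg m R \<simeq>\<^sub>a\<^sub>l\<^sub>g mat_alg m (prod_alg {1..e} (\<lambda>k. complex_mat_alg (d k)))"
    using assms by (intro mat_alg_cong ring_prod_alg ring_complex_mat_alg) (auto simp: artin_wedderburn_def)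
  also have "\<dots> \<simeq>\<^sub>a\<^sub>l\<^sub>g prod_alg {1..e} (\<lambda>k. mat_alg m (complex_mat_alg (d k)))"
    by (intro mat_alg_prod_alg ring_complex_mat_alg)
  also have "\<dots> \<simeq>\<^sub>a\<^sub>l\<^sub>g prod_alg {1..e} (\<lambda>k. complex_mat_alg (m * d k))"
    using assms(2) by (intro prod_alg_cong mat_alg_complex_mat_alg) (auto simp: artin_wedderburn_def Suc_le_eq)
  finally show ?thesis .
qed

theorem theorem3p15:
  fixes G :: "('g, 'm) monoid_scheme"
    and H :: "'g set"
    and n :: nat
    and c :: "nat \<Rightarrow> nat"
    and \<Gamma> :: "nat \<Rightarrow> nat \<Rightarrow> ('g set \<times> 'g) set"
    and A :: "nat \<Rightarrow> nat \<Rightarrow> 'g set"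
  assumes "group G"
    and "finite (carrier G)"
    and "subgroup H G"
    and index: "n = card (rcosets\<^bsub>G\<^esub> H)"
    and decomposition:
      "bij_betw (\<lambda>(i, j). \<Gamma> i j) (SIGMA i:{1..n}. {1..c i}) (gpd_components G H)"
    and object_card:
      "\<forall>i\<in>{1..n}. \<forall>j\<in>{1..c i}. \<forall>B\<in>gpd_objects (\<Gamma> i j). card B = i * card H"
    and object: "\<forall>i\<in>{1..n}. \<forall>j\<in>{1..c i}. A i j \<in> gpd_objects (\<Gamma> i j)"
  shows
    "gpd_alg G H \<simeq>\<^sub>a\<^sub>l\<^sub>g
       prod_alg {1..n} (\<lambda>i. prod_alg {1..c i} (\<lambda>j.
         mat_alg (comp_size G H (A i j)) (stab_alg G (A i j)))) \<and>
     (\<exists>e d. \<forall>i\<in>{1..n}. \<forall>j\<in>{1..c i}. artin_wedderburn (stab_alg G (A i j)) (e i j) (d i j)) \<and>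
     (\<forall>e d. (\<forall>i\<in>{1..n}. \<forall>j\<in>{1..c i}. artin_wedderburn (stab_alg G (A i j)) (e i j) (d i j)) \<longrightarrow>
       prod_alg {1..n} (\<lambda>i. prod_alg {1..c i} (\<lambda>j.
         mat_alg (comp_size G H (A i j)) (stab_alg G (A i j)))) \<simeq>\<^sub>a\<^sub>l\<^sub>g
       prod_alg {1..n} (\<lambda>i. prod_alg {1..c i} (\<lambda>j. prod_alg {1..e i j} (\<lambda>k.
         complex_mat_alg (comp_size G H (A i j) * d i j k))))) \<and>
     semisimple_ring (gpd_alg G H)"
proof -
  interpret finite_group_subgroup G H
    using assms(1-3) by (simp add: finite_group_subgroup_def finite_group_subgroup_axioms_def)
  let ?K = "SIGMA i:{1..n}. {1..c i}"
  \<comment> \<open>An object of a component is the source of an arrow, hence a subset of the group;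
    this makes its stabiliser a subgroup.\<close>
  have sub: "A i j \<subseteq> carrier G" if "i \<in> {1..n}" "j \<in> {1..c i}" for i j
  proof -
    have "\<Gamma> i j \<in> gpd_components G H"
      using bij_betw_apply[OF decomposition, of "(i, j)"] that by simp
    then show ?thesis
      using object that coset_unionsD(1) by (fastforce simp: gpd_components_def gpd_objects_def gpd_source_def gpd_iff)
  qed
  have groupoid: "finite_groupoid (stab G (A i j)) (\<lambda>x y. Some (x \<otimes>\<^bsub>G\<^esub> y)) {\<one>\<^bsub>G\<^esub>}
      (m_inv (G\<lparr>carrier := stab G (A i j)\<rparr>))" if "i \<in> {1..n}" "j \<in> {1..c i}" for i j
    using sub[OF that] by (rule finite_groupoid_stab)
  have ring: "ring (stab_alg G (A i j))" if "i \<in> {1..n}" "j \<in> {1..c i}" for i j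
    unfolding stab_alg_eq using groupoid[OF that] by (rule finite_groupoid.ring_B)
  have "(case k of (i, j) \<Rightarrow> A i j) \<in> gpd_objects (case k of (i, j) \<Rightarrow> \<Gamma> i j)" if "k \<in> ?K" for k
    using object that by auto
  note gpd_alg_decomposition[OF decomposition this]
  also have "(\<lambda>k. mat_alg (comp_size G H (case k of (i, j) \<Rightarrow> A i j)) (stab_alg G (case k of (i, j) \<Rightarrow> A i j))) =
      (\<lambda>(i, j). mat_alg (comp_size G H (A i j)) (stab_alg G (A i j)))"
    by auto
  also have "prod_alg ?K (\<lambda>(i, j). mat_alg (comp_size G H (A i j)) (stab_alg G (A i j))) \<simeq>\<^sub>a\<^sub>l\<^sub>g
      prod_alg {1..n} (\<lambda>i. prod_alg {1..c i} (\<lambda>j. mat_alg (comp_size G H (A i j)) (stab_alg G (A i j))))"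
    by (rule prod_alg_Sigma)
  finally have 1: "gpd_alg G H \<simeq>\<^sub>a\<^sub>l\<^sub>g prod_alg {1..n} (\<lambda>i. prod_alg {1..c i} (\<lambda>j.
      mat_alg (comp_size G H (A i j)) (stab_alg G (A i j))))" .
  have "\<exists>e d. artin_wedderburn (stab_alg G (A i j)) e d" if "i \<in> {1..n}" "j \<in> {1..c i}" for i j
  proof -
    interpret K: finite_groupoid "stab G (A i j)" "\<lambda>x y. Some (x \<otimes>\<^bsub>G\<^esub> y)" "{\<one>\<^bsub>G\<^esub>}"
      "m_inv (G\<lparr>carrier := stab G (A i j)\<rparr>)"
      using that by (rule groupoid)
    show ?thesis
      unfolding stab_alg_eq by (rule K.B.artin_wedderburn_exists[OF K.semisimple K.dim_le_card])
  qed
  \<comment> \<open>The ranges are moved into the implication so that e and d can be chosen as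
    functions of all i and j.\<close>
  then have "\<forall>i j. \<exists>e d. i \<in> {1..n} \<longrightarrow> j \<in> {1..c i} \<longrightarrow> artin_wedderburn (stab_alg G (A i j)) e d"
    by blast
  then have 2: "\<exists>e d. \<forall>i\<in>{1..n}. \<forall>j\<in>{1..c i}. artin_wedderburn (stab_alg G (A i j)) (e i j) (d i j)"
    by metis
  have 3: "prod_alg {1..n} (\<lambda>i. prod_alg {1..c i} (\<lambda>j.
        mat_alg (comp_size G H (A i j)) (stab_alg G (A i j)))) \<simeq>\<^sub>a\<^sub>l\<^sub>g
      prod_alg {1..n} (\<lambda>i. prod_alg {1..c i} (\<lambda>j. prod_alg {1..e i j} (\<lambda>k.
        complex_mat_alg (comp_size G H (A i j) * d i j k))))"
    if "\<forall>i\<in>{1..n}. \<forall>j\<in>{1..c i}. artin_wedderburn (stab_alg G (A i j)) (e i j) (d i j)" for e d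
    using that ring by (intro prod_alg_cong mat_alg_artin_wedderburn) auto
  have "semisimple_ring (gpd_alg G H)"
    unfolding gpd_alg_eq by (rule gpd.semisimple)
  then show ?thesis
    using 1 2 3 by blast
qed

end
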